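(* Let $f$ be a smooth function on $(-\epsilon_0,\epsilon_0)$ for some $\epsilon_0>0$, let $\tau_0>0$ be a constant, and let $\{\mu_\ell\}_{\ell\ge1}$ be the index set associated with $\tau_0$. Assume that $v$ is a solution of $$\partial_{tt}v+\partial_{\theta\theta}v=e^{-\tau_0t}f(v)$$ on $[t_0,\infty)\times\mathbb S^1$ for some $t_0\ge0$ such that $v(t,\theta)$ converges to $0$ exponentially as $t\to\infty$, uniformly in $\theta\in\mathbb S^1$. Then there exists a sequence $\mathcal X=\{X_i\}_{i\ge1}$ of spherical harmonics with $X_i\in\mathscr E_i$ such that, for any $\ell\ge1$ and any $(t,\theta)\in[t_0,\infty)\times\mathbb S^1$, $$\Big|v(t,\theta)-\sum_{j=1}^\ell P_j(\mathcal X)(\theta)e^{-\mu_jt}\Big|\le C_\ell e^{-\mu_{\ell+1}t},$$ where $\{P_\ell(\mathcal X)\}_{\ell\ge1}$ is the sequence of smooth functions on $\mathbb S^1$ determined by $\mathcal X$ (as defined in the context), and $C_\ell>0$ is a constant depending only on $v$ and $\ell$.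
   Context: $\mathbb S^1$ is the unit circle with angular variable $\theta$; $\mathscr E_0$ is the space of constants, and $\mathscr E_i=\mathrm{span}_{\mathbb R}\{\cos(i\theta),\sin(i\theta)\}$ for $i\ge1$. $\mathbb Z_+$ denotes the nonnegative integers. Solutions $v$ are smooth and satisfy $|v|<\epsilon_0$ on $[t_0,\infty)\times\mathbb S^1$. "$v$ converges to $0$ exponentially as $t\to\infty$, uniformly in $\theta$" means $|v(t,\theta)|\le C_*e^{-\gamma t}$ for all $t\ge t_0$, $\theta\in\mathbb S^1$, for some positive constants $C_*,\gamma$. The numbers $a_j$ are the Taylor coefficients of $f$ at $0$: $f(s)\sim\sum_{j\ge0}a_js^j$, $a_j=f^{(j)}(0)/j!$. Index set. Set $\rho_0=\tau_0$ and $\rho_i=i$ for $i\ge1$. The index set associated with $\tau_0$ is the set of all nonzero sums $\sum_{i\ge0}m_i\rho_i$ with $m_i\in\mathbb Z_+$, finitely many $m_i>0$; it is written as a strictly increasing sequence $\{\mu_\ell\}_{\ell\ge1}$ of positive numbers. The sequence $P_\ell=P_\ell(\mathcal X)$ is determined recursively in $\ell\ge1$ by: (1) if $\mu_\ell<\rho_0$, then $\mu_\ell=\ell$ and $P_\ell=X_\ell$; (2) if $\mu_\ell=\rho_0$, then $P_\ell=a_0/\rho_0^2$ if $\rho_0$ is not an integer, and $P_\ell=a_0/\rho_0^2+X_{\rho_0}$ if $\rho_0$ is an integer; (3) if $\mu_\ell>\rho_0$ and $\mu_\ell\ne\rho_0+\mu_m$ for all $m\ge1$, then $\mu_\ell$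 is an integer and $P_\ell=X_{\mu_\ell}$; (4) if $\mu_\ell>\rho_0$ and $\mu_\ell=\rho_0+\mu_m$ for some $1\le m<\ell$, consider $$(\ast)\qquad \partial_{\theta\theta}P+\mu_\ell^2P=\sum_{j=1}^m a_j\sum_{\mu_{k_1}+\cdots+\mu_{k_j}=\mu_m}P_{k_1}\cdots P_{k_j}\quad\text{on }\mathbb S^1,$$ the inner sum being over all tuples $(k_1,\dots,k_j)$ of positive integers with the indicated property. (4a) If $\mu_\ell$ is not an integer, $P_\ell$ is the unique solution of $(\ast)$. (4b) If $\mu_\ell$ is an integer, $P_\ell=X_{\mu_\ell}+Q_\ell$, where $Q_\ell$ is the unique solution of $(\ast)$ orthogonal to $\mathscr E_{\mu_\ell}$ in $L^2(\mathbb S^1)$. *)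

theory Defs
  imports "HOL-Analysis.Analysis"
begin

text \<open>
  Functions on the unit circle are represented by \<open>2 * pi\<close>-periodic functions of the angular
  variable, functions on \<open>{t0..} \<times> S^1\<close> by curried functions of \<open>t\<close> and the angle.
\<close>

definition smooth_on_open :: "real set \<Rightarrow> (real \<Rightarrow> real) \<Rightarrow> bool" where
  "smooth_on_open S g \<longleftrightarrow> (\<forall>k. \<forall>x\<in>S. ((deriv ^^ k) g) differentiable (at x))"

definition taylor_coeff :: "(real \<Rightarrow> real) \<Rightarrow> nat \<Rightarrow> real" where
  "taylor_coeff f j = (deriv ^^ j) f 0 / fact j"

definition smooth_circle :: "(real \<Rightarrow> real) \<Rightarrow> bool" where
  "smooth_circle g \<longleftrightarrow> (\<forall>\<theta>. g (\<theta> + 2 * pi) = g \<theta>) \<and> smooth_on_open UNIV g"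

definition spherical_harmonics :: "nat \<Rightarrow> (real \<Rightarrow> real) set" where
  "spherical_harmonics i =
     (if i = 0 then {\<lambda>\<theta>. c | c. True}
      else {\<lambda>\<theta>. c * cos (real i * \<theta>) + d * sin (real i * \<theta>) | c d. True})"

definition L2_circle_inner :: "(real \<Rightarrow> real) \<Rightarrow> (real \<Rightarrow> real) \<Rightarrow> real" where
  "L2_circle_inner g h = integral {0..2 * pi} (\<lambda>\<theta>. g \<theta> * h \<theta>)"

text \<open>
  The \<open>t\<close>-derivative is taken within \<open>{t0..}\<close>, so it is one-sided at \<open>t = t0\<close> and does not depend
  on the values of the function for \<open>t < t0\<close>.
\<close>

definition partial_t :: "real \<Rightarrow> (real \<Rightarrow> real \<Rightarrow> real) \<Rightarrow> (real \<Rightarrow> real \<Rightarrow> real)" where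
  "partial_t t0 F = (\<lambda>t \<theta>. vector_derivative (\<lambda>s. F s \<theta>) (at t within {t0..}))"

definition partial_th :: "(real \<Rightarrow> real \<Rightarrow> real) \<Rightarrow> (real \<Rightarrow> real \<Rightarrow> real)" where
  "partial_th F = (\<lambda>t \<theta>. deriv (F t) \<theta>)"

primrec C_k_cylinder :: "real \<Rightarrow> nat \<Rightarrow> (real \<Rightarrow> real \<Rightarrow> real) \<Rightarrow> bool" where
  "C_k_cylinder t0 0 F \<longleftrightarrow> continuous_on ({t0..} \<times> UNIV) (\<lambda>(t, \<theta>). F t \<theta>)"
| "C_k_cylinder t0 (Suc k) F \<longleftrightarrow>
     continuous_on ({t0..} \<times> UNIV) (\<lambda>(t, \<theta>). F t \<theta>) \<and>
     (\<forall>t\<ge>t0. \<forall>\<theta>. (\<lambda>s. F s \<theta>) differentiable (at t within {t0..}) \<and> F t differentiable (at \<theta>)) \<and>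
     C_k_cylinder t0 k (partial_t t0 F) \<and> C_k_cylinder t0 k (partial_th F)"

definition smooth_cylinder :: "real \<Rightarrow> (real \<Rightarrow> real \<Rightarrow> real) \<Rightarrow> bool" where
  "smooth_cylinder t0 F \<longleftrightarrow>
     (\<forall>t\<ge>t0. \<forall>\<theta>. F t (\<theta> + 2 * pi) = F t \<theta>) \<and> (\<forall>k. C_k_cylinder t0 k F)"

definition is_solution ::
  "real \<Rightarrow> real \<Rightarrow> (real \<Rightarrow> real) \<Rightarrow> real \<Rightarrow> (real \<Rightarrow> real \<Rightarrow> real) \<Rightarrow> bool" where
  "is_solution \<epsilon>0 \<tau>0 f t0 v \<longleftrightarrow>
     smooth_cylinder t0 v \<and>
     (\<forall>t\<ge>t0. \<forall>\<theta>. \<bar>v t \<theta>\<bar> < \<epsilon>0) \<and>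
     (\<forall>t\<ge>t0. \<forall>\<theta>. partial_t t0 (partial_t t0 v) t \<theta> + partial_th (partial_th v) t \<theta>
                 = exp (- \<tau>0 * t) * f (v t \<theta>))"

definition converges_exponentially :: "real \<Rightarrow> (real \<Rightarrow> real \<Rightarrow> real) \<Rightarrow> bool" where
  "converges_exponentially t0 v \<longleftrightarrow>
     (\<exists>C>0. \<exists>\<gamma>>0. \<forall>t\<ge>t0. \<forall>\<theta>. \<bar>v t \<theta>\<bar> \<le> C * exp (- \<gamma> * t))"

definition rho :: "real \<Rightarrow> nat \<Rightarrow> real" where
  "rho \<tau>0 i = (if i = 0 then \<tau>0 else real i)"

definition index_set :: "real \<Rightarrow> real set" where
  "index_set \<tau>0 =
     {s. s \<noteq> 0 \<and> (\<exists>m :: nat \<Rightarrow> nat. finite {i. m i > 0} \<and>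
                      s = (\<Sum>i\<in>{i. m i > 0}. real (m i) * rho \<tau>0 i))}"

text \<open>Sequences indexed by the positive integers are functions on \<open>nat\<close> whose value at \<open>0\<close> is ignored.\<close>

definition is_index_sequence :: "real \<Rightarrow> (nat \<Rightarrow> real) \<Rightarrow> bool" where
  "is_index_sequence \<tau>0 \<mu> \<longleftrightarrow> strict_mono_on {1..} \<mu> \<and> \<mu> ` {1..} = index_set \<tau>0"

definition index_tuples :: "(nat \<Rightarrow> real) \<Rightarrow> nat \<Rightarrow> nat \<Rightarrow> nat list set" where
  "index_tuples \<mu> m j =
     {ks. length ks = j \<and> (\<forall>k\<in>set ks. 1 \<le> k) \<and> (\<Sum>k\<leftarrow>ks. \<mu> k) = \<mu> m}"

definition coeff_rhs ::
  "(nat \<Rightarrow> real) \<Rightarrow> (nat \<Rightarrow> real) \<Rightarrow> (nat \<Rightarrow> real \<Rightarrow> real) \<Rightarrow> nat \<Rightarrow> real \<Rightarrow> real" where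
  "coeff_rhs a \<mu> P m \<theta> =
     (\<Sum>j = 1..m. a j * (\<Sum>ks\<in>index_tuples \<mu> m j. \<Prod>k\<leftarrow>ks. P k \<theta>))"

definition circle_solutions :: "real \<Rightarrow> (real \<Rightarrow> real) \<Rightarrow> (real \<Rightarrow> real) set" where
  "circle_solutions \<kappa> g =
     {Q. smooth_circle Q \<and> (\<forall>\<theta>. deriv (deriv Q) \<theta> + \<kappa>\<^sup>2 * Q \<theta> = g \<theta>)}"

text \<open>
  \<open>is_coeff_sequence \<tau>0 a \<mu> X P\<close>: \<open>P\<close> is the sequence determined by \<open>X\<close>. Where \<open>P l\<close> is prescribed
  as the unique solution of an equation, both solvability and uniqueness are part of the condition,
  by requiring the solution set to be a singleton. Given \<open>X\<close>, all \<open>P l\<close> with \<open>l \<ge> 1\<close> are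
  determined: see \<open>is_coeff_sequence_unique\<close> below.
\<close>

definition is_coeff_sequence ::
  "real \<Rightarrow> (nat \<Rightarrow> real) \<Rightarrow> (nat \<Rightarrow> real) \<Rightarrow>
   (nat \<Rightarrow> real \<Rightarrow> real) \<Rightarrow> (nat \<Rightarrow> real \<Rightarrow> real) \<Rightarrow> bool" where
  "is_coeff_sequence \<tau>0 a \<mu> X P \<longleftrightarrow> (\<forall>l\<ge>1.
     (\<mu> l < \<tau>0 \<longrightarrow> \<mu> l = real l \<and> P l = X l) \<and>
     (\<mu> l = \<tau>0 \<longrightarrow>
        (\<tau>0 \<notin> \<int> \<longrightarrow> P l = (\<lambda>\<theta>. a 0 / \<tau>0\<^sup>2)) \<and>
        (\<forall>n. \<tau>0 = real n \<longrightarrow> P l = (\<lambda>\<theta>. a 0 / \<tau>0\<^sup>2 + X n \<theta>))) \<and>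
     (\<mu> l > \<tau>0 \<and> (\<forall>m\<ge>1. \<mu> l \<noteq> \<tau>0 + \<mu> m) \<longrightarrow>
        (\<exists>n. \<mu> l = real n \<and> P l = X n)) \<and>
     (\<forall>m. \<mu> l > \<tau>0 \<and> 1 \<le> m \<and> m < l \<and> \<mu> l = \<tau>0 + \<mu> m \<longrightarrow>
        (\<mu> l \<notin> \<int> \<longrightarrow> circle_solutions (\<mu> l) (coeff_rhs a \<mu> P m) = {P l}) \<and>
        (\<forall>n. \<mu> l = real n \<longrightarrow>
           (\<exists>Q. {q \<in> circle_solutions (\<mu> l) (coeff_rhs a \<mu> P m).
                   \<forall>Y\<in>spherical_harmonics n. L2_circle_inner q Y = 0} = {Q} \<and>
                P l = (\<lambda>\<theta>. X n \<theta> + Q \<theta>)))))"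

lemma index_set_pos:
  assumes "\<tau>0 > 0" "s \<in> index_set \<tau>0"
  shows "s > 0"
proof -
  obtain m :: "nat \<Rightarrow> nat" where m: "s \<noteq> 0" "s = (\<Sum>i\<in>{i. m i > 0}. real (m i) * rho \<tau>0 i)"
    using assms(2) by (auto simp: index_set_def)
  have "s \<ge> 0"
    unfolding m(2) using assms(1) by (intro sum_nonneg) (auto simp: rho_def)
  with m(1) show ?thesis by simp
qed

lemma index_tuples_le:
  assumes "\<tau>0 > 0" "is_index_sequence \<tau>0 \<mu>" "1 \<le> m" "ks \<in> index_tuples \<mu> m j" "k \<in> set ks"
  shows "k \<le> m"
proof (rule ccontr)
  assume "\<not> k \<le> m"
  have pos: "\<mu> i > 0" if "1 \<le> i" for i
    using that assms(1,2) index_set_pos by (auto simp: is_index_sequence_def)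
  have ks: "\<forall>i\<in>set ks. 1 \<le> i" "(\<Sum>i\<leftarrow>ks. \<mu> i) = \<mu> m"
    using assms(4) by (auto simp: index_tuples_def)
  have "\<mu> k \<in> set (map \<mu> ks)" using assms(5) by simp
  then have "\<mu> k \<le> (\<Sum>i\<leftarrow>ks. \<mu> i)"
    by (rule member_le_sum_list) (use ks(1) pos in \<open>auto intro: less_imp_le\<close>)
  moreover have "\<mu> m < \<mu> k"
    using assms(2,3) \<open>\<not> k \<le> m\<close> by (auto simp: is_index_sequence_def strict_mono_on_def)
  ultimately show False using ks(2) by simp
qed

lemma coeff_rhs_cong:
  assumes "\<tau>0 > 0" "is_index_sequence \<tau>0 \<mu>" "1 \<le> m"
    and "\<And>k. 1 \<le> k \<Longrightarrow> k \<le> m \<Longrightarrow> P k = P' k"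
  shows "coeff_rhs a \<mu> P m = coeff_rhs a \<mu> P' m"
proof
  fix \<theta>
  have "(\<Prod>k\<leftarrow>ks. P k \<theta>) = (\<Prod>k\<leftarrow>ks. P' k \<theta>)" if "ks \<in> index_tuples \<mu> m j" for ks j
  proof -
    have "map (\<lambda>k. P k \<theta>) ks = map (\<lambda>k. P' k \<theta>) ks"
      using index_tuples_le[OF assms(1-3) that] that assms(4)
      by (auto simp: index_tuples_def)
    then show ?thesis by (rule arg_cong)
  qed
  then show "coeff_rhs a \<mu> P m \<theta> = coeff_rhs a \<mu> P' m \<theta>"
    unfolding coeff_rhs_def by simp
qed

lemma is_coeff_sequence_unique:
  assumes \<tau>0: "\<tau>0 > 0" and \<mu>: "is_index_sequence \<tau>0 \<mu>"
    and P: "is_coeff_sequence \<tau>0 a \<mu> X P" and P': "is_coeff_sequence \<tau>0 a \<mu> X P'"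
  shows "1 \<le> l \<Longrightarrow> P l = P' l"
proof (induction l rule: less_induct)
  case (less l)
  have int: "\<exists>n. x = real n" if x: "x \<in> \<int>" "x > 0" for x :: real
  proof -
    obtain k where k: "x = of_int k" using x(1) by (rule Ints_cases)
    with x(2) have "x = real (nat k)" by simp
    then show ?thesis ..
  qed
  note D0 = P[unfolded is_coeff_sequence_def, THEN spec, THEN mp, OF less.prems]
    and D0' = P'[unfolded is_coeff_sequence_def, THEN spec, THEN mp, OF less.prems]
  note D = D0[THEN conjunct1] D0[THEN conjunct2, THEN conjunct1]
    D0[THEN conjunct2, THEN conjunct2, THEN conjunct1]
    D0[THEN conjunct2, THEN conjunct2, THEN conjunct2, THEN spec, THEN mp]
  note D' = D0'[THEN conjunct1] D0'[THEN conjunct2, THEN conjunct1]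
    D0'[THEN conjunct2, THEN conjunct2, THEN conjunct1]
    D0'[THEN conjunct2, THEN conjunct2, THEN conjunct2, THEN spec, THEN mp]
  have "\<mu> l \<in> index_set \<tau>0"
    using less.prems \<mu> unfolding is_index_sequence_def by blast
  then have pos: "\<mu> l > 0" by (rule index_set_pos[OF \<tau>0])
  consider "\<mu> l < \<tau>0" | "\<mu> l = \<tau>0" | "\<mu> l > \<tau>0" "\<forall>m\<ge>1. \<mu> l \<noteq> \<tau>0 + \<mu> m"
    | m where "\<mu> l > \<tau>0" "1 \<le> m" "\<mu> l = \<tau>0 + \<mu> m"
    using linorder_less_linear[of "\<mu> l" \<tau>0] by blast
  then show ?case
  proof cases
    case 1
    show ?thesis
      using D(1)[THEN mp, OF 1, THEN conjunct2] D'(1)[THEN mp, OF 1, THEN conjunct2]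
      by (rule trans[OF _ sym])
  next
    case 2
    show ?thesis
    proof (cases "\<tau>0 \<in> \<int>")
      case True
      then obtain n where n: "\<tau>0 = real n" using int \<tau>0 by blast
      show ?thesis
        using D(2)[THEN mp, OF 2, THEN conjunct2, THEN spec, THEN mp, OF n]
          D'(2)[THEN mp, OF 2, THEN conjunct2, THEN spec, THEN mp, OF n] by (rule trans[OF _ sym])
    next
      case False
      show ?thesis
        using D(2)[THEN mp, OF 2, THEN conjunct1, THEN mp, OF False]
          D'(2)[THEN mp, OF 2, THEN conjunct1, THEN mp, OF False] by (rule trans[OF _ sym])
    qed
  next
    case 3
    obtain n where n: "\<mu> l = real n" "P l = X n"
      using D(3)[THEN mp, OF conjI, OF 3] by blast
    obtain n' where n': "\<mu> l = real n'" "P' l = X n'"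
      using D'(3)[THEN mp, OF conjI, OF 3] by blast
    have "n = n'" using n(1) n'(1) by simp
    with n(2) n'(2) show ?thesis by simp
  next
    case (4 m)
    have "m < l"
    proof (rule ccontr)
      assume "\<not> m < l"
      then have "\<mu> l \<le> \<mu> m"
        using \<mu> less.prems strict_mono_on_leD[of "{1..}" \<mu> l m]
        by (simp add: is_index_sequence_def)
      with 4 \<tau>0 show False by simp
    qed
    have rhs: "coeff_rhs a \<mu> P m = coeff_rhs a \<mu> P' m"
    proof (rule coeff_rhs_cong[OF \<tau>0 \<mu> 4(2)])
      fix k assume "1 \<le> k" "k \<le> m"
      with \<open>m < l\<close> show "P k = P' k" by (intro less.IH) simp_all
    qed
    have m: "\<mu> l > \<tau>0 \<and> 1 \<le> m \<and> m < l \<and> \<mu> l = \<tau>0 + \<mu> m"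
      using 4 \<open>m < l\<close> by blast
    note D4 = D(4)[OF m] and D4' = D'(4)[OF m]
    show ?thesis
    proof (cases "\<mu> l \<in> \<int>")
      case False
      have "{P l} = {P' l}"
        using D4[THEN conjunct1, THEN mp, OF False] D4'[THEN conjunct1, THEN mp, OF False]
        unfolding rhs by simp
      then show ?thesis by simp
    next
      case True
      then obtain n where n: "\<mu> l = real n" using int pos by blast
      let ?S = "\<lambda>P. {q \<in> circle_solutions (\<mu> l) (coeff_rhs a \<mu> P m).
                   \<forall>Y\<in>spherical_harmonics n. L2_circle_inner q Y = 0}"
      obtain Q where Q: "?S P = {Q}" "P l = (\<lambda>\<theta>. X n \<theta> + Q \<theta>)"
        using D4[THEN conjunct2, THEN spec, THEN mp, OF n] by blast
      obtain Q' where Q': "?S P' = {Q'}" "P' l = (\<lambda>\<theta>. X n \<theta> + Q' \<theta>)"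
        using D4'[THEN conjunct2, THEN spec, THEN mp, OF n] by blast
      have "Q = Q'" using Q(1) Q'(1) unfolding rhs by simp
      with Q(2) Q'(2) show ?thesis by simp
    qed
  qed
qed

end

theory Submission
  imports Defs
begin

text \<open>
  Expand in Fourier modes: the \<open>k\<close>-th mode \<open>W\<close> of a solution of \<open>w_tt + w_\<theta>\<theta> = h\<close> satisfies
  \<open>W'' - k\<^sup>2 W = H\<close>, whose growing solution is excluded by decay. If \<open>w\<close> decays like \<open>exp (- \<beta> t)\<close>
  and \<open>h\<close> like \<open>exp (- b t)\<close>, then \<open>w\<close> decays like \<open>exp (- b t)\<close> up to one harmonic
  \<open>Y exp (- \<kappa> t)\<close> for every integer \<open>\<kappa>\<close> between \<open>\<beta>\<close> and \<open>b\<close>. Given the expansion of \<open>v\<close> up to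
  \<open>\<mu>_l\<close>, Taylor's formula gives that of \<open>f (v)\<close>; the forcing term with exponent \<open>\<mu>_(l+1)\<close> is removed
  by a trigonometric polynomial of degree less than \<open>\<mu>_(l+1)\<close>, which therefore never resonates, and the
  linear statement applied to the remainder yields the next coefficient.
\<close>

section \<open>Trigonometric polynomials\<close>

text \<open>An integer exponent could meet an eigenvalue of the circle: forcing in degree
  \<open>k\<close> with exponent \<open>k\<close> would produce a term
  \<open>t * exp (- k * t)\<close>. What excludes this is an invariant of the recursion: the
  coefficient at exponent \<open>\<nu> j\<close> is a trigonometric polynomial of degree at most
  \<open>\<nu> j\<close>. Degrees add under products exactly as exponents do, while the factor
  \<open>exp (- \<tau>0 * t)\<close> raises the exponent by \<open>\<tau>0\<close> and leaves the
  degree alone, so every forcing term has degree strictly below its exponent. This is why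
  \<open>trig_poly\<close> carries a real degree bound, and it makes the orthogonality of the
  particular solution to the resonant harmonics automatic. The same danger sits in the error terms:
  an error of rate exactly \<open>k\<close> would lose a factor \<open>t\<close> in mode
  \<open>k\<close>. All positive integers are exponents, so rates strictly between consecutive
  exponents are safe. The passage from modes back to a bound uniform in the angle rests on mode
  bounds of size \<open>1 / k\<^sup>2\<close>, which are summable.\<close>

inductive_set trig_poly :: "real \<Rightarrow> (real \<Rightarrow> real) set" for d :: real where
  trig_poly_zero: "(\<lambda>_. 0) \<in> trig_poly d"
| trig_poly_cos: "real k \<le> d \<Longrightarrow> (\<lambda>\<theta>. cos (real k * \<theta>)) \<in> trig_poly d"
| trig_poly_sin: "real k \<le> d \<Longrightarrow> (\<lambda>\<theta>. sin (real k * \<theta>)) \<in> trig_poly d"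
| trig_poly_add: "p \<in> trig_poly d \<Longrightarrow> q \<in> trig_poly d \<Longrightarrow> (\<lambda>\<theta>. p \<theta> + q \<theta>) \<in> trig_poly d"
| trig_poly_scale: "p \<in> trig_poly d \<Longrightarrow> (\<lambda>\<theta>. c * p \<theta>) \<in> trig_poly d"

lemma trig_poly_mono:
  assumes "p \<in> trig_poly d" "d \<le> e" shows "p \<in> trig_poly e"
  using assms(1)
proof induction
  case (trig_poly_cos k) then show ?case using assms(2) by (intro trig_poly.trig_poly_cos) auto
next
  case (trig_poly_sin k) then show ?case using assms(2) by (intro trig_poly.trig_poly_sin) auto
qed (rule trig_poly.intros; assumption)+

lemma trig_poly_const:
  assumes "0 \<le> d" shows "(\<lambda>_. c) \<in> trig_poly d"
  using trig_poly_scale[OF trig_poly_cos[of 0 d], of c] assms by simp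

lemma trig_poly_sum:
  assumes "\<And>i. i \<in> A \<Longrightarrow> p i \<in> trig_poly d"
  shows "(\<lambda>\<theta>. \<Sum>i\<in>A. p i \<theta>) \<in> trig_poly d"
  using assms by (induction A rule: infinite_finite_induct)
    (auto intro: trig_poly_zero trig_poly_add)

lemma trig_poly_cos_diff:
  assumes "real i + real j \<le> d"
  shows "(\<lambda>\<theta>. cos ((real i - real j) * \<theta>)) \<in> trig_poly d"
proof (cases "j \<le> i")
  case True
  then show ?thesis using trig_poly_cos[of "i - j" d] assms by (simp add: of_nat_diff)
next
  case False
  have "cos ((real i - real j) * \<theta>) = cos (real (j - i) * \<theta>)" for \<theta>
    using False cos_minus[of "(real i - real j) * \<theta>"] by (simp add: of_nat_diff algebra_simps)
  then show ?thesis using trig_poly_cos[of "j - i" d] assms False by (simp add: of_nat_diff)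
qed

lemma trig_poly_sin_diff:
  assumes "real i + real j \<le> d"
  shows "(\<lambda>\<theta>. sin ((real i - real j) * \<theta>)) \<in> trig_poly d"
proof (cases "j \<le> i")
  case True
  then show ?thesis using trig_poly_sin[of "i - j" d] assms by (simp add: of_nat_diff)
next
  case False
  have "sin ((real i - real j) * \<theta>) = - 1 * sin (real (j - i) * \<theta>)" for \<theta>
    using False sin_minus[of "(real i - real j) * \<theta>"] by (simp add: of_nat_diff algebra_simps)
  then show ?thesis
    using trig_poly_scale[OF trig_poly_sin[of "j - i" d], of "-1"] assms False
    by (simp add: of_nat_diff)
qed

lemma trig_poly_basis_mult:
  assumes "real i \<le> d" "real j \<le> e"
  shows "(\<lambda>\<theta>. cos (real i * \<theta>) * cos (real j * \<theta>)) \<in> trig_poly (d + e)"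
    and "(\<lambda>\<theta>. sin (real i * \<theta>) * cos (real j * \<theta>)) \<in> trig_poly (d + e)"
    and "(\<lambda>\<theta>. cos (real i * \<theta>) * sin (real j * \<theta>)) \<in> trig_poly (d + e)"
    and "(\<lambda>\<theta>. sin (real i * \<theta>) * sin (real j * \<theta>)) \<in> trig_poly (d + e)"
proof -
  have ij: "real i + real j \<le> d + e" using assms by simp
  note cd = trig_poly_cos_diff[OF ij] and sd = trig_poly_sin_diff[OF ij]
  have cs: "(\<lambda>\<theta>. cos ((real i + real j) * \<theta>)) \<in> trig_poly (d + e)"
    and ss: "(\<lambda>\<theta>. sin ((real i + real j) * \<theta>)) \<in> trig_poly (d + e)"
    using trig_poly_cos[of "i + j" "d + e"] trig_poly_sin[of "i + j" "d + e"] ij by simp_all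
  have "(\<lambda>\<theta>. 1/2 * (cos ((real i - real j) * \<theta>) + cos ((real i + real j) * \<theta>))) \<in> trig_poly (d + e)"
    by (intro trig_poly_scale trig_poly_add cs cd)
  then show "(\<lambda>\<theta>. cos (real i * \<theta>) * cos (real j * \<theta>)) \<in> trig_poly (d + e)"
    by (simp add: cos_times_cos distrib_right left_diff_distrib)
  have "(\<lambda>\<theta>. 1/2 * (sin ((real i + real j) * \<theta>) + sin ((real i - real j) * \<theta>))) \<in> trig_poly (d + e)"
    by (intro trig_poly_scale trig_poly_add ss sd)
  then show "(\<lambda>\<theta>. sin (real i * \<theta>) * cos (real j * \<theta>)) \<in> trig_poly (d + e)"
    by (simp add: sin_times_cos distrib_right left_diff_distrib)
  have "(\<lambda>\<theta>. 1/2 * (sin ((real i + real j) * \<theta>) + - 1 * sin ((real i - real j) * \<theta>))) \<in> trig_poly (d + e)"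
    by (intro trig_poly_scale trig_poly_add ss sd)
  then show "(\<lambda>\<theta>. cos (real i * \<theta>) * sin (real j * \<theta>)) \<in> trig_poly (d + e)"
    by (simp add: cos_times_sin distrib_right left_diff_distrib)
  have "(\<lambda>\<theta>. 1/2 * (cos ((real i - real j) * \<theta>) + - 1 * cos ((real i + real j) * \<theta>))) \<in> trig_poly (d + e)"
    by (intro trig_poly_scale trig_poly_add cs cd)
  then show "(\<lambda>\<theta>. sin (real i * \<theta>) * sin (real j * \<theta>)) \<in> trig_poly (d + e)"
    by (simp add: sin_times_sin distrib_right left_diff_distrib)
qed

lemma trig_poly_mult_basis:
  assumes "q \<in> trig_poly e" "real i \<le> d"
  shows "(\<lambda>\<theta>. cos (real i * \<theta>) * q \<theta>) \<in> trig_poly (d + e)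
    \<and> (\<lambda>\<theta>. sin (real i * \<theta>) * q \<theta>) \<in> trig_poly (d + e)"
  using assms(1)
proof induction
  case (trig_poly_scale p c)
  then show ?case
    using trig_poly.trig_poly_scale[of _ "d + e" c] by (auto simp: mult.left_commute)
qed (use assms(2) trig_poly_basis_mult[of i d _ e] in
    \<open>auto intro: trig_poly_zero trig_poly_add simp: distrib_left\<close>)

text \<open>Degrees add by the product-to-sum formulas. Iterated over a list, this bounds the degree
  of a product of coefficients by the sum of their exponents.\<close>

lemma trig_poly_mult:
  assumes "p \<in> trig_poly d" "q \<in> trig_poly e"
  shows "(\<lambda>\<theta>. p \<theta> * q \<theta>) \<in> trig_poly (d + e)"
  using assms(1)
proof induction
  case (trig_poly_scale p c)
  then show ?case
    using trig_poly.trig_poly_scale[of _ "d + e" c] by (auto simp: mult.assoc)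
qed (use assms(2) trig_poly_mult_basis[of q e _ d] in
    \<open>auto intro: trig_poly_zero trig_poly_add simp: distrib_right\<close>)

lemma trig_poly_prod_list:
  assumes "\<And>k. k \<in> set ks \<Longrightarrow> p k \<in> trig_poly (d k)"
  shows "(\<lambda>\<theta>. \<Prod>k\<leftarrow>ks. p k \<theta>) \<in> trig_poly (\<Sum>k\<leftarrow>ks. d k)"
  using assms by (induction ks) (auto intro: trig_poly_const trig_poly_mult)

lemma trig_poly_has_derivative:
  assumes "p \<in> trig_poly d"
  shows "\<exists>p'\<in>trig_poly d. \<forall>\<theta>. (p has_real_derivative p' \<theta>) (at \<theta>)"
  using assms
proof induction
  case trig_poly_zero
  then show ?case by (intro bexI[of _ "\<lambda>_. 0"]) (auto intro: trig_poly.intros)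
next
  case (trig_poly_cos k)
  have "(\<lambda>\<theta>. - real k * sin (real k * \<theta>)) \<in> trig_poly d"
    by (rule trig_poly.trig_poly_scale) (rule trig_poly.trig_poly_sin[OF trig_poly_cos])
  then show ?case
    by (rule bexI[rotated]) (auto intro!: derivative_eq_intros)
next
  case (trig_poly_sin k)
  have "(\<lambda>\<theta>. real k * cos (real k * \<theta>)) \<in> trig_poly d"
    by (rule trig_poly.trig_poly_scale) (rule trig_poly.trig_poly_cos[OF trig_poly_sin])
  then show ?case
    by (rule bexI[rotated]) (auto intro!: derivative_eq_intros)
next
  case (trig_poly_add p q)
  then obtain p' q' where "p' \<in> trig_poly d" "\<And>\<theta>. (p has_real_derivative p' \<theta>) (at \<theta>)"
    "q' \<in> trig_poly d" "\<And>\<theta>. (q has_real_derivative q' \<theta>) (at \<theta>)" by blast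
  then show ?case
    by (intro bexI[of _ "\<lambda>\<theta>. p' \<theta> + q' \<theta>"])
      (auto intro!: derivative_eq_intros intro: trig_poly.trig_poly_add)
next
  case (trig_poly_scale p c)
  then obtain p' where "p' \<in> trig_poly d" "\<And>\<theta>. (p has_real_derivative p' \<theta>) (at \<theta>)" by blast
  then show ?case
    by (intro bexI[of _ "\<lambda>\<theta>. c * p' \<theta>"])
      (auto intro!: derivative_eq_intros intro: trig_poly.trig_poly_scale)
qed

lemma trig_poly_deriv:
  assumes "p \<in> trig_poly d"
  shows "deriv p \<in> trig_poly d" "(p has_real_derivative deriv p \<theta>) (at \<theta>)"
proof -
  obtain p' where p': "p' \<in> trig_poly d" "\<And>\<theta>. (p has_real_derivative p' \<theta>) (at \<theta>)"
    using trig_poly_has_derivative[OF assms] by blast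
  have "deriv p = p'" using p'(2) by (auto intro: DERIV_imp_deriv)
  with p' show "deriv p \<in> trig_poly d" "(p has_real_derivative deriv p \<theta>) (at \<theta>)" by auto
qed

lemma trig_poly_iterated_deriv:
  assumes "p \<in> trig_poly d" shows "(deriv ^^ n) p \<in> trig_poly d"
  by (induction n) (auto simp: assms intro: trig_poly_deriv)

lemma trig_poly_continuous: "p \<in> trig_poly d \<Longrightarrow> continuous_on S p"
  by (meson DERIV_isCont continuous_at_imp_continuous_on trig_poly_deriv(2))

lemma trig_poly_periodic:
  assumes "p \<in> trig_poly d" shows "p (\<theta> + 2 * pi) = p \<theta>"
  using assms
proof induction
  case (trig_poly_cos k)
  have "real k * (\<theta> + 2 * pi) = real k * \<theta> + 2 * real k * pi" by (simp add: algebra_simps)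
  then show ?case by (simp add: cos_add)
next
  case (trig_poly_sin k)
  have "real k * (\<theta> + 2 * pi) = real k * \<theta> + 2 * real k * pi" by (simp add: algebra_simps)
  then show ?case by (simp add: sin_add)
qed auto

lemma trig_poly_bounded:
  assumes "p \<in> trig_poly d" shows "\<exists>C. \<forall>\<theta>. \<bar>p \<theta>\<bar> \<le> C"
  using assms
proof induction
  case (trig_poly_add p q)
  then obtain C D where "\<forall>\<theta>. \<bar>p \<theta>\<bar> \<le> C" "\<forall>\<theta>. \<bar>q \<theta>\<bar> \<le> D" by blast
  then have "\<bar>p \<theta> + q \<theta>\<bar> \<le> C + D" for \<theta>
    using abs_triangle_ineq[of "p \<theta>" "q \<theta>"] by (meson add_mono order_trans)
  then show ?case by blast
next
  case (trig_poly_scale p c)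
  then obtain C where "\<forall>\<theta>. \<bar>p \<theta>\<bar> \<le> C" by blast
  then have "\<bar>c * p \<theta>\<bar> \<le> \<bar>c\<bar> * C" for \<theta> by (simp add: abs_mult mult_left_mono)
  then show ?case by blast
qed (auto intro: exI[of _ 1] abs_cos_le_one abs_sin_le_one)

lemma trig_poly_smooth_circle:
  assumes "p \<in> trig_poly d" shows "smooth_circle p"
  unfolding smooth_circle_def smooth_on_open_def
  using trig_poly_periodic[OF assms] trig_poly_deriv(2)[OF trig_poly_iterated_deriv[OF assms]]
  by (auto simp: real_differentiable_def)

text \<open>The operator is diagonal in the basis: frequency \<open>k\<close> is multiplied by
  \<open>\<kappa>\<^sup>2 - k\<^sup>2\<close>, which is nonzero because
  \<open>k \<le> d < \<kappa>\<close>.\<close>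

lemma trig_poly_solve:
  assumes "p \<in> trig_poly d" "0 \<le> d" "d < \<kappa>"
  shows "\<exists>q\<in>trig_poly d. \<forall>\<theta>. deriv (deriv q) \<theta> + \<kappa>\<^sup>2 * q \<theta> = p \<theta>"
proof -
  \<comment> \<open>Shared by both basis functions: \<open>K\<close> and \<open>k\<close> stand for
    the squares of \<open>\<kappa>\<close> and of the frequency, \<open>s\<close> for the value of
    the cosine or sine.\<close>
  have aux: "1 / (K - k) * (- k * s) + K * (1 / (K - k) * s) = s" if "K - k \<noteq> 0" for K k s :: real
    using that by (simp add: divide_simps) (simp add: algebra_simps)
  show ?thesis
    using assms(1)
  proof induction
    case trig_poly_zero
    show ?case by (rule bexI[OF _ trig_poly.trig_poly_zero]) (auto simp: deriv_const[abs_def])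
  next
    case (trig_poly_cos k)
    then have nz: "\<kappa>\<^sup>2 - (real k)\<^sup>2 \<noteq> 0"
      using assms by (smt (verit) of_nat_0_le_iff power2_eq_iff_nonneg)
    define c where "c = 1 / (\<kappa>\<^sup>2 - (real k)\<^sup>2)"
    let ?q = "\<lambda>\<theta>. c * cos (real k * \<theta>)"
    have "deriv ?q = (\<lambda>\<theta>. c * (- real k * sin (real k * \<theta>)))"
      by (rule ext, rule DERIV_imp_deriv) (auto intro!: derivative_eq_intros)
    moreover have "deriv \<dots> = (\<lambda>\<theta>. c * (- (real k)\<^sup>2 * cos (real k * \<theta>)))"
      by (rule ext, rule DERIV_imp_deriv) (auto intro!: derivative_eq_intros simp: power2_eq_square)
    ultimately have "deriv (deriv ?q) \<theta> + \<kappa>\<^sup>2 * ?q \<theta> = cos (real k * \<theta>)" for \<theta>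
      unfolding c_def by (simp only: aux[OF nz])
    then show ?case
      using trig_poly.trig_poly_scale[OF trig_poly.trig_poly_cos[OF trig_poly_cos]] by blast
  next
    case (trig_poly_sin k)
    then have nz: "\<kappa>\<^sup>2 - (real k)\<^sup>2 \<noteq> 0"
      using assms by (smt (verit) of_nat_0_le_iff power2_eq_iff_nonneg)
    define c where "c = 1 / (\<kappa>\<^sup>2 - (real k)\<^sup>2)"
    let ?q = "\<lambda>\<theta>. c * sin (real k * \<theta>)"
    have "deriv ?q = (\<lambda>\<theta>. c * (real k * cos (real k * \<theta>)))"
      by (rule ext, rule DERIV_imp_deriv) (auto intro!: derivative_eq_intros)
    moreover have "deriv \<dots> = (\<lambda>\<theta>. c * (- (real k)\<^sup>2 * sin (real k * \<theta>)))"
      by (rule ext, rule DERIV_imp_deriv) (auto intro!: derivative_eq_intros simp: power2_eq_square)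
    ultimately have "deriv (deriv ?q) \<theta> + \<kappa>\<^sup>2 * ?q \<theta> = sin (real k * \<theta>)" for \<theta>
      unfolding c_def by (simp only: aux[OF nz])
    then show ?case
      using trig_poly.trig_poly_scale[OF trig_poly.trig_poly_sin[OF trig_poly_sin]] by blast
  next
    case (trig_poly_add p q)
    then obtain r s where r: "r \<in> trig_poly d" "\<And>\<theta>. deriv (deriv r) \<theta> + \<kappa>\<^sup>2 * r \<theta> = p \<theta>"
      and s: "s \<in> trig_poly d" "\<And>\<theta>. deriv (deriv s) \<theta> + \<kappa>\<^sup>2 * s \<theta> = q \<theta>" by blast
    have "deriv (\<lambda>\<theta>. r \<theta> + s \<theta>) = (\<lambda>\<theta>. deriv r \<theta> + deriv s \<theta>)"
      using r(1) s(1) by (intro ext DERIV_imp_deriv DERIV_add trig_poly_deriv(2))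
    moreover have "deriv \<dots> = (\<lambda>\<theta>. deriv (deriv r) \<theta> + deriv (deriv s) \<theta>)"
      using r(1) s(1) by (intro ext DERIV_imp_deriv DERIV_add trig_poly_deriv)
    ultimately show ?case
      using r(2)[symmetric] s(2)[symmetric]
      by (intro bexI[OF _ trig_poly.trig_poly_add[OF r(1) s(1)]]) (simp add: algebra_simps)
  next
    case (trig_poly_scale p c)
    then obtain r where r: "r \<in> trig_poly d" "\<And>\<theta>. deriv (deriv r) \<theta> + \<kappa>\<^sup>2 * r \<theta> = p \<theta>" by blast
    have "deriv (\<lambda>\<theta>. c * r \<theta>) = (\<lambda>\<theta>. c * deriv r \<theta>)"
      using r(1) by (intro ext DERIV_imp_deriv DERIV_cmult trig_poly_deriv(2))
    moreover have "deriv \<dots> = (\<lambda>\<theta>. c * deriv (deriv r) \<theta>)"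
      using r(1) by (intro ext DERIV_imp_deriv DERIV_cmult trig_poly_deriv)
    ultimately show ?case
      using r(2)[symmetric]
      by (intro bexI[OF _ trig_poly.trig_poly_scale[OF r(1), of c]]) (simp add: algebra_simps)
  qed
qed

lemma spherical_harmonics_trig_poly:
  assumes "Y \<in> spherical_harmonics i" shows "Y \<in> trig_poly (real i)"
  using assms trig_poly_const[of "real i"] unfolding spherical_harmonics_def
  by (auto split: if_splits intro!: trig_poly_add trig_poly_scale trig_poly_cos trig_poly_sin)

lemma spherical_harmonics_deriv2:
  assumes "Y \<in> spherical_harmonics i"
  shows "deriv (deriv Y) \<theta> = - (real i)\<^sup>2 * Y \<theta>"
proof (cases "i = 0")
  case True
  then obtain c where "Y = (\<lambda>_. c)" using assms by (auto simp: spherical_harmonics_def)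
  then show ?thesis using True by (simp add: deriv_const[abs_def])
next
  case False
  then obtain c d where Y: "Y = (\<lambda>\<theta>. c * cos (real i * \<theta>) + d * sin (real i * \<theta>))"
    using assms by (auto simp: spherical_harmonics_def)
  have "deriv Y = (\<lambda>\<theta>. real i * (- c * sin (real i * \<theta>) + d * cos (real i * \<theta>)))"
    unfolding Y by (rule ext, rule DERIV_imp_deriv)
      (auto intro!: derivative_eq_intros simp: algebra_simps)
  moreover have "deriv \<dots> = (\<lambda>\<theta>. - (real i)\<^sup>2 * Y \<theta>)"
    unfolding Y by (rule ext, rule DERIV_imp_deriv)
      (auto intro!: derivative_eq_intros simp: algebra_simps power2_eq_square)
  ultimately show ?thesis by simp
qed

section \<open>Fourier modes\<close>

text \<open>The phase \<open>\<phi>\<close> replaces the pair of cosine and sine coefficients. As a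
  function of \<open>\<phi>\<close> this is \<open>pi\<close> times the projection of a continuous
  \<open>g\<close> to the harmonics of degree \<open>k\<close> (\<open>2 * pi\<close> times for
  \<open>k = 0\<close>); for a fixed phase it is a single number, so the mode equations are
  scalar.\<close>

definition fourier_integral :: "nat \<Rightarrow> real \<Rightarrow> (real \<Rightarrow> real) \<Rightarrow> real" where
  "fourier_integral k \<phi> g = integral {0..2 * pi} (\<lambda>\<theta>. g \<theta> * cos (real k * (\<theta> - \<phi>)))"

definition fourier_mode :: "nat \<Rightarrow> (real \<Rightarrow> real) \<Rightarrow> real \<Rightarrow> real" where
  "fourier_mode k g \<phi> = (if k = 0 then 1 else 2) / (2 * pi) * fourier_integral k \<phi> g"

section \<open>Periodic functions and the density of trigonometric polynomials\<close>

lemma periodic_int: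
  fixes g :: "real \<Rightarrow> real"
  assumes "\<And>\<theta>. g (\<theta> + 2 * pi) = g \<theta>"
  shows "g (\<theta> + 2 * pi * of_int n) = g \<theta>"
proof -
  have nat: "g (\<theta> + 2 * pi * real k) = g \<theta>" for \<theta> k
  proof (induction k)
    case (Suc k)
    have "\<theta> + 2 * pi * real (Suc k) = \<theta> + 2 * pi * real k + 2 * pi" by (simp add: algebra_simps)
    then show ?case using Suc assms by metis
  qed simp
  show ?thesis
  proof (cases "n \<ge> 0")
    case True
    then show ?thesis using nat[of \<theta> "nat n"] by simp
  next
    case False
    then show ?thesis using nat[of "\<theta> + 2 * pi * of_int n" "nat (- n)"] by (simp add: algebra_simps)
  qed
qed

lemma periodic_reduce:
  fixes g :: "real \<Rightarrow> real"
  assumes "\<And>\<theta>. g (\<theta> + 2 * pi) = g \<theta>"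
  shows "\<exists>x\<in>{0..2 * pi}. g x = g \<theta>"
proof -
  define n where "n = \<lfloor>\<theta> / (2 * pi)\<rfloor>"
  have "of_int n \<le> \<theta> / (2 * pi)" "\<theta> / (2 * pi) < of_int n + 1" unfolding n_def by linarith+
  then have "\<theta> - 2 * pi * of_int n \<in> {0..2 * pi}" by (auto simp: field_simps)
  moreover have "g (\<theta> - 2 * pi * of_int n) = g \<theta>"
    using periodic_int[where g = g, OF assms, of "\<theta> - 2 * pi * of_int n" n] by simp
  ultimately show ?thesis by blast
qed

text \<open>\<open>Arg\<close> jumps across the negative axis, but by a multiple of the period of
  \<open>g\<close>. This moves \<open>g\<close> to the compact circle in the plane, where
  Stone-Weierstrass applies.\<close>

lemma periodic_Arg_continuous:
  assumes g: "continuous_on UNIV g" and per: "\<And>\<theta>. g (\<theta> + 2 * pi) = g \<theta>"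
  shows "continuous_on (sphere 0 1) (\<lambda>z. g (Arg z) :: real)"
  unfolding continuous_on_eq_continuous_within
proof
  fix z0 :: complex assume z0: "z0 \<in> sphere 0 1"
  then have z0': "norm z0 = 1" "z0 \<noteq> 0" by auto
  \<comment> \<open>Rotating \<open>z0\<close> to \<open>1\<close> puts the argument of
    \<open>z / z0\<close> near \<open>0\<close>, away from the cut; the two sides differ inside
    \<open>g\<close> by a multiple of \<open>2 * pi\<close>.\<close>
  have eq: "g (Arg z) = g (Arg z0 + Arg (z / z0))" if "z \<in> sphere 0 1" for z
  proof -
    have z: "norm z = 1" "z \<noteq> 0" using that by auto
    have "cis (Arg z0 + Arg (z / z0)) = sgn z0 * sgn (z / z0)"
      using z z0' by (simp add: cis_mult[symmetric] cis_Arg)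
    also have "\<dots> = cis (Arg z)" using z z0' by (simp add: cis_Arg sgn_eq norm_divide)
    finally have "sin (Arg z0 + Arg (z / z0)) = sin (Arg z) \<and> cos (Arg z0 + Arg (z / z0)) = cos (Arg z)"
      by (simp add: complex_eq_iff)
    then obtain n :: int where "Arg z0 + Arg (z / z0) = Arg z + 2 * pi * n"
      using sin_cos_eq_iff by blast
    then show ?thesis using periodic_int[where g = g, OF per] by simp
  qed
  have "continuous (at z0 within sphere 0 1) (\<lambda>z. g (Arg z0 + Arg (z / z0)))"
  proof (rule continuous_within_compose3[where g = g])
    show "isCont g (Arg z0 + Arg (z0 / z0))"
      using g by (simp add: continuous_on_eq_continuous_at)
    have "continuous (at z0 within sphere 0 1) (\<lambda>z. Arg (z / z0))"
    proof (rule continuous_within_compose3[where g = Arg])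
      show "isCont Arg (z0 / z0)"
        using z0' by (intro continuous_at_Arg) simp
      show "continuous (at z0 within sphere 0 1) (\<lambda>z. z / z0)"
        using z0' by (intro continuous_intros) auto
    qed
    then show "continuous (at z0 within sphere 0 1) (\<lambda>z. Arg z0 + Arg (z / z0))"
      by (intro continuous_intros)
  qed
  then show "continuous (at z0 within sphere 0 1) (\<lambda>z. g (Arg z))"
    by (rule continuous_transform_within[where \<delta> = 1]) (use z0 eq in auto)
qed

lemma trig_poly_dense:
  assumes g: "continuous_on UNIV g" and per: "\<And>\<theta>. g (\<theta> + 2 * pi) = g \<theta>" and "e > 0"
  shows "\<exists>d. \<exists>p\<in>trig_poly d. \<forall>\<theta>. \<bar>g \<theta> - p \<theta>\<bar> < e"
proof -
  \<comment> \<open>The algebra for Stone-Weierstrass: functions whose pull-back by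
    \<open>cis\<close> is a trigonometric polynomial. It contains \<open>Re\<close> and
    \<open>Im\<close>, which separate points.\<close>
  define R :: "(complex \<Rightarrow> real) set" where
    "R = {F. continuous_on (sphere 0 1) F \<and> (\<exists>d. (\<lambda>\<theta>. F (cis \<theta>)) \<in> trig_poly d)}"
  interpret function_ring_on R "sphere 0 1 :: complex set"
  proof
    fix F G :: "complex \<Rightarrow> real" assume "F \<in> R" "G \<in> R"
    then obtain d e where d: "(\<lambda>\<theta>. F (cis \<theta>)) \<in> trig_poly d" "(\<lambda>\<theta>. G (cis \<theta>)) \<in> trig_poly e"
      and c: "continuous_on (sphere 0 1) F" "continuous_on (sphere 0 1) G"
      by (auto simp: R_def)
    show "(\<lambda>x. F x * G x) \<in> R"
      using trig_poly_mult[OF d] c unfolding R_def by (auto intro!: continuous_intros)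
    have "(\<lambda>\<theta>. F (cis \<theta>) + G (cis \<theta>)) \<in> trig_poly (max d e)"
      by (intro trig_poly_add trig_poly_mono[OF d(1)] trig_poly_mono[OF d(2)]) simp_all
    then show "(\<lambda>x. F x + G x) \<in> R" using c unfolding R_def by (auto intro!: continuous_intros)
  next
    fix c :: real
    show "(\<lambda>_. c) \<in> R" unfolding R_def using trig_poly_const[of 0 c] by auto
  next
    fix x y :: complex assume "x \<noteq> y"
    have "Re \<in> R" "Im \<in> R"
      unfolding R_def using trig_poly_cos[of 1 1] trig_poly_sin[of 1 1]
      by (auto intro!: continuous_intros)
    then show "\<exists>F\<in>R. F x \<noteq> F y" using \<open>x \<noteq> y\<close> by (metis complex_eqI)
  qed (auto simp: R_def)
  obtain F where F: "F \<in> R" "\<And>z. z \<in> sphere 0 1 \<Longrightarrow> \<bar>g (Arg z) - F z\<bar> < e"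
    using Stone_Weierstrass_basic[OF periodic_Arg_continuous[OF g per] \<open>e > 0\<close>] by auto
  have "g (Arg (cis \<theta>)) = g \<theta>" for \<theta>
  proof -
    have "cis (Arg (cis \<theta>)) = cis \<theta>" by (subst cis_Arg) (auto simp: sgn_eq)
    then have "sin (Arg (cis \<theta>)) = sin \<theta> \<and> cos (Arg (cis \<theta>)) = cos \<theta>"
      by (simp add: complex_eq_iff)
    then obtain n :: int where "Arg (cis \<theta>) = \<theta> + 2 * pi * n" using sin_cos_eq_iff by blast
    then show ?thesis using periodic_int[where g = g, OF per] by simp
  qed
  then have "\<forall>\<theta>. \<bar>g \<theta> - F (cis \<theta>)\<bar> < e" using F(2)[of "cis _"] by simp
  moreover obtain d where "(\<lambda>\<theta>. F (cis \<theta>)) \<in> trig_poly d" using F(1) unfolding R_def by blast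
  ultimately show ?thesis by (intro exI[of _ d] bexI[of _ "\<lambda>\<theta>. F (cis \<theta>)"])
qed

section \<open>Projections to the spherical harmonics and their orthogonality\<close>

lemma fourier_integrable:
  assumes "continuous_on {0..2 * pi} g"
  shows "(\<lambda>\<theta>. g \<theta> * cos (real k * (\<theta> - \<phi>))) integrable_on {0..2 * pi}"
  by (rule integrable_continuous_interval) (intro continuous_intros assms)

text \<open>By the addition formula the phase enters only through two factors, so the values at two
  suitable phases determine the whole mode.\<close>

lemma fourier_integral_expand:
  assumes "continuous_on {0..2 * pi} g"
  shows "fourier_integral k \<phi> g
     = integral {0..2 * pi} (\<lambda>\<theta>. g \<theta> * cos (real k * \<theta>)) * cos (real k * \<phi>)
       + integral {0..2 * pi} (\<lambda>\<theta>. g \<theta> * sin (real k * \<theta>)) * sin (real k * \<phi>)"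
proof -
  have "((\<lambda>\<theta>. g \<theta> * cos (real k * \<theta>) * cos (real k * \<phi>) + g \<theta> * sin (real k * \<theta>) * sin (real k * \<phi>))
      has_integral (integral {0..2 * pi} (\<lambda>\<theta>. g \<theta> * cos (real k * \<theta>)) * cos (real k * \<phi>)
       + integral {0..2 * pi} (\<lambda>\<theta>. g \<theta> * sin (real k * \<theta>)) * sin (real k * \<phi>))) {0..2 * pi}"
    using assms
    by (intro has_integral_add has_integral_mult_left integrable_integral
        integrable_continuous_interval continuous_intros)
  then have "((\<lambda>\<theta>. g \<theta> * cos (real k * (\<theta> - \<phi>)))
      has_integral (integral {0..2 * pi} (\<lambda>\<theta>. g \<theta> * cos (real k * \<theta>)) * cos (real k * \<phi>)
       + integral {0..2 * pi} (\<lambda>\<theta>. g \<theta> * sin (real k * \<theta>)) * sin (real k * \<phi>))) {0..2 * pi}"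
    by (rule has_integral_eq[rotated]) (simp add: right_diff_distrib cos_diff distrib_left mult.assoc)
  then show ?thesis unfolding fourier_integral_def by (rule integral_unique)
qed

lemma fourier_mode_harmonic:
  assumes "continuous_on {0..2 * pi} g" shows "fourier_mode k g \<in> spherical_harmonics k"
proof (cases "k = 0")
  case True
  then show ?thesis unfolding spherical_harmonics_def fourier_mode_def[abs_def] fourier_integral_def
    by auto
next
  case False
  define A B where "A = 1 / pi * integral {0..2 * pi} (\<lambda>\<theta>. g \<theta> * cos (real k * \<theta>))"
    and "B = 1 / pi * integral {0..2 * pi} (\<lambda>\<theta>. g \<theta> * sin (real k * \<theta>))"
  have "fourier_mode k g = (\<lambda>\<phi>. A * cos (real k * \<phi>) + B * sin (real k * \<phi>))"
    unfolding fourier_mode_def[abs_def] fourier_integral_expand[OF assms] A_def B_def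
    using False by (simp add: fun_eq_iff algebra_simps add_divide_distrib)
  then show ?thesis using False unfolding spherical_harmonics_def by auto
qed

lemma fourier_integral_deriv2:
  assumes d1: "\<And>\<theta>. (g has_real_derivative g' \<theta>) (at \<theta>)"
    and d2: "\<And>\<theta>. (g' has_real_derivative g'' \<theta>) (at \<theta>)"
    and c: "continuous_on {0..2 * pi} g''" and per: "\<And>\<theta>. g (\<theta> + 2 * pi) = g \<theta>"
  shows "fourier_integral k \<phi> g'' = - (real k)\<^sup>2 * fourier_integral k \<phi> g"
proof -
  have cg: "continuous_on {0..2 * pi} g"
    using d1 by (meson DERIV_isCont continuous_at_imp_continuous_on)
  have per': "g' (\<theta> + 2 * pi) = g' \<theta>" for \<theta>
  proof -
    have "((\<lambda>x. g (x + 2 * pi)) has_real_derivative g' (\<theta> + 2 * pi)) (at \<theta>)"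
      using d1 DERIV_shift by blast
    then have "(g has_real_derivative g' (\<theta> + 2 * pi)) (at \<theta>)" by (simp add: per)
    then show ?thesis by (rule DERIV_unique[OF _ d1])
  qed
  \<comment> \<open>The result of integrating by parts twice, collected in one primitive: its
    derivative is the integrand in \<open>I1\<close>, and periodicity of \<open>g\<close> and
    \<open>g'\<close> makes its endpoint values equal.\<close>
  define G where "G = (\<lambda>\<theta>. g' \<theta> * cos (real k * (\<theta> - \<phi>)) + g \<theta> * (real k * sin (real k * (\<theta> - \<phi>))))"
  have G2: "G (2 * pi) = G 0"
  proof -
    have "real k * (2 * pi - \<phi>) = real k * (0 - \<phi>) + 2 * pi * of_int (int k)" by (simp add: algebra_simps)
    then have "cos (real k * (2 * pi - \<phi>)) = cos (real k * (0 - \<phi>))"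
      "sin (real k * (2 * pi - \<phi>)) = sin (real k * (0 - \<phi>))"
      using sin_cos_eq_iff by blast+
    then show ?thesis using per[of 0] per'[of 0] unfolding G_def by simp
  qed
  have I1: "((\<lambda>\<theta>. g'' \<theta> * cos (real k * (\<theta> - \<phi>)) + (real k)\<^sup>2 * (g \<theta> * cos (real k * (\<theta> - \<phi>))))
      has_integral (G (2 * pi) - G 0)) {0..2 * pi}"
  proof (rule fundamental_theorem_of_calculus)
    fix \<theta>
    have "(G has_real_derivative g'' \<theta> * cos (real k * (\<theta> - \<phi>)) + (real k)\<^sup>2 * (g \<theta> * cos (real k * (\<theta> - \<phi>)))) (at \<theta>)"
      unfolding G_def
      by (rule derivative_eq_intros d1 d2 refl)+ (simp add: algebra_simps power2_eq_square)
    then show "(G has_vector_derivative g'' \<theta> * cos (real k * (\<theta> - \<phi>)) + (real k)\<^sup>2 * (g \<theta> * cos (real k * (\<theta> - \<phi>)))) (at \<theta> within {0..2 * pi})"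
      by (simp add: has_real_derivative_iff_has_vector_derivative has_vector_derivative_at_within)
  qed simp
  have I2: "((\<lambda>\<theta>. g'' \<theta> * cos (real k * (\<theta> - \<phi>)) + (real k)\<^sup>2 * (g \<theta> * cos (real k * (\<theta> - \<phi>))))
      has_integral (fourier_integral k \<phi> g'' + (real k)\<^sup>2 * fourier_integral k \<phi> g)) {0..2 * pi}"
    unfolding fourier_integral_def
    by (intro has_integral_add has_integral_mult_right integrable_integral fourier_integrable c cg)
  show ?thesis using has_integral_unique[OF I1 I2] G2 by simp
qed

text \<open>Eigenfunctions with different eigenvalues are orthogonal: the second derivative can be
  moved to the cosine, giving \<open>- k\<^sup>2\<close>, or applied to \<open>Y\<close>, giving
  \<open>- i\<^sup>2\<close>.\<close>

lemma fourier_integral_other_harmonic: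
  assumes Y: "Y \<in> spherical_harmonics i" and "i \<noteq> k"
  shows "fourier_integral k \<phi> Y = 0"
proof -
  note T = spherical_harmonics_trig_poly[OF Y]
  have "fourier_integral k \<phi> (deriv (deriv Y)) = - (real k)\<^sup>2 * fourier_integral k \<phi> Y"
    by (rule fourier_integral_deriv2[where g' = "deriv Y"])
      (auto intro!: trig_poly_deriv T trig_poly_periodic trig_poly_continuous)
  moreover have "fourier_integral k \<phi> (deriv (deriv Y)) = - (real i)\<^sup>2 * fourier_integral k \<phi> Y"
    unfolding fourier_integral_def spherical_harmonics_deriv2[OF Y]
    by (simp only: mult.assoc integral_mult_right)
  ultimately show ?thesis using \<open>i \<noteq> k\<close> by (auto simp: power2_eq_iff)
qed

lemma has_integral_cos_period:
  assumes "m > 0"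
  shows "((\<lambda>\<theta>. cos (real m * \<theta> - a)) has_integral 0) {0..2 * pi}"
proof -
  have "((\<lambda>\<theta>. cos (real m * \<theta> - a)) has_integral
      (sin (real m * (2 * pi) - a) / real m - sin (real m * 0 - a) / real m)) {0..2 * pi}"
  proof (rule fundamental_theorem_of_calculus)
    fix \<theta>
    have "((\<lambda>\<theta>. sin (real m * \<theta> - a) / real m) has_real_derivative cos (real m * \<theta> - a)) (at \<theta>)"
      using assms by (auto intro!: derivative_eq_intros)
    then show "((\<lambda>\<theta>. sin (real m * \<theta> - a) / real m) has_vector_derivative cos (real m * \<theta> - a)) (at \<theta> within {0..2 * pi})"
      by (simp add: has_real_derivative_iff_has_vector_derivative has_vector_derivative_at_within)
  qed simp
  moreover have "real m * (2 * pi) - a = (real m * 0 - a) + 2 * pi * of_int (int m)" by simp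
  then have "sin (real m * (2 * pi) - a) = sin (real m * 0 - a)" using sin_cos_eq_iff by blast
  ultimately show ?thesis by simp
qed

lemma fourier_mode_harmonic_same:
  assumes Y: "Y \<in> spherical_harmonics k"
  shows "fourier_mode k Y \<phi> = Y \<phi>"
proof (cases "k = 0")
  case True
  then show ?thesis using Y
    by (auto simp: fourier_mode_def fourier_integral_def spherical_harmonics_def)
next
  case False
  then obtain c d where Yd: "Y = (\<lambda>\<theta>. c * cos (real k * \<theta>) + d * sin (real k * \<theta>))"
    using Y by (auto simp: spherical_harmonics_def)
  \<comment> \<open>The integrand splits into its mean and oscillations of frequency
    \<open>2 * k\<close>. The sine is written as a cosine shifted by \<open>pi / 2\<close>, so that
    one vanishing integral serves both terms.\<close>
  have "((\<lambda>\<theta>. 1/2 * Y \<phi> + (c / 2 * cos (real (2 * k) * \<theta> - real k * \<phi>)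
        + d / 2 * cos (real (2 * k) * \<theta> - (real k * \<phi> + pi / 2))))
      has_integral (1/2 * Y \<phi> * (2 * pi - 0) + (c / 2 * 0 + d / 2 * 0))) {0..2 * pi}"
    using False
    by (intro has_integral_add has_integral_mult_right has_integral_cos_period)
       (auto intro: has_integral_const_real[THEN has_integral_eq_rhs])
  moreover have "1/2 * Y \<phi> + (c / 2 * cos (real (2 * k) * \<theta> - real k * \<phi>)
        + d / 2 * cos (real (2 * k) * \<theta> - (real k * \<phi> + pi / 2))) = Y \<theta> * cos (real k * (\<theta> - \<phi>))" for \<theta>
  proof -
    have 1: "cos (real (2 * k) * \<theta> - (real k * \<phi> + pi / 2)) = sin (real (2 * k) * \<theta> - real k * \<phi>)"
      by (simp add: cos_diff cos_add sin_add sin_diff)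
    have e: "real (2 * k) * \<theta> - real k * \<phi> = real k * \<theta> + real k * (\<theta> - \<phi>)"
      by (simp add: algebra_simps)
    have e3: "real k * \<theta> - real k * (\<theta> - \<phi>) = real k * \<phi>" by (simp add: algebra_simps)
    have c: "cos (real k * \<theta>) * cos (real k * (\<theta> - \<phi>))
        = (cos (real k * \<phi>) + cos (real (2 * k) * \<theta> - real k * \<phi>)) / 2"
      unfolding cos_times_cos e e3 by simp
    have s: "sin (real k * \<theta>) * cos (real k * (\<theta> - \<phi>))
        = (sin (real (2 * k) * \<theta> - real k * \<phi>) + sin (real k * \<phi>)) / 2"
      unfolding sin_times_cos e e3 by simp
    show ?thesis unfolding Yd 1 distrib_right mult.assoc c s by (simp add: field_simps)
  qed
  ultimately have "fourier_integral k \<phi> Y = Y \<phi> * pi"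
    unfolding fourier_integral_def by (simp add: integral_unique)
  then show ?thesis using False by (simp add: fourier_mode_def)
qed


section \<open>Completeness: recovering a function from its modes\<close>

lemma fourier_integral_zero_trig_poly:
  assumes g: "continuous_on {0..2 * pi} g" and z: "\<And>k \<phi>. fourier_integral k \<phi> g = 0"
    and p: "p \<in> trig_poly d"
  shows "((\<lambda>\<theta>. g \<theta> * p \<theta>) has_integral 0) {0..2 * pi}"
  using p
proof induction
  case (trig_poly_cos k)
  then show ?case
    using integrable_integral[OF fourier_integrable[OF g, of k 0]] z[of k 0]
    by (simp add: fourier_integral_def)
next
  case (trig_poly_sin k)
  show ?case
  proof (cases "k = 0")
    case False
    \<comment> \<open>The phase \<open>pi / (2 * k)\<close> turns the cosine into a sine; it needs
      \<open>k \<noteq> 0\<close>, and for \<open>k = 0\<close> the sine vanishes.\<close>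
    then have "cos (real k * (\<theta> - pi / (2 * real k))) = sin (real k * \<theta>)" for \<theta>
      by (simp add: right_diff_distrib cos_diff)
    then show ?thesis
      using integrable_integral[OF fourier_integrable[OF g, of k "pi / (2 * real k)"]]
        z[of k "pi / (2 * real k)"]
      by (simp add: fourier_integral_def)
  qed simp
next
  case (trig_poly_add p q)
  then show ?case using has_integral_add[OF trig_poly_add.IH] by (simp add: distrib_left)
next
  case (trig_poly_scale p c)
  then show ?case using has_integral_mult_right[OF trig_poly_scale.IH, of c]
    by (simp add: mult.left_commute)
qed simp

text \<open>Since \<open>g\<close> is orthogonal to every trigonometric polynomial \<open>p\<close>,
  the integral of \<open>g\<^sup>2\<close> equals that of \<open>g * (g - p)\<close>, which is small
  when \<open>p\<close> is uniformly close to \<open>g\<close>.\<close>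

lemma fourier_unique:
  assumes g: "continuous_on UNIV g" and per: "\<And>\<theta>. g (\<theta> + 2 * pi) = g \<theta>"
    and z: "\<And>k \<phi>. fourier_integral k \<phi> g = 0"
  shows "g \<theta> = 0"
proof -
  have g': "continuous_on {0..2 * pi} g" using g continuous_on_subset by blast
  define I where "I = integral {0..2 * pi} (\<lambda>\<theta>. g \<theta> * g \<theta>)"
  define M where "M = integral {0..2 * pi} (\<lambda>\<theta>. \<bar>g \<theta>\<bar>)"
  have I: "((\<lambda>\<theta>. g \<theta> * g \<theta>) has_integral I) {0..2 * pi}" unfolding I_def
    by (rule integrable_integral, rule integrable_continuous_interval) (intro continuous_intros g')
  have M: "((\<lambda>\<theta>. \<bar>g \<theta>\<bar>) has_integral M) {0..2 * pi}" unfolding M_def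
    by (rule integrable_integral, rule integrable_continuous_interval) (intro continuous_intros g')
  have le: "I \<le> e * M" if e: "e > 0" for e
  proof -
    obtain d p where p: "p \<in> trig_poly d" "\<And>\<theta>. \<bar>g \<theta> - p \<theta>\<bar> < e"
      using trig_poly_dense[OF g per e] by blast
    have "((\<lambda>\<theta>. g \<theta> * g \<theta> - g \<theta> * p \<theta>) has_integral (I - 0)) {0..2 * pi}"
      by (intro has_integral_diff I fourier_integral_zero_trig_poly[OF g' z p(1)])
    then have "I - 0 \<le> e * M"
    proof (rule has_integral_le)
      show "((\<lambda>\<theta>. e * \<bar>g \<theta>\<bar>) has_integral e * M) {0..2 * pi}"
        by (intro has_integral_mult_right M)
      fix \<theta>
      have "g \<theta> * g \<theta> - g \<theta> * p \<theta> \<le> \<bar>g \<theta> - p \<theta>\<bar> * \<bar>g \<theta>\<bar>"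
        by (metis abs_ge_self abs_mult left_diff_distrib mult.commute)
      also have "\<dots> \<le> e * \<bar>g \<theta>\<bar>" using p(2)[of \<theta>] by (intro mult_right_mono) auto
      finally show "g \<theta> * g \<theta> - g \<theta> * p \<theta> \<le> e * \<bar>g \<theta>\<bar>" .
    qed
    then show ?thesis by simp
  qed
  have M0: "M \<ge> 0" using M by (rule has_integral_nonneg) simp
  have "I \<le> 0"
  proof (rule ccontr)
    assume "\<not> I \<le> 0"
    \<comment> \<open>The choice \<open>e = I / (2 * (M + 1))\<close> would force
      \<open>I \<le> I / 2\<close>; the summand \<open>1\<close> keeps the denominator positive when
      \<open>M = 0\<close>.\<close>
    then have "I \<le> I / (2 * (M + 1)) * M" using M0 by (intro le) (simp add: field_simps)
    also have "I * (M + 2) > 0" using \<open>\<not> I \<le> 0\<close> M0 by (intro mult_pos_pos) auto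
    then have "I / (2 * (M + 1)) * M < I" using M0 by (simp add: field_simps)
    finally show False by simp
  qed
  moreover have "I \<ge> 0" using I by (rule has_integral_nonneg) simp
  ultimately have "I = 0" by simp
  then have "\<forall>x\<in>{0..2 * pi}. g x * g x = 0"
    unfolding I_def by (subst (asm) integral_eq_0_iff) (auto intro!: continuous_intros g')
  then show ?thesis using periodic_reduce[where g = g, OF per, of \<theta>] by auto
qed

text \<open>No convergence theorem for Fourier series of \<open>g\<close> is invoked: the assumed
  bounds make the series of modes converge uniformly to a continuous \<open>S\<close>, and
  \<open>S\<close> has the same modes as \<open>g\<close>, hence equals it.\<close>

lemma fourier_sum_bound:
  assumes g: "continuous_on UNIV g" and per: "\<And>\<theta>. g (\<theta> + 2 * pi) = g \<theta>"
    and B: "\<And>k \<phi>. \<bar>fourier_mode k g \<phi>\<bar> \<le> B k" and "summable B"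
  shows "\<bar>g \<theta>\<bar> \<le> suminf B"
proof -
  have g': "continuous_on {0..2 * pi} g" using g continuous_on_subset by blast
  define S where "S = (\<lambda>x. \<Sum>k. fourier_mode k g x)"
  note H = fourier_mode_harmonic[OF g']
  note T = spherical_harmonics_trig_poly[OF H]
  have unif: "uniform_limit UNIV (\<lambda>n x. \<Sum>k<n. fourier_mode k g x) S sequentially"
    unfolding S_def using B \<open>summable B\<close> by (intro Weierstrass_m_test) auto
  have cP: "continuous_on A (\<lambda>x. \<Sum>k<n. fourier_mode k g x)" for A n
    by (intro continuous_on_sum trig_poly_continuous[OF T])
  have cS: "continuous_on UNIV S"
    by (rule uniform_limit_theorem[OF _ unif]) (auto intro!: always_eventually cP)
  have cS': "continuous_on {0..2 * pi} S" using cS continuous_on_subset by blast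
  have perS: "S (x + 2 * pi) = S x" for x
    unfolding S_def using trig_poly_periodic[OF T] by simp
  have eq: "fourier_integral k \<phi> S = fourier_integral k \<phi> g" for k \<phi>
  proof -
    let ?f = "\<lambda>n \<theta>. (\<Sum>j<n. fourier_mode j g \<theta>) * cos (real k * (\<theta> - \<phi>))"
    have "uniform_limit {0..2 * pi} ?f (\<lambda>\<theta>. S \<theta> * cos (real k * (\<theta> - \<phi>))) sequentially"
    proof (rule uniform_lim_mult)
      show "uniform_limit {0..2 * pi} (\<lambda>n x. \<Sum>k<n. fourier_mode k g x) S sequentially"
        using unif uniform_limit_on_subset by blast
      show "bounded (S ` {0..2 * pi})"
        using cS' by (intro compact_imp_bounded compact_continuous_image) auto
      show "bounded ((\<lambda>\<theta>. cos (real k * (\<theta> - \<phi>))) ` {0..2 * pi})"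
        by (intro compact_imp_bounded compact_continuous_image continuous_intros) auto
    qed (rule uniform_limit_const)
    then obtain I J where IJ: "\<And>n. (?f n has_integral I n) {0..2 * pi}"
      "((\<lambda>\<theta>. S \<theta> * cos (real k * (\<theta> - \<phi>))) has_integral J) {0..2 * pi}" "I \<longlonglongrightarrow> J"
      by (rule uniform_limit_integral)
        (auto intro!: continuous_intros cP)
    \<comment> \<open>By orthogonality the partial sums have a constant \<open>k\<close>-th mode
      once \<open>n > k\<close>, so its limit is the mode of \<open>g\<close>.\<close>
    have "I n = fourier_integral k \<phi> g" if "n > k" for n
    proof -
      have "(?f n has_integral (\<Sum>j<n. fourier_integral k \<phi> (fourier_mode j g))) {0..2 * pi}"
        unfolding sum_distrib_right fourier_integral_def
        by (intro has_integral_sum integrable_integral fourier_integrable trig_poly_continuous[OF T]) auto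
      then have "I n = (\<Sum>j<n. fourier_integral k \<phi> (fourier_mode j g))"
        using IJ(1) has_integral_unique by blast
      also have "\<dots> = (\<Sum>j<n. if j = k then fourier_integral k \<phi> (fourier_mode k g) else 0)"
        by (intro sum.cong) (auto intro: fourier_integral_other_harmonic[OF H])
      also have "\<dots> = fourier_integral k \<phi> (fourier_mode k g)" using that by simp
      also have "\<dots> = fourier_integral k \<phi> g"
        using fourier_mode_harmonic_same[OF H, of k \<phi>] by (simp add: fourier_mode_def split: if_splits)
      finally show ?thesis .
    qed
    then have "I \<longlonglongrightarrow> fourier_integral k \<phi> g"
      by (intro tendsto_eventually eventually_sequentiallyI[of "Suc k"]) auto
    then have "J = fourier_integral k \<phi> g" using IJ(3) LIMSEQ_unique by blast
    then show ?thesis using IJ(2) by (simp add: fourier_integral_def integral_unique)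
  qed
  have "g \<theta> - S \<theta> = 0"
  proof (rule fourier_unique[where g = "\<lambda>\<theta>. g \<theta> - S \<theta>"])
    show "fourier_integral k \<phi> (\<lambda>\<theta>. g \<theta> - S \<theta>) = 0" for k \<phi>
      using eq[of k \<phi>] integral_diff[OF fourier_integrable[OF g', of k \<phi>] fourier_integrable[OF cS', of k \<phi>]]
      by (simp add: fourier_integral_def left_diff_distrib)
  qed (auto intro!: continuous_intros g cS simp: per perS)
  then have "\<bar>g \<theta>\<bar> = \<bar>S \<theta>\<bar>" by simp
  also have "\<dots> \<le> suminf B"
    unfolding S_def using B \<open>summable B\<close> by (intro norm_suminf_le[where 'a = real, simplified]) auto
  finally show ?thesis .
qed

text \<open>Taking modes of the equation, each mode of a solution is determined by \<open>h\<close>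
  through the factor \<open>\<kappa>\<^sup>2 - k\<^sup>2\<close>, except for
  \<open>k = \<kappa>\<close>. There the orthogonality hypothesis, void for non-integer
  \<open>\<kappa>\<close>, makes the mode vanish.\<close>

lemma circle_solution_unique:
  assumes q: "q \<in> circle_solutions \<kappa> h" "r \<in> circle_solutions \<kappa> h" and "\<kappa> > 0"
    and orth: "\<And>n Y. \<kappa> = real n \<Longrightarrow> Y \<in> spherical_harmonics n
       \<Longrightarrow> L2_circle_inner q Y = 0 \<and> L2_circle_inner r Y = 0"
  shows "q = r"
proof
  fix \<theta>
  have D: "(g has_real_derivative deriv g x) (at x)"
    "(deriv g has_real_derivative deriv (deriv g) x) (at x)"
    "continuous_on S g" "continuous_on S (deriv (deriv g))" "g (x + 2 * pi) = g x"
    if "g \<in> circle_solutions \<kappa> h" for g x S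
  proof -
    have d: "(deriv ^^ k) g differentiable at x" for k x
      using that by (auto simp: circle_solutions_def smooth_circle_def smooth_on_open_def)
    then have c: "continuous_on S ((deriv ^^ k) g)" for k
      by (intro differentiable_imp_continuous_on) (auto simp: differentiable_on_def intro: differentiable_at_withinI)
    show "(g has_real_derivative deriv g x) (at x)"
      "(deriv g has_real_derivative deriv (deriv g) x) (at x)"
      using d[of 0 x] d[of 1 x] by (auto simp: DERIV_deriv_iff_real_differentiable)
    show "continuous_on S g" "continuous_on S (deriv (deriv g))"
      using c[of 0] c[of 2] by (auto simp: numeral_2_eq_2)
    show "g (x + 2 * pi) = g x"
      using that by (auto simp: circle_solutions_def smooth_circle_def)
  qed
  have F: "(\<kappa>\<^sup>2 - (real k)\<^sup>2) * fourier_integral k \<phi> g = fourier_integral k \<phi> h"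
    if g: "g \<in> circle_solutions \<kappa> h" for g k \<phi>
  proof -
    have h: "h = (\<lambda>\<theta>. deriv (deriv g) \<theta> + \<kappa>\<^sup>2 * g \<theta>)"
      using g by (auto simp: circle_solutions_def)
    have "fourier_integral k \<phi> h
        = integral {0..2 * pi} (\<lambda>\<theta>. deriv (deriv g) \<theta> * cos (real k * (\<theta> - \<phi>))
             + \<kappa>\<^sup>2 * (g \<theta> * cos (real k * (\<theta> - \<phi>))))"
      unfolding fourier_integral_def h by (intro integral_cong) (simp add: algebra_simps)
    also have "\<dots> = fourier_integral k \<phi> (deriv (deriv g)) + \<kappa>\<^sup>2 * fourier_integral k \<phi> g"
      unfolding fourier_integral_def
      using fourier_integrable[OF D(4)[OF g]] fourier_integrable[OF D(3)[OF g]]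
      by (subst integral_add) (auto simp: integrable_on_mult_right)
    also have "fourier_integral k \<phi> (deriv (deriv g)) = - (real k)\<^sup>2 * fourier_integral k \<phi> g"
      by (rule fourier_integral_deriv2[OF D(1)[OF g] D(2)[OF g] D(4)[OF g] D(5)[OF g]])
    finally show ?thesis by (simp add: algebra_simps)
  qed
  have eq: "fourier_integral k \<phi> q = fourier_integral k \<phi> r" for k \<phi>
  proof (cases "\<kappa> = real k")
    case False
    then have "\<kappa>\<^sup>2 - (real k)\<^sup>2 \<noteq> 0" using \<open>\<kappa> > 0\<close> by (auto simp: power2_eq_iff)
    then show ?thesis using F[OF q(1), of k \<phi>] F[OF q(2), of k \<phi>] by (metis mult_cancel_left)
  next
    case True
    \<comment> \<open>In the resonant case the kernel of the mode integral is itself a harmonic of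
      degree \<open>k\<close>, so orthogonality applies to it.\<close>
    have "(\<lambda>\<theta>. cos (real k * (\<theta> - \<phi>)))
        = (\<lambda>\<theta>. cos (real k * \<phi>) * cos (real k * \<theta>) + sin (real k * \<phi>) * sin (real k * \<theta>))"
      by (simp add: right_diff_distrib cos_diff algebra_simps)
    then have "(\<lambda>\<theta>. cos (real k * (\<theta> - \<phi>))) \<in> spherical_harmonics k"
      using True \<open>\<kappa> > 0\<close> unfolding spherical_harmonics_def by auto
    then show ?thesis using orth[OF True] by (simp add: fourier_integral_def L2_circle_inner_def)
  qed
  have "q \<theta> - r \<theta> = 0"
  proof (rule fourier_unique[where g = "\<lambda>\<theta>. q \<theta> - r \<theta>"])
    show "fourier_integral k \<phi> (\<lambda>\<theta>. q \<theta> - r \<theta>) = 0" for k \<phi>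
      using eq[of k \<phi>] integral_diff[OF fourier_integrable[OF D(3)[OF q(1)], of k \<phi>] fourier_integrable[OF D(3)[OF q(2)], of k \<phi>]]
      by (simp add: fourier_integral_def left_diff_distrib)
  qed (auto intro!: continuous_on_diff D(3)[OF q(1)] D(3)[OF q(2)] simp: D(5)[OF q(1)] D(5)[OF q(2)])
  then show "q \<theta> = r \<theta>" by simp
qed

section \<open>Linear theory\<close>

text \<open>The function \<open>A / r * exp (r * t)\<close> is a primitive of the bound on
  \<open>y'\<close>; subtracting it from \<open>y\<close> or from \<open>- y\<close> gives a
  nonincreasing function. Negative \<open>r\<close> serves convergence at infinity, positive
  \<open>r\<close> the modes integrated forward from \<open>t0\<close>.\<close>

lemma growth_comparison:
  fixes y y' :: "real \<Rightarrow> real"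
  assumes d: "\<And>t. t \<ge> t0 \<Longrightarrow> (y has_real_derivative y' t) (at t within {t0..})"
    and b: "\<And>t. t \<ge> t0 \<Longrightarrow> \<bar>y' t\<bar> \<le> A * exp (r * t)" and r: "r \<noteq> 0"
    and st: "t0 \<le> s" "s \<le> t"
  shows "\<bar>y t - y s\<bar> \<le> A / r * (exp (r * t) - exp (r * s))"
proof -
  have *: "\<sigma> * y t - A / r * exp (r * t) \<le> \<sigma> * y s - A / r * exp (r * s)" if "\<bar>\<sigma>\<bar> = 1" for \<sigma> :: real
  proof (rule DERIV_nonpos_imp_decreasing_open[OF st(2)])
    show "continuous_on {s..t} (\<lambda>t. \<sigma> * y t - A / r * exp (r * t))"
    proof (intro continuous_intros)
      show "continuous_on {s..t} y"
        by (rule DERIV_continuous_on, rule DERIV_subset[OF d]) (use st in auto)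
    qed
    fix x assume x: "s < x" "x < t"
    have "(y has_real_derivative y' x) (at x)"
      using d[of x] x st by (simp add: at_within_interior[of x "{t0..}"])
    then have "((\<lambda>t. \<sigma> * y t - A / r * exp (r * t)) has_real_derivative (\<sigma> * y' x - A * exp (r * x))) (at x)"
      using r by (auto intro!: derivative_eq_intros)
    moreover have "\<sigma> * y' x \<le> A * exp (r * x)"
    proof -
      have "\<sigma> * y' x \<le> \<bar>\<sigma> * y' x\<bar>" by simp
      also have "\<dots> = \<bar>y' x\<bar>" using that by (simp add: abs_mult)
      also have "\<dots> \<le> A * exp (r * x)" using b[of x] x st by simp
      finally show ?thesis .
    qed
    ultimately show "\<exists>D. ((\<lambda>t. \<sigma> * y t - A / r * exp (r * t)) has_real_derivative D) (at x) \<and> D \<le> 0"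
      by (intro exI[of _ "\<sigma> * y' x - A * exp (r * x)"]) auto
  qed
  show ?thesis using *[of 1] *[of "-1"] by (simp add: right_diff_distrib abs_le_iff)
qed

lemma exp_decay_tendsto:
  assumes "r > 0" shows "((\<lambda>t::real. C * exp (- r * t)) \<longlongrightarrow> 0) at_top"
proof (rule tendsto_mult_right_zero)
  have "filterlim (\<lambda>s. - r * s) at_bot at_top"
    using assms by (intro filterlim_tendsto_neg_mult_at_bot[OF tendsto_const]) (auto simp: filterlim_ident)
  then show "((\<lambda>s. exp (- r * s)) \<longlongrightarrow> 0) at_top"
    by (rule filterlim_compose[OF exp_at_bot])
qed

text \<open>The derivative is integrable at infinity, so \<open>y\<close> has a limit
  \<open>c\<close>, and the error is the tail integral of the bound.\<close>

lemma decay_limit: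
  fixes y y' :: "real \<Rightarrow> real"
  assumes d: "\<And>t. t \<ge> t0 \<Longrightarrow> (y has_real_derivative y' t) (at t within {t0..})"
    and b: "\<And>t. t \<ge> t0 \<Longrightarrow> \<bar>y' t\<bar> \<le> A * exp (- r * t)" and r: "r > 0" and A: "A \<ge> 0"
  shows "\<exists>c. \<forall>t\<ge>t0. \<bar>y t - c\<bar> \<le> A / r * exp (- r * t)"
proof -
  have cmp: "\<bar>y t - y s\<bar> \<le> A / r * (exp (- r * s) - exp (- r * t))" if "t0 \<le> s" "s \<le> t" for s t
    using growth_comparison[of t0 y y' A "- r" s t] d b r that by (simp add: algebra_simps)
  have lim0: "((\<lambda>s. A / r * exp (- r * s)) \<longlongrightarrow> 0) at_top"
    by (rule exp_decay_tendsto[OF r])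
  have le: "\<bar>y t - y s\<bar> \<le> A / r * exp (- r * s)" if "t0 \<le> s" "s \<le> t" for s t
  proof -
    have "A / r * (exp (- r * s) - exp (- r * t)) \<le> A / r * exp (- r * s)"
      using A r by (intro mult_left_mono) auto
    then show ?thesis using cmp[OF that] by simp
  qed
  \<comment> \<open>Sampling at integer times reduces the limit to Cauchy sequences;
    \<open>max t0\<close> keeps the samples in the domain.\<close>
  have "convergent (\<lambda>n. y (max t0 (real n)))"
  proof (rule Cauchy_convergent, rule CauchyI')
    fix e :: real assume "e > 0"
    then have "eventually (\<lambda>s. A / r * exp (- r * s) < e) at_top"
      using lim0 by (auto simp: order_tendsto_iff)
    then obtain T where T: "\<And>s. s \<ge> T \<Longrightarrow> A / r * exp (- r * s) < e"
      by (auto simp: eventually_at_top_linorder)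
    show "\<exists>M. \<forall>m\<ge>M. \<forall>n>m. dist (y (max t0 (real m))) (y (max t0 (real n))) < e"
    proof (intro exI[of _ "nat \<lceil>T\<rceil>"] allI impI)
      fix m n assume "m \<ge> nat \<lceil>T\<rceil>" "n > m"
      then have "T \<le> max t0 (real m)" "max t0 (real m) \<le> max t0 (real n)" by linarith+
      then show "dist (y (max t0 (real m))) (y (max t0 (real n))) < e"
        using le[of "max t0 (real m)" "max t0 (real n)"] T[of "max t0 (real m)"]
        by (simp add: dist_real_def abs_minus_commute)
    qed
  qed
  then obtain c where c: "(\<lambda>n. y (max t0 (real n))) \<longlonglongrightarrow> c" by (auto simp: convergent_def)
  have "\<bar>y s - c\<bar> \<le> A / r * exp (- r * s)" if s: "t0 \<le> s" for s
  proof (rule tendsto_upperbound)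
    show "(\<lambda>n. \<bar>y s - y (max t0 (real n))\<bar>) \<longlonglongrightarrow> \<bar>y s - c\<bar>"
      by (intro tendsto_intros c)
    show "\<forall>\<^sub>F n in sequentially. \<bar>y s - y (max t0 (real n))\<bar> \<le> A / r * exp (- r * s)"
    proof (rule eventually_sequentiallyI[of "nat \<lceil>s\<rceil>"])
      fix n assume "n \<ge> nat \<lceil>s\<rceil>"
      then have "s \<le> max t0 (real n)" by linarith
      then show "\<bar>y s - y (max t0 (real n))\<bar> \<le> A / r * exp (- r * s)"
        using le[OF s, of "max t0 (real n)"] by (simp only: abs_minus_commute)
    qed
  qed simp
  then show ?thesis by blast
qed

text \<open>By the mean value theorem a bounded function with bounded second derivative has bounded first
  derivative, which rules out the solution growing like \<open>exp (k * t)\<close>.\<close>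

lemma mode_first_integral:
  fixes W W1 W2 :: "real \<Rightarrow> real"
  assumes t0: "t0 \<ge> 0"
    and d1: "\<And>t. t \<ge> t0 \<Longrightarrow> (W has_real_derivative W1 t) (at t within {t0..})"
    and d2: "\<And>t. t \<ge> t0 \<Longrightarrow> (W1 has_real_derivative W2 t) (at t within {t0..})"
    and H: "\<And>t. t \<ge> t0 \<Longrightarrow> \<bar>W2 t - k\<^sup>2 * W t\<bar> \<le> A * exp (- b * t)"
    and W: "\<And>t. t \<ge> t0 \<Longrightarrow> \<bar>W t\<bar> \<le> B * exp (- \<beta> * t)"
    and pos: "b > 0" "\<beta> > 0" "k \<ge> 0" "A \<ge> 0" "B \<ge> 0"
    and t: "t \<ge> t0"
  shows "\<bar>W1 t + k * W t\<bar> \<le> A / (k + b) * exp (- b * t)"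
proof -
  have mvt: "\<exists>\<xi>. x < \<xi> \<and> \<xi> < y \<and> h y - h x = (y - x) * h' \<xi>"
    if d: "\<And>t. t \<ge> t0 \<Longrightarrow> (h has_real_derivative h' t) (at t within {t0..})" and xy: "t0 \<le> x" "x < y"
    for h h' :: "real \<Rightarrow> real" and x y
  proof -
    have c: "continuous_on {x..y} h"
      by (rule DERIV_continuous_on, rule DERIV_subset[OF d]) (use xy in auto)
    have d': "(h has_real_derivative h' z) (at z)" if "x < z" for z
      using d[of z] xy that by (simp add: at_within_interior[of z "{t0..}"])
    obtain l z where "x < z" "z < y" "DERIV h z :> l" "h y - h x = (y - x) * l"
      using MVT[OF xy(2) c] d' real_differentiable_def by blast
    then show ?thesis using d' DERIV_unique by blast
  qed
  \<comment> \<open>Two mean value steps give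
    \<open>W1 s = W (s + 1) - W s - (\<xi> - s) * W2 \<eta>\<close>: the two values of
    \<open>W\<close> contribute \<open>2 * B\<close>, and the bound on \<open>W2\<close> contributes
    \<open>k\<^sup>2 * B\<close> and \<open>A\<close>.\<close>
  define U where "U = (\<lambda>t. (2 * B + k\<^sup>2 * B) * exp (- \<beta> * t) + A * exp (- b * t))"
  have W1: "\<bar>W1 s\<bar> \<le> U s" if s: "s \<ge> t0" for s
  proof -
    obtain \<xi> where \<xi>: "s < \<xi>" "\<xi> < s + 1" "W (s + 1) - W s = (s + 1 - s) * W1 \<xi>"
      using mvt[OF d1 s, of "s + 1"] by auto
    obtain \<eta> where \<eta>: "s < \<eta>" "\<eta> < \<xi>" "W1 \<xi> - W1 s = (\<xi> - s) * W2 \<eta>"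
      using mvt[OF d2 s \<xi>(1)] by auto
    have mono: "C * exp (- r * x) \<le> C * exp (- r * s)" if "C \<ge> 0" "r > 0" "s \<le> x" for C r x
      using that by (intro mult_left_mono) auto
    have "\<bar>W2 \<eta>\<bar> \<le> \<bar>W2 \<eta> - k\<^sup>2 * W \<eta>\<bar> + k\<^sup>2 * \<bar>W \<eta>\<bar>"
      using abs_triangle_ineq[of "W2 \<eta> - k\<^sup>2 * W \<eta>" "k\<^sup>2 * W \<eta>"] by (simp add: abs_mult)
    also have "\<dots> \<le> A * exp (- b * \<eta>) + k\<^sup>2 * (B * exp (- \<beta> * \<eta>))"
      using s \<eta> by (intro add_mono H mult_left_mono W) auto
    also have "\<dots> \<le> A * exp (- b * s) + k\<^sup>2 * (B * exp (- \<beta> * s))"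
      using \<eta> pos by (intro add_mono mult_left_mono mono) auto
    finally have W2: "\<bar>W2 \<eta>\<bar> \<le> A * exp (- b * s) + k\<^sup>2 * (B * exp (- \<beta> * s))" .
    have "\<bar>(\<xi> - s) * W2 \<eta>\<bar> \<le> 1 * \<bar>W2 \<eta>\<bar>"
      unfolding abs_mult using \<xi> by (intro mult_right_mono) auto
    moreover have "\<bar>W (s + 1)\<bar> \<le> B * exp (- \<beta> * s)"
      using W[of "s + 1"] mono[of B \<beta> "s + 1"] s pos by auto
    moreover have "\<bar>W s\<bar> \<le> B * exp (- \<beta> * s)" using W[OF s] .
    moreover have "W1 s = W (s + 1) - W s - (\<xi> - s) * W2 \<eta>" using \<xi>(3) \<eta>(3) by simp
    ultimately show ?thesis using W2 unfolding U_def by (simp add: distrib_right)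
  qed
  \<comment> \<open>The second-order operator factors, so
    \<open>G' - k * G = W2 - k\<^sup>2 * W\<close>; \<open>exp (- k * s)\<close> is the integrating
    factor for \<open>G\<close>.\<close>
  define G where "G = (\<lambda>s. W1 s + k * W s)"
  define y where "y = (\<lambda>s. exp (- k * s) * G s)"
  have "\<exists>c. \<forall>t\<ge>t0. \<bar>y t - c\<bar> \<le> A / (k + b) * exp (- (k + b) * t)"
  proof (rule decay_limit)
    fix s assume s: "s \<ge> t0"
    show "(y has_real_derivative exp (- k * s) * (W2 s - k\<^sup>2 * W s)) (at s within {t0..})"
      unfolding y_def G_def using d1[OF s] d2[OF s]
      by (auto intro!: derivative_eq_intros simp: algebra_simps power2_eq_square)
    have "exp (- k * s) * \<bar>W2 s - k\<^sup>2 * W s\<bar> \<le> exp (- k * s) * (A * exp (- b * s))"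
      using H[OF s] by (intro mult_left_mono) auto
    also have "\<dots> = A * exp (- (k + b) * s)" by (simp add: exp_add[symmetric] algebra_simps)
    finally show "\<bar>exp (- k * s) * (W2 s - k\<^sup>2 * W s)\<bar> \<le> A * exp (- (k + b) * s)"
      by (simp add: abs_mult)
  qed (use pos in auto)
  then obtain c where c: "\<And>t. t \<ge> t0 \<Longrightarrow> \<bar>y t - c\<bar> \<le> A / (k + b) * exp (- (k + b) * t)" by blast
  \<comment> \<open>A nonzero limit of \<open>y\<close> would be the growing solution. For
    \<open>k = 0\<close> the integrating factor gives no decay, so the decay of \<open>W\<close> and
    of \<open>W1\<close> is used, which works for all \<open>k\<close>.\<close>
  have "\<bar>c\<bar> \<le> 0"
  proof (rule tendsto_lowerbound)
    have "((\<lambda>t. (2 * B + k\<^sup>2 * B) * exp (- \<beta> * t) + A * exp (- b * t) + (k * B) * exp (- \<beta> * t)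
        + A / (k + b) * exp (- (k + b) * t)) \<longlongrightarrow> 0 + 0 + 0 + 0) at_top"
      using pos by (intro tendsto_add exp_decay_tendsto) auto
    then show "((\<lambda>t. U t + (k * B) * exp (- \<beta> * t) + A / (k + b) * exp (- (k + b) * t)) \<longlongrightarrow> 0) at_top"
      by (simp add: U_def)
    show "\<forall>\<^sub>F t in at_top. \<bar>c\<bar> \<le> U t + (k * B) * exp (- \<beta> * t) + A / (k + b) * exp (- (k + b) * t)"
      using eventually_ge_at_top[of t0]
    proof eventually_elim
      case (elim t)
      have "\<bar>y t\<bar> \<le> 1 * \<bar>G t\<bar>"
        unfolding y_def abs_mult using elim t0 pos by (intro mult_right_mono) auto
      also have "\<dots> \<le> \<bar>W1 t\<bar> + k * \<bar>W t\<bar>"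
        unfolding G_def using abs_triangle_ineq[of "W1 t" "k * W t"] pos by (simp add: abs_mult)
      also have "\<dots> \<le> U t + k * (B * exp (- \<beta> * t))"
        using elim pos by (intro add_mono W1 mult_left_mono W) auto
      finally show ?case using c[OF elim] by (simp add: mult.assoc)
    qed
  qed simp
  then have "\<bar>y t\<bar> \<le> A / (k + b) * exp (- (k + b) * t)" using c[OF t] by simp
  then have "exp (k * t) * \<bar>y t\<bar> \<le> exp (k * t) * (A / (k + b) * exp (- (k + b) * t))"
    by (intro mult_left_mono) auto
  also have "exp (k * t) * \<bar>y t\<bar> = \<bar>G t\<bar>"
    by (simp add: y_def abs_mult mult.assoc[symmetric] exp_add[symmetric])
  also have "exp (k * t) * (A / (k + b) * exp (- (k + b) * t)) = A / (k + b) * exp (- b * t)"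
    by (simp add: exp_add[symmetric] algebra_simps)
  finally show ?thesis unfolding G_def .
qed

text \<open>The remaining first-order equation says that \<open>exp (k * t) * W\<close> has
  derivative \<open>exp (k * t) * (W1 + k * W)\<close>. For \<open>k > b\<close> its bound grows, so
  it is integrated forward from \<open>t0\<close>, and the initial value survives with the fast rate
  \<open>k\<close>. The second constant is of order \<open>1 / k\<^sup>2\<close>, as the summation
  over modes requires.\<close>

lemma mode_high:
  fixes W W1 W2 :: "real \<Rightarrow> real"
  assumes t0: "t0 \<ge> 0"
    and d1: "\<And>t. t \<ge> t0 \<Longrightarrow> (W has_real_derivative W1 t) (at t within {t0..})"
    and d2: "\<And>t. t \<ge> t0 \<Longrightarrow> (W1 has_real_derivative W2 t) (at t within {t0..})"
    and H: "\<And>t. t \<ge> t0 \<Longrightarrow> \<bar>W2 t - k\<^sup>2 * W t\<bar> \<le> A * exp (- b * t)"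
    and W: "\<And>t. t \<ge> t0 \<Longrightarrow> \<bar>W t\<bar> \<le> B * exp (- \<beta> * t)"
    and pos: "b > 0" "\<beta> > 0" "b < k" "A \<ge> 0" "B \<ge> 0"
    and t: "t \<ge> t0"
  shows "\<bar>W t\<bar> \<le> \<bar>W t0\<bar> * exp (- k * (t - t0)) + A / ((k + b) * (k - b)) * exp (- b * t)"
proof -
  have k: "k \<ge> 0" using pos by simp
  define y where "y = (\<lambda>s. exp (k * s) * W s)"
  have "\<bar>y t - y t0\<bar> \<le> (A / (k + b)) / (k - b) * (exp ((k - b) * t) - exp ((k - b) * t0))"
  proof (rule growth_comparison[where y' = "\<lambda>s. exp (k * s) * (W1 s + k * W s)"])
    fix s assume s: "s \<ge> t0"
    show "(y has_real_derivative exp (k * s) * (W1 s + k * W s)) (at s within {t0..})"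
      unfolding y_def using d1[OF s] by (auto intro!: derivative_eq_intros simp: algebra_simps)
    have "exp (k * s) * \<bar>W1 s + k * W s\<bar> \<le> exp (k * s) * (A / (k + b) * exp (- b * s))"
      using mode_first_integral[OF t0 d1 d2 H W pos(1,2) k pos(4,5) s] by (intro mult_left_mono) auto
    also have "\<dots> = A / (k + b) * exp ((k - b) * s)" by (simp add: exp_add[symmetric] algebra_simps)
    finally show "\<bar>exp (k * s) * (W1 s + k * W s)\<bar> \<le> A / (k + b) * exp ((k - b) * s)"
      by (simp add: abs_mult)
  qed (use pos t in auto)
  also have "\<dots> \<le> (A / (k + b)) / (k - b) * exp ((k - b) * t)"
    using pos by (intro mult_left_mono) auto
  finally have "\<bar>y t\<bar> \<le> \<bar>y t0\<bar> + A / ((k + b) * (k - b)) * exp ((k - b) * t)" by simp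
  then have "exp (- k * t) * \<bar>y t\<bar> \<le> exp (- k * t) * (\<bar>y t0\<bar> + A / ((k + b) * (k - b)) * exp ((k - b) * t))"
    by (intro mult_left_mono) auto
  also have "exp (- k * t) * \<bar>y t\<bar> = \<bar>W t\<bar>"
    by (simp add: y_def abs_mult mult.assoc[symmetric] exp_add[symmetric])
  also have "exp (- k * t) * (\<bar>y t0\<bar> + A / ((k + b) * (k - b)) * exp ((k - b) * t))
     = \<bar>W t0\<bar> * (exp (- k * t) * exp (k * t0)) + A / ((k + b) * (k - b)) * (exp (- k * t) * exp ((k - b) * t))"
    by (simp add: y_def abs_mult algebra_simps)
  also have "exp (- k * t) * exp (k * t0) = exp (- k * (t - t0))" by (simp add: exp_add[symmetric] algebra_simps)
  also have "exp (- k * t) * exp ((k - b) * t) = exp (- b * t)" by (simp add: exp_add[symmetric] algebra_simps)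
  finally show ?thesis .
qed

text \<open>For \<open>k < b\<close> the derivative of \<open>exp (k * t) * W\<close> is integrable
  at infinity, so this function converges; its limit \<open>c\<close> is the amplitude of the free
  solution \<open>exp (- k * t)\<close>.\<close>

lemma mode_low:
  fixes W W1 W2 :: "real \<Rightarrow> real"
  assumes t0: "t0 \<ge> 0"
    and d1: "\<And>t. t \<ge> t0 \<Longrightarrow> (W has_real_derivative W1 t) (at t within {t0..})"
    and d2: "\<And>t. t \<ge> t0 \<Longrightarrow> (W1 has_real_derivative W2 t) (at t within {t0..})"
    and H: "\<And>t. t \<ge> t0 \<Longrightarrow> \<bar>W2 t - k\<^sup>2 * W t\<bar> \<le> A * exp (- b * t)"
    and W: "\<And>t. t \<ge> t0 \<Longrightarrow> \<bar>W t\<bar> \<le> B * exp (- \<beta> * t)"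
    and pos: "b > 0" "\<beta> > 0" "k \<ge> 0" "k < b" "A \<ge> 0" "B \<ge> 0"
  shows "\<exists>c. (k < \<beta> \<longrightarrow> c = 0) \<and> (\<forall>t\<ge>t0. \<bar>W t - c * exp (- k * t)\<bar> \<le> A / ((k + b) * (b - k)) * exp (- b * t))"
proof -
  define y where "y = (\<lambda>s. exp (k * s) * W s)"
  have "\<exists>c. \<forall>t\<ge>t0. \<bar>y t - c\<bar> \<le> (A / (k + b)) / (b - k) * exp (- (b - k) * t)"
  proof (rule decay_limit)
    fix s assume s: "s \<ge> t0"
    show "(y has_real_derivative exp (k * s) * (W1 s + k * W s)) (at s within {t0..})"
      unfolding y_def using d1[OF s] by (auto intro!: derivative_eq_intros simp: algebra_simps)
    have "exp (k * s) * \<bar>W1 s + k * W s\<bar> \<le> exp (k * s) * (A / (k + b) * exp (- b * s))"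
      using mode_first_integral[OF t0 d1 d2 H W pos(1,2,3,5,6) s] by (intro mult_left_mono) auto
    also have "\<dots> = A / (k + b) * exp (- (b - k) * s)" by (simp add: exp_add[symmetric] algebra_simps)
    finally show "\<bar>exp (k * s) * (W1 s + k * W s)\<bar> \<le> A / (k + b) * exp (- (b - k) * s)"
      by (simp add: abs_mult)
  qed (use pos in auto)
  then obtain c where c: "\<And>t. t \<ge> t0 \<Longrightarrow> \<bar>y t - c\<bar> \<le> A / ((k + b) * (b - k)) * exp (- (b - k) * t)" by auto
  have "\<bar>W t - c * exp (- k * t)\<bar> \<le> A / ((k + b) * (b - k)) * exp (- b * t)" if "t \<ge> t0" for t
  proof -
    have "exp (- k * t) * \<bar>y t - c\<bar> \<le> exp (- k * t) * (A / ((k + b) * (b - k)) * exp (- (b - k) * t))"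
      using c[OF that] by (intro mult_left_mono) auto
    also have "\<dots> = A / ((k + b) * (b - k)) * (exp (- k * t) * exp (- (b - k) * t))" by simp
    also have "exp (- k * t) * exp (- (b - k) * t) = exp (- b * t)" by (simp add: exp_add[symmetric] algebra_simps)
    also have "exp (- k * t) * \<bar>y t - c\<bar> = \<bar>exp (- k * t) * (y t - c)\<bar>" by (simp add: abs_mult)
    also have "exp (- k * t) * (y t - c) = W t - c * exp (- k * t)"
      by (simp add: y_def right_diff_distrib mult.assoc[symmetric] exp_add[symmetric])
    finally show ?thesis .
  qed
  \<comment> \<open>If \<open>W\<close> already decays faster than \<open>exp (- k * t)\<close>,
    then \<open>exp (k * t) * W\<close> tends to zero.\<close>
  moreover have "c = 0" if "k < \<beta>"
  proof -
    have "\<bar>c\<bar> \<le> 0"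
    proof (rule tendsto_lowerbound)
      show "((\<lambda>t. B * exp (- (\<beta> - k) * t) + A / ((k + b) * (b - k)) * exp (- (b - k) * t)) \<longlongrightarrow> 0) at_top"
        using pos that by (intro tendsto_add_zero exp_decay_tendsto) auto
      show "\<forall>\<^sub>F t in at_top. \<bar>c\<bar> \<le> B * exp (- (\<beta> - k) * t) + A / ((k + b) * (b - k)) * exp (- (b - k) * t)"
        using eventually_ge_at_top[of t0]
      proof eventually_elim
        case (elim t)
        have "\<bar>y t\<bar> \<le> exp (k * t) * (B * exp (- \<beta> * t))"
          unfolding y_def abs_mult using W[OF elim] by (intro mult_mono) auto
        also have "\<dots> = B * exp (- (\<beta> - k) * t)" by (simp add: exp_add[symmetric] algebra_simps)
        finally show ?case using c[OF elim] by simp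
      qed
    qed simp
    then show ?thesis by simp
  qed
  ultimately show ?thesis by blast
qed

section \<open>Calculus of exponential decay, uniform in the angle\<close>

definition decays :: "real \<Rightarrow> real \<Rightarrow> (real \<Rightarrow> real \<Rightarrow> real) \<Rightarrow> bool" where
  "decays t0 b F \<longleftrightarrow> (\<exists>C. \<forall>t\<ge>t0. \<forall>\<theta>. \<bar>F t \<theta>\<bar> \<le> C * exp (- b * t))"

lemma decaysE:
  assumes "decays t0 b F"
  obtains C where "C \<ge> 0" "\<And>t \<theta>. t \<ge> t0 \<Longrightarrow> \<bar>F t \<theta>\<bar> \<le> C * exp (- b * t)"
proof -
  obtain C where C: "\<And>t \<theta>. t \<ge> t0 \<Longrightarrow> \<bar>F t \<theta>\<bar> \<le> C * exp (- b * t)"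
    using assms unfolding decays_def by blast
  have "0 \<le> C * exp (- b * t0)" using C[of t0 0] abs_ge_zero order_trans by blast
  then have "C \<ge> 0" by (simp add: zero_le_mult_iff)
  with C that show thesis by blast
qed

lemma decays_add:
  assumes "decays t0 b F" "decays t0 b G" shows "decays t0 b (\<lambda>t \<theta>. F t \<theta> + G t \<theta>)"
proof -
  obtain C D where C: "\<And>t \<theta>. t \<ge> t0 \<Longrightarrow> \<bar>F t \<theta>\<bar> \<le> C * exp (- b * t)"
    and D: "\<And>t \<theta>. t \<ge> t0 \<Longrightarrow> \<bar>G t \<theta>\<bar> \<le> D * exp (- b * t)" using assms by (metis decaysE)
  have "\<bar>F t \<theta> + G t \<theta>\<bar> \<le> (C + D) * exp (- b * t)" if "t \<ge> t0" for t \<theta>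
    using C[OF that, of \<theta>] D[OF that, of \<theta>] by (simp add: distrib_right)
  then show ?thesis unfolding decays_def by blast
qed

lemma decays_mult:
  assumes "decays t0 b F" "decays t0 c G" shows "decays t0 (b + c) (\<lambda>t \<theta>. F t \<theta> * G t \<theta>)"
proof -
  obtain C D where C: "C \<ge> 0" "\<And>t \<theta>. t \<ge> t0 \<Longrightarrow> \<bar>F t \<theta>\<bar> \<le> C * exp (- b * t)"
    and D: "D \<ge> 0" "\<And>t \<theta>. t \<ge> t0 \<Longrightarrow> \<bar>G t \<theta>\<bar> \<le> D * exp (- c * t)" using assms by (metis decaysE)
  have "\<bar>F t \<theta> * G t \<theta>\<bar> \<le> (C * D) * exp (- (b + c) * t)" if "t \<ge> t0" for t \<theta>
  proof -
    have "\<bar>F t \<theta> * G t \<theta>\<bar> \<le> (C * exp (- b * t)) * (D * exp (- c * t))"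
      unfolding abs_mult using C D that by (intro mult_mono) auto
    also have "\<dots> = (C * D) * (exp (- b * t) * exp (- c * t))" by simp
    also have "exp (- b * t) * exp (- c * t) = exp (- (b + c) * t)"
      by (simp add: exp_add[symmetric] algebra_simps)
    finally show ?thesis .
  qed
  then show ?thesis unfolding decays_def by blast
qed

lemma decays_mono:
  assumes "decays t0 b F" "c \<le> b" "t0 \<ge> 0" shows "decays t0 c F"
proof -
  obtain C where C: "C \<ge> 0" "\<And>t \<theta>. t \<ge> t0 \<Longrightarrow> \<bar>F t \<theta>\<bar> \<le> C * exp (- b * t)" using assms(1) by (metis decaysE)
  have "\<bar>F t \<theta>\<bar> \<le> C * exp (- c * t)" if "t \<ge> t0" for t \<theta>
  proof -
    have "C * exp (- b * t) \<le> C * exp (- c * t)"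
      using assms C(1) that by (intro mult_left_mono) (auto intro: mult_right_mono)
    then show ?thesis using C(2)[OF that, of \<theta>] by simp
  qed
  then show ?thesis unfolding decays_def by blast
qed

lemma decays_bound:
  assumes "\<And>t \<theta>. t \<ge> t0 \<Longrightarrow> \<bar>F t \<theta>\<bar> \<le> \<bar>G t \<theta>\<bar>" "decays t0 b G"
  shows "decays t0 b F"
  using assms unfolding decays_def by (meson order_trans)

lemma decays_exp:
  assumes "\<And>\<theta>. \<bar>p \<theta>\<bar> \<le> C" shows "decays t0 b (\<lambda>t \<theta>. p \<theta> * exp (- b * t))"
  unfolding decays_def using assms by (intro exI[of _ C]) (simp add: abs_mult)

lemma decays_trig_poly: "p \<in> trig_poly d \<Longrightarrow> decays t0 b (\<lambda>t \<theta>. p \<theta> * exp (- b * t))"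
  using trig_poly_bounded decays_exp by metis

lemma decays_zero: "decays t0 b (\<lambda>t \<theta>. 0)"
  unfolding decays_def by (intro exI[of _ 0]) simp

lemma decays_const: "decays t0 0 (\<lambda>t \<theta>. c)"
  unfolding decays_def by (intro exI[of _ "\<bar>c\<bar>"]) simp

lemma decays_cmult: "decays t0 b F \<Longrightarrow> decays t0 b (\<lambda>t \<theta>. c * F t \<theta>)"
  using decays_mult[OF decays_const, of t0 b F c] by simp

lemma decays_diff:
  assumes "decays t0 b F" "decays t0 b G" shows "decays t0 b (\<lambda>t \<theta>. F t \<theta> - G t \<theta>)"
  using decays_add[OF assms(1) decays_cmult[OF assms(2), of "-1"]] by simp

lemma decays_sum:
  assumes "\<And>i. i \<in> I \<Longrightarrow> decays t0 b (F i)"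
  shows "decays t0 b (\<lambda>t \<theta>. \<Sum>i\<in>I. F i t \<theta>)"
  using assms by (induction I rule: infinite_finite_induct) (auto intro: decays_zero decays_add)

text \<open>The derivatives are existential witnesses, so subtracting an explicit term only requires
  subtracting its derivatives. The continuity conditions allow differentiation under the integral
  and Fourier integration of the equation.\<close>

definition cylinder_solution :: "real \<Rightarrow> (real \<Rightarrow> real \<Rightarrow> real) \<Rightarrow> (real \<Rightarrow> real \<Rightarrow> real) \<Rightarrow> bool" where
  "cylinder_solution t0 w h \<longleftrightarrow> (\<exists>wt wtt wx wxx.
     (\<forall>t\<ge>t0. \<forall>\<theta>.
        ((\<lambda>s. w s \<theta>) has_real_derivative wt t \<theta>) (at t within {t0..}) \<and>
        ((\<lambda>s. wt s \<theta>) has_real_derivative wtt t \<theta>) (at t within {t0..}) \<and>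
        (w t has_real_derivative wx t \<theta>) (at \<theta>) \<and>
        (wx t has_real_derivative wxx t \<theta>) (at \<theta>) \<and>
        w t (\<theta> + 2 * pi) = w t \<theta> \<and>
        wtt t \<theta> + wxx t \<theta> = h t \<theta>) \<and>
     continuous_on ({t0..} \<times> UNIV) (\<lambda>(t, \<theta>). w t \<theta>) \<and>
     continuous_on ({t0..} \<times> UNIV) (\<lambda>(t, \<theta>). wt t \<theta>) \<and>
     continuous_on ({t0..} \<times> UNIV) (\<lambda>(t, \<theta>). wtt t \<theta>) \<and>
     continuous_on ({t0..} \<times> UNIV) (\<lambda>(t, \<theta>). wxx t \<theta>))"

text \<open>On a separated term \<open>p * exp (- \<mu> * t)\<close> the operator acts as
  \<open>p'' + \<mu>\<^sup>2 * p\<close>: a particular solution cancels forcing, and a harmonic of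
  degree \<open>\<mu>\<close> leaves it unchanged.\<close>

lemma cylinder_solution_diff:
  assumes w: "cylinder_solution t0 w h" and p: "p \<in> trig_poly d"
  shows "cylinder_solution t0 (\<lambda>t \<theta>. w t \<theta> - p \<theta> * exp (- \<mu> * t))
     (\<lambda>t \<theta>. h t \<theta> - (deriv (deriv p) \<theta> + \<mu>\<^sup>2 * p \<theta>) * exp (- \<mu> * t))"
proof -
  obtain wt wtt wx wxx where D:
    "\<And>t \<theta>. t \<ge> t0 \<Longrightarrow> ((\<lambda>s. w s \<theta>) has_real_derivative wt t \<theta>) (at t within {t0..})"
    "\<And>t \<theta>. t \<ge> t0 \<Longrightarrow> ((\<lambda>s. wt s \<theta>) has_real_derivative wtt t \<theta>) (at t within {t0..})"
    "\<And>t \<theta>. t \<ge> t0 \<Longrightarrow> (w t has_real_derivative wx t \<theta>) (at \<theta>)"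
    "\<And>t \<theta>. t \<ge> t0 \<Longrightarrow> (wx t has_real_derivative wxx t \<theta>) (at \<theta>)"
    "\<And>t \<theta>. t \<ge> t0 \<Longrightarrow> w t (\<theta> + 2 * pi) = w t \<theta>"
    "\<And>t \<theta>. t \<ge> t0 \<Longrightarrow> wtt t \<theta> + wxx t \<theta> = h t \<theta>"
    "continuous_on ({t0..} \<times> UNIV) (\<lambda>x. w (fst x) (snd x))"
    "continuous_on ({t0..} \<times> UNIV) (\<lambda>x. wt (fst x) (snd x))"
    "continuous_on ({t0..} \<times> UNIV) (\<lambda>x. wtt (fst x) (snd x))"
    "continuous_on ({t0..} \<times> UNIV) (\<lambda>x. wxx (fst x) (snd x))"
    using w unfolding cylinder_solution_def case_prod_beta by blast
  have c: "continuous_on S (\<lambda>x. q (snd x) * (c * exp (- \<mu> * fst x)))" if "q \<in> trig_poly d" for q c S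
    by (intro continuous_intros continuous_on_compose2[OF trig_poly_continuous[OF that, of UNIV]]) auto
  show ?thesis
    unfolding cylinder_solution_def case_prod_beta
  proof (intro exI conjI allI impI)
    fix t \<theta> assume t: "t \<ge> t0"
    show "((\<lambda>s. w s \<theta> - p \<theta> * exp (- \<mu> * s)) has_real_derivative (wt t \<theta> - p \<theta> * (- \<mu> * exp (- \<mu> * t)))) (at t within {t0..})"
      using D(1)[OF t] by (auto intro!: derivative_eq_intros)
    show "((\<lambda>s. wt s \<theta> - p \<theta> * (- \<mu> * exp (- \<mu> * s))) has_real_derivative (wtt t \<theta> - p \<theta> * (\<mu>\<^sup>2 * exp (- \<mu> * t)))) (at t within {t0..})"
      using D(2)[OF t] by (auto intro!: derivative_eq_intros simp: power2_eq_square)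
    show "((\<lambda>\<theta>. w t \<theta> - p \<theta> * exp (- \<mu> * t)) has_real_derivative (wx t \<theta> - deriv p \<theta> * exp (- \<mu> * t))) (at \<theta>)"
      using D(3)[OF t] trig_poly_deriv(2)[OF p] by (intro DERIV_diff DERIV_cmult_right)
    \<comment> \<open>The factor \<open>1\<close> gives the witness the shape
      \<open>q * (c * exp ...)\<close> of the continuity fact \<open>c\<close>.\<close>
    show "((\<lambda>\<theta>. wx t \<theta> - deriv p \<theta> * exp (- \<mu> * t)) has_real_derivative (wxx t \<theta> - deriv (deriv p) \<theta> * (1 * exp (- \<mu> * t)))) (at \<theta>)"
      using D(4)[OF t] trig_poly_deriv(2)[OF trig_poly_deriv(1)[OF p]] by (simp add: DERIV_diff DERIV_cmult_right)
    show "w t (\<theta> + 2 * pi) - p (\<theta> + 2 * pi) * exp (- \<mu> * t) = w t \<theta> - p \<theta> * exp (- \<mu> * t)"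
      using D(5)[OF t] trig_poly_periodic[OF p] by simp
    show "wtt t \<theta> - p \<theta> * (\<mu>\<^sup>2 * exp (- \<mu> * t)) + (wxx t \<theta> - deriv (deriv p) \<theta> * (1 * exp (- \<mu> * t))) =
        h t \<theta> - (deriv (deriv p) \<theta> + \<mu>\<^sup>2 * p \<theta>) * exp (- \<mu> * t)"
      using D(6)[OF t, of \<theta>] by (simp add: algebra_simps)
  next
    show "continuous_on ({t0..} \<times> UNIV) (\<lambda>x. w (fst x) (snd x) - p (snd x) * exp (- \<mu> * fst x))"
      using c[OF p, of _ 1] by (intro continuous_on_diff D) simp
    show "continuous_on ({t0..} \<times> UNIV) (\<lambda>x. wt (fst x) (snd x) - p (snd x) * (- \<mu> * exp (- \<mu> * fst x)))"
      "continuous_on ({t0..} \<times> UNIV) (\<lambda>x. wtt (fst x) (snd x) - p (snd x) * (\<mu>\<^sup>2 * exp (- \<mu> * fst x)))"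
      "continuous_on ({t0..} \<times> UNIV) (\<lambda>x. wxx (fst x) (snd x) - deriv (deriv p) (snd x) * (1 * exp (- \<mu> * fst x)))"
      by (intro continuous_on_diff D c p trig_poly_deriv(1))+
  qed
qed

section \<open>Fourier modes of solutions on the half-cylinder\<close>

lemma continuous_on_slice:
  fixes F :: "real \<Rightarrow> real \<Rightarrow> real"
  assumes "continuous_on ({t0..} \<times> UNIV) (\<lambda>(t, \<theta>). F t \<theta>)" "t \<ge> t0"
  shows "continuous_on S (F t)"
proof -
  have "continuous_on S ((\<lambda>(t, \<theta>). F t \<theta>) \<circ> (\<lambda>\<theta>. (t, \<theta>)))"
    by (intro continuous_on_compose continuous_on_subset[OF assms(1)] continuous_on_Pair
        continuous_on_const continuous_on_id) (use assms(2) in auto)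
  then show ?thesis by (simp add: comp_def)
qed

lemma fourier_integral_bound:
  assumes "continuous_on {0..2 * pi} g" "\<And>\<theta>. \<bar>g \<theta>\<bar> \<le> M"
  shows "\<bar>fourier_integral k \<phi> g\<bar> \<le> M * (2 * pi)"
proof -
  have "norm (integral {0..2 * pi} (\<lambda>\<theta>. g \<theta> * cos (real k * (\<theta> - \<phi>)))) \<le> M * (2 * pi - 0)"
  proof (rule integral_bound)
    show "continuous_on {0..2 * pi} (\<lambda>\<theta>. g \<theta> * cos (real k * (\<theta> - \<phi>)))"
      by (intro continuous_intros assms)
    fix \<theta>
    have "\<bar>g \<theta>\<bar> * \<bar>cos (real k * (\<theta> - \<phi>))\<bar> \<le> M * 1"
      using assms(2)[of \<theta>] by (intro mult_mono) auto
    then show "norm (g \<theta> * cos (real k * (\<theta> - \<phi>))) \<le> M" by (simp add: abs_mult)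
  qed simp
  then show ?thesis by (simp add: fourier_integral_def)
qed

lemma fourier_integral_has_derivative:
  assumes d: "\<And>t \<theta>. t \<ge> t0 \<Longrightarrow> ((\<lambda>s. w s \<theta>) has_real_derivative wt t \<theta>) (at t within {t0..})"
    and c: "continuous_on ({t0..} \<times> UNIV) (\<lambda>(t, \<theta>). w t \<theta>)" "continuous_on ({t0..} \<times> UNIV) (\<lambda>(t, \<theta>). wt t \<theta>)"
    and t: "t \<ge> t0"
  shows "((\<lambda>t. fourier_integral k \<phi> (w t)) has_real_derivative fourier_integral k \<phi> (wt t)) (at t within {t0..})"
proof -
  have "((\<lambda>x. integral (cbox 0 (2 * pi)) (\<lambda>\<theta>. w x \<theta> * cos (real k * (\<theta> - \<phi>)))) has_field_derivative
      integral (cbox 0 (2 * pi)) (\<lambda>\<theta>. wt t \<theta> * cos (real k * (\<theta> - \<phi>)))) (at t within {t0..})"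
  proof (rule leibniz_rule_field_derivative)
    fix s \<theta> :: real assume "s \<in> {t0..}"
    then show "((\<lambda>x. w x \<theta> * cos (real k * (\<theta> - \<phi>))) has_real_derivative wt s \<theta> * cos (real k * (\<theta> - \<phi>))) (at s within {t0..})"
      using d[of s \<theta>] by (intro DERIV_cmult_right) auto
  next
    fix s assume "s \<in> {t0..}"
    then show "(\<lambda>\<theta>. w s \<theta> * cos (real k * (\<theta> - \<phi>))) integrable_on cbox 0 (2 * pi)"
      using fourier_integrable[OF continuous_on_slice[OF c(1), of s], of k \<phi>] by simp
  next
    have "continuous_on ({t0..} \<times> cbox 0 (2 * pi)) (\<lambda>(t, \<theta>). wt t \<theta>)"
      by (rule continuous_on_subset[OF c(2)]) auto
    then show "continuous_on ({t0..} \<times> cbox 0 (2 * pi)) (\<lambda>(x, \<theta>). wt x \<theta> * cos (real k * (\<theta> - \<phi>)))"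
      unfolding case_prod_beta by (intro continuous_intros)
  qed (use t in auto)
  then show ?thesis by (simp add: fourier_integral_def)
qed

lemma cylinder_solution_continuous:
  assumes "cylinder_solution t0 w h" "t \<ge> t0" shows "continuous_on S (w t)" "continuous_on S (h t)"
proof -
  obtain wtt wxx where D:
    "\<And>t \<theta>. t \<ge> t0 \<Longrightarrow> wtt t \<theta> + wxx t \<theta> = h t \<theta>"
    "continuous_on ({t0..} \<times> UNIV) (\<lambda>(t, \<theta>). w t \<theta>)"
    "continuous_on ({t0..} \<times> UNIV) (\<lambda>(t, \<theta>). wtt t \<theta>)"
    "continuous_on ({t0..} \<times> UNIV) (\<lambda>(t, \<theta>). wxx t \<theta>)"
    using assms(1) unfolding cylinder_solution_def by blast
  note s = continuous_on_slice[OF _ assms(2)]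
  show "continuous_on S (w t)" using s[OF D(2)] .
  have "h t = (\<lambda>\<theta>. wtt t \<theta> + wxx t \<theta>)" using D(1)[OF assms(2)] by auto
  then show "continuous_on S (h t)" using s[OF D(3)] s[OF D(4)] by (auto intro!: continuous_intros)
qed

lemma cylinder_solution_mode:
  assumes w: "cylinder_solution t0 w h"
  shows "\<exists>W1 W2. \<forall>t\<ge>t0. ((\<lambda>t. fourier_integral k \<phi> (w t)) has_real_derivative W1 t) (at t within {t0..}) \<and>
    (W1 has_real_derivative W2 t) (at t within {t0..}) \<and>
    W2 t - (real k)\<^sup>2 * fourier_integral k \<phi> (w t) = fourier_integral k \<phi> (h t)"
proof -
  obtain wt wtt wx wxx where D:
    "\<And>t \<theta>. t \<ge> t0 \<Longrightarrow> ((\<lambda>s. w s \<theta>) has_real_derivative wt t \<theta>) (at t within {t0..})"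
    "\<And>t \<theta>. t \<ge> t0 \<Longrightarrow> ((\<lambda>s. wt s \<theta>) has_real_derivative wtt t \<theta>) (at t within {t0..})"
    "\<And>t \<theta>. t \<ge> t0 \<Longrightarrow> (w t has_real_derivative wx t \<theta>) (at \<theta>)"
    "\<And>t \<theta>. t \<ge> t0 \<Longrightarrow> (wx t has_real_derivative wxx t \<theta>) (at \<theta>)"
    "\<And>t \<theta>. t \<ge> t0 \<Longrightarrow> w t (\<theta> + 2 * pi) = w t \<theta>"
    "\<And>t \<theta>. t \<ge> t0 \<Longrightarrow> wtt t \<theta> + wxx t \<theta> = h t \<theta>"
    and c: "continuous_on ({t0..} \<times> UNIV) (\<lambda>(t, \<theta>). w t \<theta>)"
    "continuous_on ({t0..} \<times> UNIV) (\<lambda>(t, \<theta>). wt t \<theta>)"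
    "continuous_on ({t0..} \<times> UNIV) (\<lambda>(t, \<theta>). wtt t \<theta>)"
    "continuous_on ({t0..} \<times> UNIV) (\<lambda>(t, \<theta>). wxx t \<theta>)"
    using w unfolding cylinder_solution_def by blast
  note s = continuous_on_slice[where S = "{0..2 * pi}"]
  have "fourier_integral k \<phi> (wtt t) - (real k)\<^sup>2 * fourier_integral k \<phi> (w t) = fourier_integral k \<phi> (h t)"
    if t: "t \<ge> t0" for t
  proof -
    have "h t = (\<lambda>\<theta>. wtt t \<theta> + wxx t \<theta>)" using D(6)[OF t] by auto
    then have "fourier_integral k \<phi> (h t) = fourier_integral k \<phi> (wtt t) + fourier_integral k \<phi> (wxx t)"
      unfolding fourier_integral_def
      using integral_add[OF fourier_integrable[OF s[OF c(3) t], of k \<phi>] fourier_integrable[OF s[OF c(4) t], of k \<phi>]]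
      by (simp add: distrib_right)
    also have "fourier_integral k \<phi> (wxx t) = - (real k)\<^sup>2 * fourier_integral k \<phi> (w t)"
      by (rule fourier_integral_deriv2[OF D(3)[OF t] D(4)[OF t] s[OF c(4) t] D(5)[OF t]])
    finally show ?thesis by simp
  qed
  then show ?thesis
    using fourier_integral_has_derivative[OF D(1) c(1,2)] fourier_integral_has_derivative[OF D(2) c(2,3)]
    by (intro exI[of _ "\<lambda>t. fourier_integral k \<phi> (wt t)"] exI[of _ "\<lambda>t. fourier_integral k \<phi> (wtt t)"]) auto
qed


text \<open>The amplitude \<open>c\<close> may depend on \<open>k\<close> and \<open>\<phi>\<close>,
  but the constants in the bounds do not involve \<open>\<phi>\<close> and are explicit in
  \<open>k\<close>; that is what allows the summation over modes. In the first bound the initial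
  value is at most \<open>B * (2 * pi)\<close>, since \<open>t0 \<ge> 0\<close>.\<close>

lemma mode_bounds:
  assumes w: "cylinder_solution t0 w h" and t0: "t0 \<ge> 0"
    and dw: "\<forall>t\<ge>t0. \<forall>\<theta>. \<bar>w t \<theta>\<bar> \<le> B * exp (- \<beta> * t)"
    and dh: "\<forall>t\<ge>t0. \<forall>\<theta>. \<bar>h t \<theta>\<bar> \<le> A * exp (- b * t)"
    and pos: "\<beta> > 0" "b > 0" "A \<ge> 0" "B \<ge> 0"
  shows "b < real k \<Longrightarrow> t \<ge> t0 \<Longrightarrow> \<bar>fourier_integral k \<phi> (w t)\<bar> \<le>
      B * (2 * pi) * exp (- real k * (t - t0)) + A * (2 * pi) / ((real k + b) * (real k - b)) * exp (- b * t)"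
    and "real k < b \<Longrightarrow> \<exists>c. (real k < \<beta> \<longrightarrow> c = 0) \<and>
      (\<forall>t\<ge>t0. \<bar>fourier_integral k \<phi> (w t) - c * exp (- real k * t)\<bar>
         \<le> A * (2 * pi) / ((real k + b) * (b - real k)) * exp (- b * t))"
proof -
  obtain W1 W2 where W: "\<And>t. t \<ge> t0 \<Longrightarrow> ((\<lambda>t. fourier_integral k \<phi> (w t)) has_real_derivative W1 t) (at t within {t0..})"
    "\<And>t. t \<ge> t0 \<Longrightarrow> (W1 has_real_derivative W2 t) (at t within {t0..})"
    "\<And>t. t \<ge> t0 \<Longrightarrow> W2 t - (real k)\<^sup>2 * fourier_integral k \<phi> (w t) = fourier_integral k \<phi> (h t)"
    using cylinder_solution_mode[OF w, of k \<phi>] by blast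
  have H: "\<bar>W2 t - (real k)\<^sup>2 * fourier_integral k \<phi> (w t)\<bar> \<le> A * (2 * pi) * exp (- b * t)" if "t \<ge> t0" for t
    using fourier_integral_bound[OF cylinder_solution_continuous(2)[OF w that] dh[rule_format, OF that], of k \<phi>] W(3)[OF that]
    by (simp add: algebra_simps)
  have F: "\<bar>fourier_integral k \<phi> (w t)\<bar> \<le> B * (2 * pi) * exp (- \<beta> * t)" if "t \<ge> t0" for t
    using fourier_integral_bound[OF cylinder_solution_continuous(1)[OF w that] dw[rule_format, OF that], of k \<phi>]
    by (simp add: algebra_simps)
  have p: "A * (2 * pi) \<ge> 0" "B * (2 * pi) \<ge> 0" using pos by auto
  show "\<exists>c. (real k < \<beta> \<longrightarrow> c = 0) \<and>
      (\<forall>t\<ge>t0. \<bar>fourier_integral k \<phi> (w t) - c * exp (- real k * t)\<bar>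
         \<le> A * (2 * pi) / ((real k + b) * (b - real k)) * exp (- b * t))" if "real k < b"
    using mode_low[OF t0 W(1,2) H F pos(2,1) _ that p] by simp
  show "\<bar>fourier_integral k \<phi> (w t)\<bar> \<le>
      B * (2 * pi) * exp (- real k * (t - t0)) + A * (2 * pi) / ((real k + b) * (real k - b)) * exp (- b * t)"
    if "b < real k" "t \<ge> t0"
  proof -
    have "B * exp (- \<beta> * t0) \<le> B * 1" using pos t0 by (intro mult_left_mono) auto
    then have "B * exp (- \<beta> * t0) * (2 * pi) \<le> B * (2 * pi)" by (intro mult_right_mono) auto
    then have "\<bar>fourier_integral k \<phi> (w t0)\<bar> \<le> B * (2 * pi)" using F[of t0] by (simp add: algebra_simps)
    then have "\<bar>fourier_integral k \<phi> (w t0)\<bar> * exp (- real k * (t - t0)) \<le> B * (2 * pi) * exp (- real k * (t - t0))"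
      by (intro mult_right_mono) auto
    then show ?thesis using mode_high[OF t0 W(1,2) H F pos(2,1) that(1) p that(2)] by linarith
  qed
qed

text \<open>Only finitely many \<open>k\<close> lie below \<open>b\<close>, so \<open>C\<close> may
  be arbitrary; the rest is dominated by a geometric series and by the series of
  \<open>1 / k\<^sup>2\<close>.\<close>

lemma summable_high_modes:
  fixes b M N :: real assumes "b > 0"
  shows "summable (\<lambda>k. if real k < b then C k else M * exp (- (real k - b)) + N / ((real k + b) * (real k - b)))"
proof (rule summable_comparison_test_ev)
  let ?g = "\<lambda>k::nat. \<bar>M\<bar> * exp b * exp (- 1) ^ k + \<bar>N\<bar> * 2 * inverse (real k ^ 2)"
  show "summable ?g"
    by (intro summable_add summable_mult summable_geometric inverse_power_summable) auto
  show "\<forall>\<^sub>F k in sequentially. norm (if real k < b then C k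
      else M * exp (- (real k - b)) + N / ((real k + b) * (real k - b))) \<le> ?g k"
  \<comment> \<open>Beyond \<open>2 * b\<close> one has
    \<open>k\<^sup>2 \<le> 2 * (k\<^sup>2 - b\<^sup>2)\<close>, the origin of the factor
    \<open>2\<close> in the comparison series.\<close>
  proof (rule eventually_sequentiallyI[of "nat \<lceil>2 * b\<rceil> + 1"])
    fix k assume "k \<ge> nat \<lceil>2 * b\<rceil> + 1"
    then have k: "real k > 2 * b" by linarith
    have "2 * b * (2 * b) \<le> real k * real k" using k assms by (intro mult_mono) auto
    moreover have "b * b > 0" using assms by simp
    ultimately have "real k * real k \<le> 2 * ((real k + b) * (real k - b))" by (simp add: algebra_simps)
    moreover have aux: "1 / X \<le> 2 * inverse S" if "0 < X" "0 < S" "S \<le> 2 * X" for X S :: real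
      using that by (simp add: field_simps)
    ultimately have "1 / ((real k + b) * (real k - b)) \<le> 2 * inverse (real k ^ 2)"
      using k assms unfolding power2_eq_square by (intro aux mult_pos_pos) auto
    then have "\<bar>N\<bar> * (1 / ((real k + b) * (real k - b))) \<le> \<bar>N\<bar> * (2 * inverse (real k ^ 2))"
      by (intro mult_left_mono) auto
    moreover have "exp (- (real k - b)) = exp b * exp (- 1) ^ k"
      by (simp add: exp_of_nat_mult[symmetric] exp_add[symmetric])
    moreover have "norm (M * exp (- (real k - b)) + N / ((real k + b) * (real k - b)))
       \<le> \<bar>M\<bar> * exp (- (real k - b)) + \<bar>N\<bar> * (1 / ((real k + b) * (real k - b)))"
    proof -
      have "\<bar>(real k + b) * (real k - b)\<bar> = (real k + b) * (real k - b)" using k assms by simp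
      then show ?thesis
        using abs_triangle_ineq[of "M * exp (- (real k - b))" "N / ((real k + b) * (real k - b))"]
        by (simp only: real_norm_def abs_mult abs_divide abs_exp_cancel) simp
    qed
    ultimately show "norm (if real k < b then C k
      else M * exp (- (real k - b)) + N / ((real k + b) * (real k - b))) \<le> ?g k"
      using k assms by (simp add: mult.assoc)
  qed
qed

text \<open>Near \<open>t = t0\<close> the bound on the high Fourier modes is not summable, but there any constant bound will do.\<close>

lemma decay_of_modes:
  assumes w: "cylinder_solution t0 w h" and t0: "t0 \<ge> 0"
    and dw: "decays t0 \<beta> w" and dh: "decays t0 b h" and pos: "\<beta> > 0" "b > 0"
    and nb: "\<And>k::nat. real k \<noteq> b"
    and low: "\<And>k. real k < b \<Longrightarrow> \<exists>C. \<forall>t\<ge>t0. \<forall>\<phi>. \<bar>fourier_integral k \<phi> (w t)\<bar> \<le> C * exp (- b * t)"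
  shows "decays t0 b w"
proof -
  obtain A where A: "A \<ge> 0" "\<forall>t\<ge>t0. \<forall>\<theta>. \<bar>h t \<theta>\<bar> \<le> A * exp (- b * t)" using dh by (metis decaysE)
  obtain B where B: "B \<ge> 0" "\<forall>t\<ge>t0. \<forall>\<theta>. \<bar>w t \<theta>\<bar> \<le> B * exp (- \<beta> * t)" using dw by (metis decaysE)
  obtain C where C: "\<And>k t \<phi>. real k < b \<Longrightarrow> t \<ge> t0 \<Longrightarrow> \<bar>fourier_integral k \<phi> (w t)\<bar> \<le> C k * exp (- b * t)"
    using low by metis
  \<comment> \<open>From \<open>exp (- k * (t - t0)) = exp (- b * t) * exp (b * t0) * exp (- (k - b)
    * (t - t0))\<close>; for \<open>t \<ge> t0 + 1\<close> the last factor is at most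
    \<open>exp (- (k - b))\<close>, which is summable in \<open>k\<close>.\<close>
  define M where "M = B * (2 * pi) * exp (b * t0)"
  define N where "N = A * (2 * pi)"
  define D where "D = (\<lambda>k. if real k < b then C k else M * exp (- (real k - b)) + N / ((real k + b) * (real k - b)))"
  have D: "\<bar>fourier_integral k \<phi> (w t)\<bar> \<le> D k * exp (- b * t)" if t: "t \<ge> t0 + 1" for k t \<phi>
  proof (cases "real k < b")
    case True then show ?thesis using C t unfolding D_def by simp
  next
    case False
    then have k: "b < real k" using nb[of k] by simp
    have "exp (- real k * (t - t0)) = exp (- b * t) * exp (b * t0) * exp (- (real k - b) * (t - t0))"
      by (simp add: exp_add[symmetric] algebra_simps)
    also have "\<dots> \<le> exp (- b * t) * exp (b * t0) * exp (- (real k - b))"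
    proof -
      have "(real k - b) * 1 \<le> (real k - b) * (t - t0)" using k t by (intro mult_left_mono) auto
      then have "- (real k - b) * (t - t0) \<le> - (real k - b)"
        unfolding mult_minus_left by simp
      then show ?thesis by (intro mult_left_mono) auto
    qed
    finally have "B * (2 * pi) * exp (- real k * (t - t0)) \<le> B * (2 * pi) * (exp (- b * t) * exp (b * t0) * exp (- (real k - b)))"
      using B by (intro mult_left_mono) auto
    also have "\<dots> = M * exp (- (real k - b)) * exp (- b * t)" by (simp add: M_def)
    finally have "B * (2 * pi) * exp (- real k * (t - t0)) \<le> M * exp (- (real k - b)) * exp (- b * t)" .
    moreover have "D k * exp (- b * t) = M * exp (- (real k - b)) * exp (- b * t)
        + N / ((real k + b) * (real k - b)) * exp (- b * t)"
      using False by (simp add: D_def distrib_right)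
    ultimately show ?thesis
      using mode_bounds(1)[OF w t0 B(2) A(2) pos A(1) B(1) k, of t \<phi>] t unfolding N_def by simp
  qed
  have sD: "summable D" unfolding D_def by (rule summable_high_modes[OF pos(2)])
  obtain wper: "\<And>t \<theta>. t \<ge> t0 \<Longrightarrow> w t (\<theta> + 2 * pi) = w t \<theta>"
    using w unfolding cylinder_solution_def by blast
  have late: "\<bar>w t \<theta>\<bar> \<le> suminf D * exp (- b * t)" if t: "t \<ge> t0 + 1" for t \<theta>
  proof -
    have tt: "t \<ge> t0" using t by simp
    have "\<bar>w t \<theta>\<bar> \<le> (\<Sum>k. D k * exp (- b * t))"
    proof (rule fourier_sum_bound[OF cylinder_solution_continuous(1)[OF w tt] wper[OF tt]])
      show "summable (\<lambda>k. D k * exp (- b * t))" using sD by (rule summable_mult2)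
      fix k \<phi>
      have "\<bar>fourier_mode k (w t) \<phi>\<bar> \<le> 1 * \<bar>fourier_integral k \<phi> (w t)\<bar>"
        unfolding fourier_mode_def abs_mult using pi_ge_two by (intro mult_right_mono) auto
      then show "\<bar>fourier_mode k (w t) \<phi>\<bar> \<le> D k * exp (- b * t)" using D[OF t, of k \<phi>] by simp
    qed
    then show ?thesis using suminf_mult2[OF sD] by simp
  qed
  \<comment> \<open>The second entry serves \<open>t0 \<le> t < t0 + 1\<close>: there
    \<open>w\<close> is bounded by \<open>B\<close>, and
    \<open>exp (b * (t0 + 1)) * exp (- b * t) \<ge> 1\<close>.\<close>
  define E where "E = max (suminf D) (B * exp (b * (t0 + 1)))"
  have "\<bar>w t \<theta>\<bar> \<le> E * exp (- b * t)" if t: "t \<ge> t0" for t \<theta>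
  proof (cases "t \<ge> t0 + 1")
    case True
    have "suminf D * exp (- b * t) \<le> E * exp (- b * t)" unfolding E_def by (intro mult_right_mono) auto
    with late[OF True, of \<theta>] show ?thesis by (rule order_trans)
  next
    case False
    have "\<bar>w t \<theta>\<bar> \<le> B * exp (- \<beta> * t)" using B(2) t by blast
    also have "\<dots> \<le> B * (exp (b * (t0 + 1)) * exp (- b * t))"
    proof -
      have "- \<beta> * t \<le> 0" using pos t0 t by simp
      moreover have "0 \<le> b * (t0 + 1 - t)" using False pos by simp
      ultimately have "- \<beta> * t \<le> b * (t0 + 1) + - b * t" by (simp add: algebra_simps)
      then show ?thesis using B(1) by (intro mult_left_mono) (simp_all add: exp_add[symmetric])
    qed
    also have "\<dots> = B * exp (b * (t0 + 1)) * exp (- b * t)" by simp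
    also have "\<dots> \<le> E * exp (- b * t)" unfolding E_def by (intro mult_right_mono) auto
    finally show ?thesis .
  qed
  then show ?thesis unfolding decays_def by blast
qed

lemma spherical_harmonicsI:
  "0 < n \<Longrightarrow> (\<lambda>\<theta>. c * cos (real n * \<theta>) + d * sin (real n * \<theta>)) \<in> spherical_harmonics n"
  unfolding spherical_harmonics_def by auto

text \<open>By \<open>gap\<close>, the only integer that can lie in \<open>[\<beta>, b]\<close> is
  \<open>\<kappa>\<close>. Modes below \<open>\<beta>\<close> have no free part, modes above
  \<open>b\<close> decay fast enough, so at most the harmonic of degree \<open>\<kappa>\<close> has
  to be removed.\<close>

lemma linear_expansion:
  assumes w: "cylinder_solution t0 w h" and t0: "t0 \<ge> 0"
    and dw: "decays t0 \<beta> w" and dh: "decays t0 b h" and pos: "0 < \<beta>" "\<beta> < \<kappa>" "\<kappa> < b"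
    and gap: "\<And>k::nat. real k < \<beta> \<or> real k = \<kappa> \<or> b < real k"
  shows "\<exists>Y. (\<forall>n. \<kappa> = real n \<longrightarrow> Y \<in> spherical_harmonics n) \<and>
     ((\<forall>n. \<kappa> \<noteq> real n) \<longrightarrow> Y = (\<lambda>_. 0)) \<and>
     decays t0 b (\<lambda>t \<theta>. w t \<theta> - Y \<theta> * exp (- \<kappa> * t))"
proof -
  obtain A where A: "A \<ge> 0" "\<forall>t\<ge>t0. \<forall>\<theta>. \<bar>h t \<theta>\<bar> \<le> A * exp (- b * t)" using dh by (metis decaysE)
  obtain B where B: "B \<ge> 0" "\<forall>t\<ge>t0. \<forall>\<theta>. \<bar>w t \<theta>\<bar> \<le> B * exp (- \<beta> * t)" using dw by (metis decaysE)
  have b: "b > 0" using pos by simp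
  have nb: "real k \<noteq> b" for k :: nat using gap[of k] pos by auto
  note modes = mode_bounds(2)[OF w t0 B(2) A(2) pos(1) b A(1) B(1)]
  have low: "\<exists>C. \<forall>t\<ge>t0. \<forall>\<phi>. \<bar>fourier_integral k \<phi> (w t)\<bar> \<le> C * exp (- b * t)"
    if k: "real k < b" "real k \<noteq> \<kappa>" for k
  proof -
    have "real k < \<beta>" using gap[of k] k by auto
    then have "\<bar>fourier_integral k \<phi> (w t)\<bar> \<le> A * (2 * pi) / ((real k + b) * (b - real k)) * exp (- b * t)"
      if "t \<ge> t0" for t \<phi>
      using modes[OF k(1), of \<phi>] that by auto
    then show ?thesis by blast
  qed
  show ?thesis
  proof (cases "\<exists>n. \<kappa> = real n")
    case False
    have "decays t0 b w"
      using decay_of_modes[OF w t0 dw dh pos(1) b nb] low False by metis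
    then show ?thesis using False by (intro exI[of _ "\<lambda>_. 0"]) auto
  next
    case True
    then obtain n where n: "\<kappa> = real n" by blast
    then have n0: "n > 0" using pos by auto
    \<comment> \<open>At this phase the cosine kernel becomes a sine, so the limits at phases
      \<open>0\<close> and \<open>\<phi>1\<close> are the two coefficients of the harmonic, up to
      the factor \<open>pi\<close>.\<close>
    define \<phi>1 where "\<phi>1 = pi / (2 * real n)"
    define K where "K = A * (2 * pi) / ((real n + b) * (b - real n))"
    have nlt: "real n < b" using n pos by simp
    obtain c where c: "\<And>t. t \<ge> t0 \<Longrightarrow> \<bar>fourier_integral n 0 (w t) - c * exp (- real n * t)\<bar> \<le> K * exp (- b * t)"
      using modes[OF nlt, of 0] unfolding K_def by blast
    obtain d where d: "\<And>t. t \<ge> t0 \<Longrightarrow> \<bar>fourier_integral n \<phi>1 (w t) - d * exp (- real n * t)\<bar> \<le> K * exp (- b * t)"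
      using modes[OF nlt, of \<phi>1] unfolding K_def by blast
    define Y where "Y = (\<lambda>\<phi>. (c / pi) * cos (real n * \<phi>) + (d / pi) * sin (real n * \<phi>))"
    have Y: "Y \<in> spherical_harmonics n" unfolding Y_def using n0 by (rule spherical_harmonicsI)
    note TY = spherical_harmonics_trig_poly[OF Y]
    \<comment> \<open>Subtracting the resonant harmonic leaves the right-hand side \<open>h\<close>
      unchanged and removes the free part of mode \<open>n\<close>, so every low mode of
      \<open>u\<close> has rate \<open>b\<close>.\<close>
    define u where "u = (\<lambda>t \<theta>. w t \<theta> - Y \<theta> * exp (- \<kappa> * t))"
    have u: "cylinder_solution t0 u h"
      using cylinder_solution_diff[OF w TY, of \<kappa>] unfolding u_def
      by (simp add: spherical_harmonics_deriv2[OF Y] n)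
    have FY: "fourier_integral n \<phi> Y = pi * Y \<phi>" for \<phi>
      using fourier_mode_harmonic_same[OF Y, of \<phi>] n0 by (simp add: fourier_mode_def field_simps)
    have Fu: "fourier_integral k \<phi> (u t) = fourier_integral k \<phi> (w t) - exp (- \<kappa> * t) * fourier_integral k \<phi> Y"
      if "t \<ge> t0" for k \<phi> t
    proof -
      have "fourier_integral k \<phi> (u t) = integral {0..2 * pi} (\<lambda>\<theta>. w t \<theta> * cos (real k * (\<theta> - \<phi>))
          - exp (- \<kappa> * t) * (Y \<theta> * cos (real k * (\<theta> - \<phi>))))"
        unfolding fourier_integral_def u_def by (intro integral_cong) (simp add: algebra_simps)
      then show ?thesis
        unfolding fourier_integral_def
        using fourier_integrable[OF cylinder_solution_continuous(1)[OF w that], of k \<phi>]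
          fourier_integrable[OF trig_poly_continuous[OF TY], of k \<phi>]
        by (simp add: integral_diff integrable_on_mult_right)
    qed
    have "decays t0 b u"
    proof (rule decay_of_modes[OF u t0 _ dh pos(1) b nb])
      show "decays t0 \<beta> u" unfolding u_def
        using pos by (intro decays_diff dw decays_mono[OF decays_trig_poly[OF TY] _ t0]) simp
      fix k assume k: "real k < b"
      show "\<exists>C. \<forall>t\<ge>t0. \<forall>\<phi>. \<bar>fourier_integral k \<phi> (u t)\<bar> \<le> C * exp (- b * t)"
      proof (cases "k = n")
        case False
        then have "fourier_integral k \<phi> Y = 0" for \<phi> using fourier_integral_other_harmonic[OF Y] by simp
        then show ?thesis using low[OF k] False n Fu by auto
      next
        case True
        have "\<bar>fourier_integral n \<phi> (u t)\<bar> \<le> (2 * K) * exp (- b * t)" if t: "t \<ge> t0" for t \<phi>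
        proof -
          note ex = fourier_integral_expand[OF cylinder_solution_continuous(1)[OF w t], of n]
          have r: "real n * \<phi>1 = pi / 2" using n0 by (simp add: \<phi>1_def)
          have "fourier_integral n \<phi> (w t) = fourier_integral n 0 (w t) * cos (real n * \<phi>)
              + fourier_integral n \<phi>1 (w t) * sin (real n * \<phi>)"
            using ex[of 0] ex[of \<phi>1, unfolded r] ex[of \<phi>] by simp
          then have "fourier_integral n \<phi> (u t) = (fourier_integral n 0 (w t) - c * exp (- real n * t)) * cos (real n * \<phi>)
              + (fourier_integral n \<phi>1 (w t) - d * exp (- real n * t)) * sin (real n * \<phi>)"
            unfolding Fu[OF t] FY unfolding Y_def n by (simp add: field_simps)
          also have "\<bar>\<dots>\<bar> \<le> \<bar>fourier_integral n 0 (w t) - c * exp (- real n * t)\<bar> * \<bar>cos (real n * \<phi>)\<bar>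
              + \<bar>fourier_integral n \<phi>1 (w t) - d * exp (- real n * t)\<bar> * \<bar>sin (real n * \<phi>)\<bar>"
            unfolding abs_mult[symmetric] by (rule abs_triangle_ineq)
          also have "\<dots> \<le> K * exp (- b * t) * 1 + K * exp (- b * t) * 1"
            using c[OF t] d[OF t] by (intro add_mono mult_mono) (auto intro: order_trans[OF abs_ge_zero])
          finally show ?thesis by simp
        qed
        then show ?thesis using True by blast
      qed
    qed
    then show ?thesis using Y n unfolding u_def by (intro exI[of _ Y]) auto
  qed
qed

section \<open>The index sequence and the nonlinearity\<close>

text \<open>The summands with \<open>i \<ge> 1\<close> add up to a natural number, and
  \<open>i = 1\<close> alone produces all of them; so the index set is generated by
  \<open>\<tau>0\<close> and \<open>1\<close>.\<close>

lemma index_set_iff: "s \<in> index_set \<tau>0 \<longleftrightarrow> s \<noteq> 0 \<and> (\<exists>a b. s = real a * \<tau>0 + real b)"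
proof
  assume "s \<in> index_set \<tau>0"
  then obtain m :: "nat \<Rightarrow> nat" where m: "s \<noteq> 0" "finite {i. m i > 0}"
    "s = (\<Sum>i\<in>{i. m i > 0}. real (m i) * rho \<tau>0 i)" by (auto simp: index_set_def)
  have "s = (\<Sum>i\<in>insert 0 ({i. m i > 0} - {0}). real (m i) * rho \<tau>0 i)"
    unfolding m(3) using m(2) by (intro sum.mono_neutral_left) auto
  also have "\<dots> = real (m 0) * \<tau>0 + (\<Sum>i\<in>{i. m i > 0} - {0}. real (m i * i))"
    using m(2) by (subst sum.insert) (auto simp: rho_def)
  also have "(\<Sum>i\<in>{i. m i > 0} - {0}. real (m i * i)) = real (\<Sum>i\<in>{i. m i > 0} - {0}. m i * i)" by simp
  finally show "s \<noteq> 0 \<and> (\<exists>a b. s = real a * \<tau>0 + real b)" using m(1) by blast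
next
  assume "s \<noteq> 0 \<and> (\<exists>a b. s = real a * \<tau>0 + real b)"
  then obtain a b where s: "s \<noteq> 0" "s = real a * \<tau>0 + real b" by blast
  define m where "m = (\<lambda>i::nat. if i = 0 then a else if i = 1 then b else 0)"
  have sub: "{i. m i > 0} \<subseteq> {0, 1}" by (auto simp: m_def split: if_splits)
  have "(\<Sum>i\<in>{i. m i > 0}. real (m i) * rho \<tau>0 i) = (\<Sum>i\<in>{0, 1}. real (m i) * rho \<tau>0 i)"
    using sub by (intro sum.mono_neutral_left) auto
  also have "\<dots> = s" by (simp add: m_def rho_def s(2))
  finally show "s \<in> index_set \<tau>0"
    unfolding index_set_def using s(1) finite_subset[OF sub] by auto
qed

locale index_sequence =
  fixes \<tau>0 :: real and \<mu> :: "nat \<Rightarrow> real"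
  assumes \<tau>0: "\<tau>0 > 0" and \<mu>: "is_index_sequence \<tau>0 \<mu>"
begin

text \<open>With the value \<open>0\<close> added, the exponents form an additive monoid, and the
  constant \<open>a 0\<close> becomes the coefficient of index \<open>0\<close> in
  \<open>f (v)\<close>. The case \<open>\<mu> l = \<tau>0\<close> then has the same form as
  \<open>\<mu> l = \<tau>0 + \<mu> m\<close>.\<close>

definition \<nu> :: "nat \<Rightarrow> real" where "\<nu> m = (if m = 0 then 0 else \<mu> m)"

lemma \<nu>_0 [simp]: "\<nu> 0 = 0" and \<nu>_pos_eq: "m \<ge> 1 \<Longrightarrow> \<nu> m = \<mu> m"
  by (auto simp: \<nu>_def)

lemma \<nu>_mem:
  assumes "l \<ge> 1" shows "\<nu> l \<in> index_set \<tau>0"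
proof -
  have "\<mu> l \<in> \<mu> ` {1..}" using assms by (intro imageI) simp
  also have "\<mu> ` {1..} = index_set \<tau>0" using \<mu> by (simp only: is_index_sequence_def)
  finally show ?thesis using assms by (simp add: \<nu>_def)
qed

lemma \<nu>_surj:
  assumes "s \<in> index_set \<tau>0" shows "\<exists>l\<ge>1. \<nu> l = s"
proof -
  have "index_set \<tau>0 = \<mu> ` {1..}" using \<mu> by (simp only: is_index_sequence_def)
  then obtain l where "l \<ge> 1" "\<mu> l = s" using assms by auto
  then show ?thesis by (intro exI[of _ l]) (simp add: \<nu>_def)
qed

lemma \<nu>_mono: "i < j \<Longrightarrow> \<nu> i < \<nu> j"
proof (cases "i = 0")
  case True
  assume "i < j"
  then show ?thesis using index_set_pos[OF \<tau>0 \<nu>_mem, of j] True by simp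
next
  case False
  assume "i < j"
  then show ?thesis using \<mu> False by (auto simp: \<nu>_def is_index_sequence_def strict_mono_on_def)
qed

lemma \<nu>_less_iff: "\<nu> i < \<nu> j \<longleftrightarrow> i < j" and \<nu>_le_iff: "\<nu> i \<le> \<nu> j \<longleftrightarrow> i \<le> j"
  and \<nu>_eq_iff: "\<nu> i = \<nu> j \<longleftrightarrow> i = j"
proof -
  have "strict_mono \<nu>" using \<nu>_mono by (simp add: strict_mono_def)
  then show "\<nu> i < \<nu> j \<longleftrightarrow> i < j" "\<nu> i \<le> \<nu> j \<longleftrightarrow> i \<le> j" "\<nu> i = \<nu> j \<longleftrightarrow> i = j"
    by (simp_all add: strict_mono_less strict_mono_less_eq strict_mono_eq)
qed

lemma \<nu>_nonneg: "\<nu> i \<ge> 0"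
  using \<nu>_le_iff[of 0 i] by simp

lemma \<nu>_repr: "\<exists>a b. \<nu> l = real a * \<tau>0 + real b"
proof (cases "l = 0")
  case True
  then show ?thesis by (intro exI[of _ 0]) simp
next
  case False
  then show ?thesis using \<nu>_mem[of l] by (simp add: index_set_iff)
qed

lemma \<nu>_obtain:
  obtains l where "\<nu> l = real a * \<tau>0 + real b"
proof (cases "real a * \<tau>0 + real b = 0")
  case True
  then show ?thesis using that[of 0] by simp
next
  case False
  then show ?thesis using that \<nu>_surj[of "real a * \<tau>0 + real b"] by (auto simp: index_set_iff)
qed

lemma \<nu>_add: "\<exists>l. \<nu> l = \<nu> i + \<nu> j"
proof -
  obtain a b where ab: "\<nu> i = real a * \<tau>0 + real b" using \<nu>_repr by blast
  obtain c d where cd: "\<nu> j = real c * \<tau>0 + real d" using \<nu>_repr by blast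
  obtain l where "\<nu> l = real (a + c) * \<tau>0 + real (b + d)" by (rule \<nu>_obtain)
  then show ?thesis unfolding ab cd by (intro exI[of _ l]) (simp add: algebra_simps)
qed

lemma \<nu>_nat: "\<exists>l. \<nu> l = real n"
  using \<nu>_obtain[of 0 n thesis for thesis] by auto

text \<open>Each summand is a positive exponent and therefore raises the index by at least one.
  Hence a tuple with sum \<open>\<nu> m\<close> has length at most \<open>m\<close>, which is why
  the sum over \<open>j\<close> in the recursion stops at \<open>m\<close>.\<close>

lemma \<nu>_sum_list: "\<forall>k\<in>set ks. 1 \<le> k \<Longrightarrow> \<exists>l. \<nu> l = (\<Sum>k\<leftarrow>ks. \<nu> k) \<and> length ks \<le> l"
proof (induction ks)
  case Nil
  then show ?case by (intro exI[of _ 0]) simp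
next
  case (Cons k ks)
  then obtain l where l: "\<nu> l = (\<Sum>k\<leftarrow>ks. \<nu> k)" "length ks \<le> l" by auto
  obtain l' where l': "\<nu> l' = \<nu> k + \<nu> l" using \<nu>_add by blast
  have "\<nu> l < \<nu> l'" using l' \<nu>_less_iff[of 0 k] Cons.prems by auto
  then have "l < l'" by (simp add: \<nu>_less_iff)
  then show ?case using l l' by (intro exI[of _ l']) auto
qed

lemma \<nu>_shift: "\<exists>l. \<nu> l = \<tau>0 + \<nu> m"
proof -
  obtain a b where ab: "\<nu> m = real a * \<tau>0 + real b" using \<nu>_repr by blast
  obtain l where "\<nu> l = real (Suc a) * \<tau>0 + real b" by (rule \<nu>_obtain)
  then show ?thesis unfolding ab by (intro exI[of _ l]) (simp add: algebra_simps)
qed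

text \<open>Multiplication by \<open>exp (- \<tau>0 * t)\<close> as a map on indices.\<close>

definition shift :: "nat \<Rightarrow> nat" where "shift m = (SOME l. \<nu> l = \<tau>0 + \<nu> m)"

lemma \<nu>_shift_eq: "\<nu> (shift m) = \<tau>0 + \<nu> m"
  unfolding shift_def using someI_ex[OF \<nu>_shift] .

lemma shift_iff: "shift m = l \<longleftrightarrow> \<nu> l = \<tau>0 + \<nu> m"
  using \<nu>_shift_eq[of m] by (auto simp: \<nu>_eq_iff[symmetric])

lemma shift_gt: "m < shift m"
  using \<nu>_shift_eq[of m] \<tau>0 \<nu>_less_iff[of m "shift m"] by simp

lemma \<nu>_Suc_le: "\<nu> (Suc m) \<le> \<tau>0 + \<nu> m"
  using shift_gt[of m] \<nu>_le_iff[of "Suc m" "shift m"] by (simp add: \<nu>_shift_eq)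

text \<open>The remainder after \<open>l\<close> terms is controlled at the midpoint between two consecutive exponents, where
  no resonance with an integer frequency can occur.\<close>

definition mid :: "nat \<Rightarrow> real" where "mid l = (\<nu> l + \<nu> (Suc l)) / 2"

text \<open>The last inequality averages two instances of \<open>\<nu>_Suc_le\<close>. It says that
  the factor \<open>exp (- \<tau>0 * t)\<close> gains enough decay to advance the expansion by one
  term.\<close>

lemma mid_bounds: "\<nu> l < mid l" "mid l < \<nu> (Suc l)" "0 < mid l" "mid (Suc l) \<le> \<tau>0 + mid l"
  using \<nu>_less_iff[of l "Suc l"] \<nu>_nonneg[of l] \<nu>_Suc_le[of l] \<nu>_Suc_le[of "Suc l"]
  by (auto simp: mid_def field_simps)

text \<open>Every natural number is some \<open>\<nu> i\<close>, and between two successive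
  midpoints there is a single exponent. This supplies the hypothesis of the same name in
  \<open>linear_expansion\<close>.\<close>

lemma gap: "real k < mid l \<or> real k = \<nu> (Suc l) \<or> mid (Suc l) < real k"
proof -
  obtain i where i: "\<nu> i = real k" using \<nu>_nat by blast
  consider "i \<le> l" | "i = Suc l" | "Suc (Suc l) \<le> i" by linarith
  then show ?thesis
  proof cases
    case 1
    then have "\<nu> i \<le> \<nu> l" by (simp add: \<nu>_le_iff)
    then show ?thesis using i mid_bounds(1)[of l] by simp
  next
    case 2
    then show ?thesis using i by simp
  next
    case 3
    then have "\<nu> (Suc (Suc l)) \<le> \<nu> i" by (simp add: \<nu>_le_iff)
    then show ?thesis using i mid_bounds(2)[of "Suc l"] by simp
  qed
qed

end

section \<open>Powers of a partial expansion and the convolution sums of the recursion\<close>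

lemma sum_power_lists:
  fixes g :: "'a \<Rightarrow> real"
  assumes "finite A"
  shows "(\<Sum>i\<in>A. g i) ^ j = (\<Sum>ks | set ks \<subseteq> A \<and> length ks = j. \<Prod>k\<leftarrow>ks. g k)"
proof (induction j)
  case 0
  have "{ks. set ks \<subseteq> A \<and> length ks = 0} = {[]}" by auto
  then show ?case by simp
next
  case (Suc j)
  let ?L = "{ks. set ks \<subseteq> A \<and> length ks = j}"
  have "(\<Sum>ks | set ks \<subseteq> A \<and> length ks = Suc j. \<Prod>k\<leftarrow>ks. g k)
      = (\<Sum>x\<in>?L \<times> A. (\<Prod>k\<leftarrow>fst x. g k) * g (snd x))"
    unfolding lists_length_Suc_eq by (subst sum.reindex) (auto simp: inj_on_def mult.commute case_prod_beta)
  also have "\<dots> = (\<Sum>ks\<in>?L. \<Sum>i\<in>A. (\<Prod>k\<leftarrow>ks. g k) * g i)"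
    by (simp add: sum.cartesian_product case_prod_beta)
  also have "\<dots> = (\<Sum>i\<in>A. g i) ^ j * (\<Sum>i\<in>A. g i)"
    unfolding Suc sum_product ..
  finally show ?case by simp
qed

lemma prod_list_exp:
  "(\<Prod>k\<leftarrow>ks. p k * exp (- m k * t)) = (\<Prod>k\<leftarrow>ks. p k) * exp (- (\<Sum>k\<leftarrow>ks. m k) * (t::real))"
proof (induction ks)
  case (Cons k ks)
  have "exp (- (m k + (\<Sum>k\<leftarrow>ks. m k)) * t) = exp (- m k * t) * exp (- (\<Sum>k\<leftarrow>ks. m k) * t)"
    by (simp only: exp_add[symmetric] distrib_right minus_add_distrib)
  then show ?case using Cons by simp
qed simp

context index_sequence
begin

definition partial_expansion :: "nat \<Rightarrow> (nat \<Rightarrow> real \<Rightarrow> real) \<Rightarrow> real \<Rightarrow> real \<Rightarrow> real" where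
  "partial_expansion l P t \<theta> = (\<Sum>j = 1..l. P j \<theta> * exp (- \<nu> j * t))"

text \<open>Expanding the powers gives one exponential for each tuple. Tuples of weight at most
  \<open>\<nu> l\<close>, grouped by weight, form \<open>coeff_rhs\<close>; every other weight is
  again an exponent and hence at least \<open>\<nu> (Suc l)\<close>. The condition
  \<open>l \<le> J\<close> ensures that no length needed for \<open>m \<le> l\<close> is
  missing.\<close>

lemma polynomial_expansion:
  assumes P: "\<And>j. 1 \<le> j \<Longrightarrow> j \<le> l \<Longrightarrow> P j \<in> trig_poly (\<nu> j)" and "l \<le> J" and t0: "t0 \<ge> 0"
  shows "decays t0 (\<nu> (Suc l)) (\<lambda>t \<theta>. (\<Sum>j = 1..J. a j * partial_expansion l P t \<theta> ^ j)
      - (\<Sum>m = 1..l. coeff_rhs a \<mu> P m \<theta> * exp (- \<nu> m * t)))"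
proof -
  define L where "L = (\<lambda>j. {ks. set ks \<subseteq> {1..l} \<and> length ks = j})"
  define W where "W = (\<lambda>ks. \<Sum>k\<leftarrow>ks. \<nu> k)"
  define T where "T = (\<lambda>ks \<theta>. \<Prod>k\<leftarrow>ks. P k \<theta>)"
  have finL: "finite (L j)" for j unfolding L_def by (rule finite_lists_length_eq) simp
  have pow: "partial_expansion l P t \<theta> ^ j = (\<Sum>ks\<in>L j. T ks \<theta> * exp (- W ks * t))" for t \<theta> j
    unfolding partial_expansion_def L_def T_def W_def by (subst sum_power_lists) (simp_all only: prod_list_exp finite_atLeastAtMost)
  have W: "\<exists>m. \<nu> m = W ks \<and> j \<le> m" if "ks \<in> L j" for ks j
    using \<nu>_sum_list[of ks] that unfolding W_def L_def by fastforce
  have tuples: "{ks \<in> L j. W ks = \<nu> m} = index_tuples \<mu> m j" if "1 \<le> m" "m \<le> l" for m j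
  proof -
    have "ks \<in> L j" if "ks \<in> index_tuples \<mu> m j" for ks
      using index_tuples_le[OF \<tau>0 \<mu> \<open>1 \<le> m\<close> that] that \<open>m \<le> l\<close>
      by (force simp: L_def index_tuples_def)
    moreover have "W ks = (\<Sum>k\<leftarrow>ks. \<mu> k)" if "\<forall>k\<in>set ks. 1 \<le> k" for ks
      unfolding W_def using that by (intro arg_cong[where f = sum_list] map_cong) (auto simp: \<nu>_def)
    ultimately show ?thesis
      using \<open>1 \<le> m\<close> by (auto simp: index_tuples_def \<nu>_pos_eq L_def) force+
  qed
  have low: "(\<Sum>ks | ks \<in> L j \<and> W ks \<le> \<nu> l. T ks \<theta> * exp (- W ks * t))
      = (\<Sum>m = 1..l. (\<Sum>ks\<in>index_tuples \<mu> m j. T ks \<theta>) * exp (- \<nu> m * t))" if "j \<ge> 1" for j t \<theta>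
  proof -
    \<comment> \<open>The index whose exponent is the weight of the tuple, used to group the sum; it
      is nonzero because the tuple is not empty.\<close>
    define \<phi> where "\<phi> = (\<lambda>ks. SOME m. \<nu> m = W ks)"
    have \<phi>: "\<nu> (\<phi> ks) = W ks" if "ks \<in> L j" for ks j
      unfolding \<phi>_def using W[OF that] by (metis (mono_tags, lifting) someI_ex)
    have rng: "\<phi> ks \<in> {1..l}" if ks: "ks \<in> L j" "W ks \<le> \<nu> l" for ks
    proof -
      have "\<phi> ks \<le> l" using \<phi>[OF ks(1)] ks(2) \<nu>_le_iff by metis
      moreover obtain m where "\<nu> m = W ks" "j \<le> m" using W[OF ks(1)] by blast
      then have "\<phi> ks \<ge> 1" using \<phi>[OF ks(1)] \<nu>_eq_iff \<open>j \<ge> 1\<close> by (metis order_trans)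
      ultimately show ?thesis by simp
    qed
    have "(\<Sum>m = 1..l. sum (\<lambda>ks. T ks \<theta> * exp (- W ks * t)) {ks \<in> {ks. ks \<in> L j \<and> W ks \<le> \<nu> l}. \<phi> ks = m})
      = (\<Sum>ks | ks \<in> L j \<and> W ks \<le> \<nu> l. T ks \<theta> * exp (- W ks * t))"
      using finL[of j] rng by (intro sum.group) auto
    moreover have "sum (\<lambda>ks. T ks \<theta> * exp (- W ks * t)) {ks \<in> {ks. ks \<in> L j \<and> W ks \<le> \<nu> l}. \<phi> ks = m}
       = (\<Sum>ks\<in>index_tuples \<mu> m j. T ks \<theta>) * exp (- \<nu> m * t)" if m: "m \<in> {1..l}" for m
    proof -
      have "{ks \<in> {ks. ks \<in> L j \<and> W ks \<le> \<nu> l}. \<phi> ks = m} = {ks \<in> L j. W ks = \<nu> m}"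
        using \<phi> m \<nu>_eq_iff \<nu>_le_iff by (auto; metis)
      then show ?thesis using m by (simp add: tuples[symmetric] sum_distrib_right)
    qed
    ultimately show ?thesis by simp
  qed
  have coeff: "(\<Sum>j = 1..J. a j * (\<Sum>ks\<in>index_tuples \<mu> m j. T ks \<theta>)) = coeff_rhs a \<mu> P m \<theta>"
    if m: "m \<in> {1..l}" for m \<theta>
    unfolding coeff_rhs_def T_def
  proof (rule sum.mono_neutral_right)
    \<comment> \<open>A tuple of more than \<open>m\<close> positive indices has weight above
      \<open>\<nu> m\<close>, so these index sets are empty.\<close>
    show "\<forall>j\<in>{1..J} - {1..m}. a j * (\<Sum>ks\<in>index_tuples \<mu> m j. \<Prod>k\<leftarrow>ks. P k \<theta>) = 0"
    proof
      fix j assume "j \<in> {1..J} - {1..m}"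
      then have "j > m" by auto
      moreover have "j \<le> m" if "ks \<in> L j" "W ks = \<nu> m" for ks
        using W[OF that(1)] that(2) \<nu>_eq_iff by metis
      ultimately have "index_tuples \<mu> m j = {}" using tuples[of m j] m by fastforce
      then show "a j * (\<Sum>ks\<in>index_tuples \<mu> m j. \<Prod>k\<leftarrow>ks. P k \<theta>) = 0" by simp
    qed
  qed (use m \<open>l \<le> J\<close> in auto)
  have eq: "(\<Sum>j = 1..J. a j * partial_expansion l P t \<theta> ^ j)
      - (\<Sum>m = 1..l. coeff_rhs a \<mu> P m \<theta> * exp (- \<nu> m * t))
      = (\<Sum>j = 1..J. a j * (\<Sum>ks | ks \<in> L j \<and> \<not> W ks \<le> \<nu> l. T ks \<theta> * exp (- W ks * t)))" for t \<theta>
  proof -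
    have "(\<Sum>j = 1..J. a j * partial_expansion l P t \<theta> ^ j)
      = (\<Sum>j = 1..J. a j * (\<Sum>ks | ks \<in> L j \<and> W ks \<le> \<nu> l. T ks \<theta> * exp (- W ks * t)))
       + (\<Sum>j = 1..J. a j * (\<Sum>ks | ks \<in> L j \<and> \<not> W ks \<le> \<nu> l. T ks \<theta> * exp (- W ks * t)))"
      unfolding sum.distrib[symmetric] distrib_left[symmetric] pow
    proof (intro sum.cong refl arg_cong2[where f = "(*)"])
      fix j
      show "(\<Sum>ks\<in>L j. T ks \<theta> * exp (- W ks * t)) =
         (\<Sum>ks | ks \<in> L j \<and> W ks \<le> \<nu> l. T ks \<theta> * exp (- W ks * t)) +
         (\<Sum>ks | ks \<in> L j \<and> \<not> W ks \<le> \<nu> l. T ks \<theta> * exp (- W ks * t))"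
        using finL[of j] by (subst sum.union_disjoint[symmetric]) (auto intro!: sum.cong)
    qed
    also have "(\<Sum>j = 1..J. a j * (\<Sum>ks | ks \<in> L j \<and> W ks \<le> \<nu> l. T ks \<theta> * exp (- W ks * t)))
      = (\<Sum>j = 1..J. \<Sum>m = 1..l. a j * (\<Sum>ks\<in>index_tuples \<mu> m j. T ks \<theta>) * exp (- \<nu> m * t))"
    proof (rule sum.cong[OF refl])
      fix j assume "j \<in> {1..J}"
      then have j: "j \<ge> 1" by simp
      show "a j * (\<Sum>ks | ks \<in> L j \<and> W ks \<le> \<nu> l. T ks \<theta> * exp (- W ks * t))
          = (\<Sum>m = 1..l. a j * (\<Sum>ks\<in>index_tuples \<mu> m j. T ks \<theta>) * exp (- \<nu> m * t))"
        unfolding low[OF j] sum_distrib_left[where A = "{1..l}"] mult.assoc ..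
    qed
    also have "\<dots> = (\<Sum>m = 1..l. (\<Sum>j = 1..J. a j * (\<Sum>ks\<in>index_tuples \<mu> m j. T ks \<theta>)) * exp (- \<nu> m * t))"
      unfolding sum_distrib_right by (rule sum.swap)
    also have "\<dots> = (\<Sum>m = 1..l. coeff_rhs a \<mu> P m \<theta> * exp (- \<nu> m * t))"
      by (intro sum.cong refl arg_cong2[where f = "(*)"] coeff)
    finally show ?thesis by simp
  qed
  show ?thesis unfolding eq
  proof (intro decays_sum decays_cmult)
    fix j ks assume "ks \<in> {ks. ks \<in> L j \<and> \<not> W ks \<le> \<nu> l}"
    then have ks: "ks \<in> L j" "\<not> W ks \<le> \<nu> l" by auto
    obtain m where m: "\<nu> m = W ks" using W[OF ks(1)] by blast
    have "l < m" using ks(2) m \<nu>_le_iff by (metis not_less)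
    then have le: "\<nu> (Suc l) \<le> W ks" using m \<nu>_le_iff[of "Suc l" m] by simp
    have "T ks \<in> trig_poly (W ks)"
      unfolding T_def W_def using ks(1) P by (intro trig_poly_prod_list) (auto simp: L_def subset_iff)
    then show "decays t0 (\<nu> (Suc l)) (\<lambda>t \<theta>. T ks \<theta> * exp (- W ks * t))"
      using decays_mono[OF decays_trig_poly le t0] by blast
  qed
qed

text \<open>Below \<open>\<tau>0\<close> no copy of \<open>\<tau>0\<close> can occur, so only
  integers remain; all of them do occur, and counting gives \<open>l\<close>.\<close>

lemma \<nu>_below_\<tau>0:
  assumes "\<nu> l < \<tau>0" shows "\<nu> l = real l"
  using assms
proof (induction l)
  case (Suc l)
  have "\<nu> l < \<nu> (Suc l)" by (simp add: \<nu>_less_iff)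
  then have l: "\<nu> l = real l" using Suc by simp
  obtain a b where ab: "\<nu> (Suc l) = real a * \<tau>0 + real b" using \<nu>_repr by blast
  have "a = 0"
  proof (rule ccontr)
    assume "a \<noteq> 0"
    then have "1 * \<tau>0 \<le> real a * \<tau>0" using \<tau>0 by (intro mult_right_mono) auto
    then show False using ab Suc.prems by simp
  qed
  then have b: "\<nu> (Suc l) = real b" using ab by simp
  then have "Suc l \<le> b" using \<open>\<nu> l < \<nu> (Suc l)\<close> l by simp
  moreover have "\<nu> (Suc l) \<le> real (Suc l)"
  proof -
    obtain i where i: "\<nu> i = real (Suc l)" using \<nu>_nat by blast
    then have "\<nu> l < \<nu> i" using l by simp
    then have "Suc l \<le> i" by (simp add: \<nu>_less_iff)
    then show ?thesis using i by (simp add: \<nu>_le_iff[symmetric])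
  qed
  ultimately show ?case using b by simp
qed simp

text \<open>In \<open>a * \<tau>0 + b\<close> with \<open>a > 0\<close>, removing one copy of
  \<open>\<tau>0\<close> leaves an exponent or \<open>0\<close>; so \<open>a = 0\<close>.\<close>

lemma \<nu>_not_shifted:
  assumes "\<And>m. \<nu> l \<noteq> \<tau>0 + \<nu> m" shows "\<exists>n. \<nu> l = real n"
proof -
  obtain a b where ab: "\<nu> l = real a * \<tau>0 + real b" using \<nu>_repr by blast
  have "a = 0"
  proof (rule ccontr)
    assume "a \<noteq> 0"
    then have "\<nu> l = \<tau>0 + (real (a - 1) * \<tau>0 + real b)" using ab by (cases a) (auto simp: algebra_simps)
    moreover obtain m where "\<nu> m = real (a - 1) * \<tau>0 + real b" by (rule \<nu>_obtain)
    ultimately show False using assms[of m] by simp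
  qed
  then show ?thesis using ab by auto
qed

text \<open>The invariant on degrees passes through the nonlinearity: each product has degree at
  most the sum of its exponents, which is \<open>\<nu> m\<close> for every tuple.\<close>

lemma coeff_rhs_trig_poly:
  assumes "m \<ge> 1" "\<And>j. 1 \<le> j \<Longrightarrow> j \<le> m \<Longrightarrow> P j \<in> trig_poly (\<nu> j)"
  shows "coeff_rhs a \<mu> P m \<in> trig_poly (\<nu> m)"
proof -
  have "(\<lambda>\<theta>. \<Prod>k\<leftarrow>ks. P k \<theta>) \<in> trig_poly (\<nu> m)" if ks: "ks \<in> index_tuples \<mu> m j" for ks j
  proof -
    have "(\<lambda>\<theta>. \<Prod>k\<leftarrow>ks. P k \<theta>) \<in> trig_poly (\<Sum>k\<leftarrow>ks. \<mu> k)"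
    proof (rule trig_poly_prod_list)
      fix k assume k: "k \<in> set ks"
      then have "1 \<le> k" using ks by (auto simp: index_tuples_def)
      then show "P k \<in> trig_poly (\<mu> k)"
        using assms(2)[of k] index_tuples_le[OF \<tau>0 \<mu> assms(1) ks k] by (simp add: \<nu>_pos_eq)
    qed
    then show ?thesis using ks assms(1) by (simp add: index_tuples_def \<nu>_pos_eq)
  qed
  then show ?thesis unfolding coeff_rhs_def[abs_def] by (intro trig_poly_sum trig_poly_scale)
qed

end

text \<open>Derivatives of \<open>f\<close> may blow up at the ends of the open interval, hence the
  smaller compact interval given by \<open>\<epsilon>1\<close>.\<close>

lemma taylor_bound:
  assumes f: "smooth_on_open {-\<epsilon>0<..<\<epsilon>0} f" and e: "0 \<le> \<epsilon>1" "\<epsilon>1 < \<epsilon>0"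
  shows "\<exists>K. \<forall>s. \<bar>s\<bar> \<le> \<epsilon>1 \<longrightarrow> \<bar>f s - (\<Sum>j\<le>J. taylor_coeff f j * s ^ j)\<bar> \<le> K * \<bar>s\<bar> ^ Suc J"
proof -
  have d: "((deriv ^^ k) f has_real_derivative (deriv ^^ Suc k) f x) (at x)" if "\<bar>x\<bar> \<le> \<epsilon>1" for k x
    using f that e unfolding smooth_on_open_def by (force simp: DERIV_deriv_iff_real_differentiable)
  have "continuous_on {-\<epsilon>1..\<epsilon>1} ((deriv ^^ Suc J) f)"
    by (intro continuous_at_imp_continuous_on ballI DERIV_isCont[OF d]) auto
  then have "bounded ((deriv ^^ Suc J) f ` {-\<epsilon>1..\<epsilon>1})"
    by (intro compact_imp_bounded compact_continuous_image) auto
  then obtain M where "\<forall>x\<in>{-\<epsilon>1..\<epsilon>1}. norm ((deriv ^^ Suc J) f x) \<le> M"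
    unfolding bounded_iff by blast
  then have M: "\<bar>(deriv ^^ Suc J) f x\<bar> \<le> M" if "\<bar>x\<bar> \<le> \<epsilon>1" for x
    using that by (simp only: real_norm_def abs_le_iff atLeastAtMost_iff) auto
  have "\<bar>f s - (\<Sum>j\<le>J. taylor_coeff f j * s ^ j)\<bar> \<le> M / fact (Suc J) * \<bar>s\<bar> ^ Suc J" if s: "\<bar>s\<bar> \<le> \<epsilon>1" for s
  proof -
    obtain x where x: "\<bar>x\<bar> \<le> \<bar>s\<bar>" "f s = (\<Sum>m<Suc J. (deriv ^^ m) f 0 / fact m * s ^ m)
        + (deriv ^^ Suc J) f x / fact (Suc J) * s ^ Suc J"
      using Maclaurin_bi_le[of "\<lambda>m. (deriv ^^ m) f" f "Suc J" s] d s by auto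
    have "f s - (\<Sum>j\<le>J. taylor_coeff f j * s ^ j) = (deriv ^^ Suc J) f x / fact (Suc J) * s ^ Suc J"
      unfolding x(2) taylor_coeff_def lessThan_Suc_atMost by simp
    also have "\<bar>\<dots>\<bar> = \<bar>(deriv ^^ Suc J) f x\<bar> / fact (Suc J) * \<bar>s\<bar> ^ Suc J"
      by (simp add: abs_mult power_abs)
    also have "\<dots> \<le> M / fact (Suc J) * \<bar>s\<bar> ^ Suc J"
      using M[of x] x(1) s by (intro mult_right_mono divide_right_mono) auto
    finally show ?thesis .
  qed
  then show ?thesis by blast
qed

lemma decays_power: "decays t0 b F \<Longrightarrow> decays t0 (real n * b) (\<lambda>t \<theta>. F t \<theta> ^ n)"
proof (induction n)
  case 0
  then show ?case using decays_const[of t0 1] by simp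
next
  case (Suc n)
  then show ?case using decays_mult[of t0 b F "real n * b" "\<lambda>t \<theta>. F t \<theta> ^ n"]
    by (simp add: distrib_right)
qed

text \<open>Rate \<open>0\<close> means boundedness. The induction uses the splitting
  \<open>F * (F ^ n - G ^ n) + (F - G) * G ^ n\<close>.\<close>

lemma decays_power_diff:
  assumes F: "decays t0 0 F" and G: "decays t0 0 G" and FG: "decays t0 b (\<lambda>t \<theta>. F t \<theta> - G t \<theta>)"
  shows "decays t0 b (\<lambda>t \<theta>. F t \<theta> ^ n - G t \<theta> ^ n)"
proof (induction n)
  case 0
  then show ?case using decays_zero by simp
next
  case (Suc n)
  have "decays t0 b (\<lambda>t \<theta>. F t \<theta> * (F t \<theta> ^ n - G t \<theta> ^ n) + (F t \<theta> - G t \<theta>) * G t \<theta> ^ n)"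
    using decays_add[of t0 b, OF decays_mult[OF F Suc, simplified]] decays_mult[OF FG decays_power[OF G, of n]] by simp
  then show ?case by (simp add: algebra_simps)
qed

section \<open>The expansion\<close>

lemma is_solution_cylinder_solution:
  assumes "is_solution \<epsilon>0 \<tau>0 f t0 v"
  shows "cylinder_solution t0 v (\<lambda>t \<theta>. exp (- \<tau>0 * t) * f (v t \<theta>))"
proof -
  have smooth: "smooth_cylinder t0 v" and eq: "\<And>t \<theta>. t \<ge> t0 \<Longrightarrow>
      partial_t t0 (partial_t t0 v) t \<theta> + partial_th (partial_th v) t \<theta> = exp (- \<tau>0 * t) * f (v t \<theta>)"
    using assms unfolding is_solution_def by blast+
  have "C_k_cylinder t0 (Suc (Suc 0)) v" using smooth unfolding smooth_cylinder_def by blast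
  then have c: "continuous_on ({t0..} \<times> UNIV) (\<lambda>(t, \<theta>). v t \<theta>)"
    "continuous_on ({t0..} \<times> UNIV) (\<lambda>(t, \<theta>). partial_t t0 v t \<theta>)"
    "continuous_on ({t0..} \<times> UNIV) (\<lambda>(t, \<theta>). partial_t t0 (partial_t t0 v) t \<theta>)"
    "continuous_on ({t0..} \<times> UNIV) (\<lambda>(t, \<theta>). partial_th (partial_th v) t \<theta>)"
    and d: "\<And>t \<theta>. t \<ge> t0 \<Longrightarrow> (\<lambda>s. v s \<theta>) differentiable (at t within {t0..})"
    "\<And>t \<theta>. t \<ge> t0 \<Longrightarrow> (\<lambda>s. partial_t t0 v s \<theta>) differentiable (at t within {t0..})"
    "\<And>t \<theta>. t \<ge> t0 \<Longrightarrow> v t differentiable (at \<theta>)"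
    "\<And>t \<theta>. t \<ge> t0 \<Longrightarrow> partial_th v t differentiable (at \<theta>)"
    by simp_all
  have dt: "((\<lambda>s. F s \<theta>) has_real_derivative partial_t t0 F t \<theta>) (at t within {t0..})"
    if "(\<lambda>s. F s \<theta>) differentiable (at t within {t0..})" for F t \<theta>
    using that unfolding partial_t_def has_real_derivative_iff_has_vector_derivative
    by (simp add: vector_derivative_works)
  have dth: "(F t has_real_derivative partial_th F t \<theta>) (at \<theta>)"
    if "F t differentiable (at \<theta>)" for F t \<theta>
    using that unfolding partial_th_def by (simp add: DERIV_deriv_iff_real_differentiable)
  have per: "v t (\<theta> + 2 * pi) = v t \<theta>" if "t \<ge> t0" for t \<theta>
    using smooth that unfolding smooth_cylinder_def by simp
  show ?thesis
    unfolding cylinder_solution_def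
    by (rule exI[of _ "partial_t t0 v"], rule exI[of _ "partial_t t0 (partial_t t0 v)"],
        rule exI[of _ "partial_th v"], rule exI[of _ "partial_th (partial_th v)"],
        intro conjI allI impI c dt d dth per eq)
qed

lemma trig_poly_fourier_integral_zero:
  assumes "p \<in> trig_poly d" "d < real n" shows "fourier_integral n \<phi> p = 0"
  using assms(1)
proof induction
  case trig_poly_zero
  then show ?case by (simp add: fourier_integral_def)
next
  case (trig_poly_cos k)
  have "(\<lambda>\<theta>. cos (real k * \<theta>)) \<in> spherical_harmonics k"
    using spherical_harmonicsI[of k 1 0] by (cases "k = 0") (auto simp: spherical_harmonics_def)
  then show ?case using trig_poly_cos assms(2) by (intro fourier_integral_other_harmonic) auto
next
  case (trig_poly_sin k)
  have "(\<lambda>\<theta>. sin (real k * \<theta>)) \<in> spherical_harmonics k"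
    using spherical_harmonicsI[of k 0 1] by (cases "k = 0") (auto simp: spherical_harmonics_def)
  then show ?case using trig_poly_sin assms(2) by (intro fourier_integral_other_harmonic) auto
next
  case (trig_poly_add p q)
  then show ?case
    using integral_add[OF fourier_integrable[OF trig_poly_continuous[OF trig_poly_add(1)], of n \<phi>]
        fourier_integrable[OF trig_poly_continuous[OF trig_poly_add(2)], of n \<phi>]]
    by (simp add: fourier_integral_def distrib_right)
next
  case (trig_poly_scale p c)
  then show ?case by (simp add: fourier_integral_def mult.assoc)
qed

text \<open>This provides the orthogonality to the resonant harmonics required of the particular
  solution, from its degree alone.\<close>

lemma trig_poly_orthogonal:
  assumes p: "p \<in> trig_poly d" "d < real n" and Y: "Y \<in> spherical_harmonics n" and n: "n > 0"
  shows "L2_circle_inner p Y = 0"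
proof -
  obtain c d' where Yd: "Y = (\<lambda>\<theta>. c * cos (real n * \<theta>) + d' * sin (real n * \<theta>))"
    using Y n by (auto simp: spherical_harmonics_def)
  define \<phi>1 where "\<phi>1 = pi / (2 * real n)"
  have r: "real n * \<phi>1 = pi / 2" using n by (simp add: \<phi>1_def)
  have Y': "p \<theta> * Y \<theta> = c * (p \<theta> * cos (real n * (\<theta> - 0))) + d' * (p \<theta> * cos (real n * (\<theta> - \<phi>1)))" for \<theta>
    by (simp add: Yd right_diff_distrib r cos_diff distrib_left mult.left_commute)
  have "((\<lambda>\<theta>. p \<theta> * Y \<theta>) has_integral (c * fourier_integral n 0 p + d' * fourier_integral n \<phi>1 p)) {0..2 * pi}"
    unfolding Y' fourier_integral_def
    by (intro has_integral_add has_integral_mult_right integrable_integral fourier_integrable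
        trig_poly_continuous[OF p(1)])
  then show ?thesis
    unfolding L2_circle_inner_def by (simp add: integral_unique trig_poly_fourier_integral_zero[OF p])
qed

lemma eq_singletonI: "x \<in> A \<Longrightarrow> (\<And>y. y \<in> A \<Longrightarrow> y = x) \<Longrightarrow> A = {x}"
  by blast

locale expansion = index_sequence \<tau>0 \<mu> for \<tau>0 and \<mu> +
  fixes f :: "real \<Rightarrow> real" and v :: "real \<Rightarrow> real \<Rightarrow> real" and \<epsilon>0 t0 :: real
  assumes \<epsilon>0: "\<epsilon>0 > 0" and f: "smooth_on_open {-\<epsilon>0<..<\<epsilon>0} f" and t0: "t0 \<ge> 0"
    and sol: "is_solution \<epsilon>0 \<tau>0 f t0 v" and conv: "converges_exponentially t0 v"
begin

abbreviation a where "a \<equiv> taylor_coeff f"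

lemma v_solution: "cylinder_solution t0 v (\<lambda>t \<theta>. exp (- \<tau>0 * t) * f (v t \<theta>))"
  using sol by (rule is_solution_cylinder_solution)

lemma v_decays: obtains \<gamma> where "\<gamma> > 0" "decays t0 \<gamma> v"
  using conv unfolding converges_exponentially_def decays_def by blast

text \<open>The strict pointwise bound is not uniform by itself on the unbounded cylinder: decay
  handles late times, and compactness together with periodicity the rest.\<close>

lemma v_small: "\<exists>\<epsilon>1\<ge>0. \<epsilon>1 < \<epsilon>0 \<and> (\<forall>t\<ge>t0. \<forall>\<theta>. \<bar>v t \<theta>\<bar> \<le> \<epsilon>1)"
proof -
  have lt: "\<bar>v t \<theta>\<bar> < \<epsilon>0" and per: "v t (\<theta> + 2 * pi) = v t \<theta>" if "t \<ge> t0" for t \<theta>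
    using sol that unfolding is_solution_def smooth_cylinder_def by auto
  obtain \<gamma> where \<gamma>: "\<gamma> > 0" "decays t0 \<gamma> v" by (rule v_decays)
  obtain C where C: "\<And>t \<theta>. t \<ge> t0 \<Longrightarrow> \<bar>v t \<theta>\<bar> \<le> C * exp (- \<gamma> * t)" using \<gamma>(2) by (metis decaysE)
  have "eventually (\<lambda>t. C * exp (- \<gamma> * t) < \<epsilon>0 / 2) at_top"
    using order_tendstoD(2)[OF exp_decay_tendsto[OF \<gamma>(1), of C], of "\<epsilon>0 / 2"] \<epsilon>0 by simp
  then obtain T where T: "\<And>t. t \<ge> T \<Longrightarrow> C * exp (- \<gamma> * t) < \<epsilon>0 / 2"
    by (auto simp: eventually_at_top_linorder)
  define K where "K = {t0..max t0 T} \<times> {0..2 * pi}"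
  have "continuous_on ({t0..} \<times> UNIV) (\<lambda>(t, \<theta>). v t \<theta>)"
    using v_solution unfolding cylinder_solution_def by blast
  then have "continuous_on K (\<lambda>(t, \<theta>). v t \<theta>)" by (rule continuous_on_subset) (auto simp: K_def)
  then have cont: "continuous_on K (\<lambda>x. \<bar>v (fst x) (snd x)\<bar>)"
    unfolding case_prod_beta by (intro continuous_intros)
  have "compact K" unfolding K_def by (intro compact_Times compact_Icc)
  moreover have "K \<noteq> {}" unfolding K_def by (auto simp: ex_in_conv[symmetric] intro: exI[of _ 0])
  ultimately obtain x where x: "x \<in> K" "\<And>y. y \<in> K \<Longrightarrow> \<bar>v (fst y) (snd y)\<bar> \<le> \<bar>v (fst x) (snd x)\<bar>"
    using continuous_attains_sup[OF _ _ cont] by blast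
  define \<epsilon>1 where "\<epsilon>1 = max (\<epsilon>0 / 2) \<bar>v (fst x) (snd x)\<bar>"
  have "\<bar>v t \<theta>\<bar> \<le> \<epsilon>1" if t: "t \<ge> t0" for t \<theta>
  proof (cases "t \<ge> T")
    case True
    then show ?thesis using C[OF t, of \<theta>] T[OF True] unfolding \<epsilon>1_def by simp
  next
    case False
    obtain y where y: "y \<in> {0..2 * pi}" "v t y = v t \<theta>"
      using periodic_reduce[where g = "v t", OF per[OF t]] by blast
    then have "(t, y) \<in> K" using t False by (auto simp: K_def)
    then show ?thesis using x(2)[of "(t, y)"] y(2) unfolding \<epsilon>1_def by simp
  qed
  moreover have "\<epsilon>1 \<ge> 0" "\<epsilon>1 < \<epsilon>0"
    using \<epsilon>0 x(1) lt[of "fst x" "snd x"] by (auto simp: \<epsilon>1_def K_def)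
  ultimately show ?thesis by blast
qed

text \<open>Increasing \<open>J\<close> gives any desired rate, however small the initial rate
  \<open>\<gamma>\<close> of \<open>v\<close> is.\<close>

lemma f_taylor_decay:
  "decays t0 (real (Suc J) * \<gamma>) (\<lambda>t \<theta>. f (v t \<theta>) - (\<Sum>j\<le>J. a j * v t \<theta> ^ j))"
  if "decays t0 \<gamma> v"
proof -
  obtain \<epsilon>1 where e: "\<epsilon>1 \<ge> 0" "\<epsilon>1 < \<epsilon>0" "\<And>t \<theta>. t \<ge> t0 \<Longrightarrow> \<bar>v t \<theta>\<bar> \<le> \<epsilon>1"
    using v_small by blast
  obtain K where K: "\<And>s. \<bar>s\<bar> \<le> \<epsilon>1 \<Longrightarrow> \<bar>f s - (\<Sum>j\<le>J. a j * s ^ j)\<bar> \<le> K * \<bar>s\<bar> ^ Suc J"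
    using taylor_bound[OF f e(1,2), of J] by blast
  show ?thesis
  proof (rule decays_bound)
    show "decays t0 (real (Suc J) * \<gamma>) (\<lambda>t \<theta>. K * v t \<theta> ^ Suc J)"
      by (intro decays_cmult decays_power that)
    fix t \<theta> assume "t \<ge> t0"
    then have "\<bar>f (v t \<theta>) - (\<Sum>j\<le>J. a j * v t \<theta> ^ j)\<bar> \<le> K * \<bar>v t \<theta>\<bar> ^ Suc J" by (intro K e)
    also have "\<dots> \<le> \<bar>K * v t \<theta> ^ Suc J\<bar>" by (simp add: abs_mult power_abs mult_right_mono)
    finally show "\<bar>f (v t \<theta>) - (\<Sum>j\<le>J. a j * v t \<theta> ^ j)\<bar> \<le> \<bar>K * v t \<theta> ^ Suc J\<bar>" .
  qed
qed

text \<open>The coefficient of \<open>exp (- \<nu> m * t)\<close> in \<open>f (v)\<close>, with the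
  constant Taylor coefficient at index \<open>0\<close>.\<close>

definition nonlin :: "(nat \<Rightarrow> real \<Rightarrow> real) \<Rightarrow> nat \<Rightarrow> real \<Rightarrow> real" where
  "nonlin P m = (if m = 0 then (\<lambda>_. a 0) else coeff_rhs a \<mu> P m)"

lemma nonlin_trig_poly:
  assumes "\<And>j. 1 \<le> j \<Longrightarrow> j \<le> m \<Longrightarrow> P j \<in> trig_poly (\<nu> j)"
  shows "nonlin P m \<in> trig_poly (\<nu> m)"
  using coeff_rhs_trig_poly[of m P a] assms trig_poly_const[of 0 "a 0"] by (auto simp: nonlin_def)

lemma nonlin_cong:
  assumes "\<And>k. 1 \<le> k \<Longrightarrow> k \<le> m \<Longrightarrow> P k = P' k" shows "nonlin P m = nonlin P' m"
  using coeff_rhs_cong[OF \<tau>0 \<mu>, of m P P' a] assms by (auto simp: nonlin_def)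

text \<open>Three errors add up: the Taylor remainder, the replacement of \<open>v\<close> by its
  partial expansion inside the powers, and the truncation of the resulting exponential sum.\<close>

lemma f_expansion:
  assumes P: "\<And>j. 1 \<le> j \<Longrightarrow> j \<le> l \<Longrightarrow> P j \<in> trig_poly (\<nu> j)"
    and R: "decays t0 (mid l) (\<lambda>t \<theta>. v t \<theta> - partial_expansion l P t \<theta>)"
  shows "decays t0 (mid l) (\<lambda>t \<theta>. f (v t \<theta>) - (\<Sum>m\<le>l. nonlin P m \<theta> * exp (- \<nu> m * t)))"
proof -
  obtain \<gamma> where \<gamma>: "\<gamma> > 0" "decays t0 \<gamma> v" by (rule v_decays)
  \<comment> \<open>Two demands on the Taylor degree: \<open>J \<ge> l\<close>, so that all tuples
    relevant up to \<open>\<nu> l\<close> occur, and \<open>(J + 1) * \<gamma> \<ge> mid l\<close>,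
    so that the remainder is small enough.\<close>
  define J where "J = max l (nat \<lceil>mid l / \<gamma>\<rceil>)"
  have "mid l / \<gamma> \<le> real (Suc J)" unfolding J_def by linarith
  then have J: "mid l \<le> real (Suc J) * \<gamma>" using \<gamma>(1) by (simp add: field_simps)
  let ?S = "partial_expansion l P"
  have v0: "decays t0 0 v" using decays_mono[OF \<gamma>(2) _ t0] \<gamma>(1) by simp
  have S0: "decays t0 0 ?S"
    unfolding partial_expansion_def[abs_def]
    by (intro decays_sum decays_mono[OF decays_trig_poly[OF P] \<nu>_nonneg t0]) auto
  have "decays t0 (mid l) (\<lambda>t \<theta>. (f (v t \<theta>) - (\<Sum>j\<le>J. a j * v t \<theta> ^ j))
      + (\<Sum>j = 1..J. a j * (v t \<theta> ^ j - ?S t \<theta> ^ j))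
      + ((\<Sum>j = 1..J. a j * ?S t \<theta> ^ j) - (\<Sum>m = 1..l. coeff_rhs a \<mu> P m \<theta> * exp (- \<nu> m * t))))"
  proof (intro decays_add)
    show "decays t0 (mid l) (\<lambda>t \<theta>. f (v t \<theta>) - (\<Sum>j\<le>J. a j * v t \<theta> ^ j))"
      by (rule decays_mono[OF f_taylor_decay[OF \<gamma>(2)] J t0])
    show "decays t0 (mid l) (\<lambda>t \<theta>. \<Sum>j = 1..J. a j * (v t \<theta> ^ j - ?S t \<theta> ^ j))"
      by (intro decays_sum decays_cmult decays_power_diff v0 S0 R)
    show "decays t0 (mid l) (\<lambda>t \<theta>. (\<Sum>j = 1..J. a j * ?S t \<theta> ^ j)
        - (\<Sum>m = 1..l. coeff_rhs a \<mu> P m \<theta> * exp (- \<nu> m * t)))"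
      by (rule decays_mono[OF polynomial_expansion[OF P _ t0]]) (use mid_bounds(2)[of l] t0 J_def in auto)
  qed
  moreover have "(f (v t \<theta>) - (\<Sum>j\<le>J. a j * v t \<theta> ^ j))
      + (\<Sum>j = 1..J. a j * (v t \<theta> ^ j - ?S t \<theta> ^ j))
      + ((\<Sum>j = 1..J. a j * ?S t \<theta> ^ j) - (\<Sum>m = 1..l. coeff_rhs a \<mu> P m \<theta> * exp (- \<nu> m * t)))
     = f (v t \<theta>) - (\<Sum>m\<le>l. nonlin P m \<theta> * exp (- \<nu> m * t))" for t \<theta>
  proof -
    have split: "(\<Sum>j\<le>N. g j) = g 0 + (\<Sum>j = 1..N. g j)" for N and g :: "nat \<Rightarrow> real"
      by (simp add: atMost_atLeast0 sum.atLeast_Suc_atMost)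
    have "(\<Sum>m = 1..l. nonlin P m \<theta> * exp (- \<nu> m * t)) = (\<Sum>m = 1..l. coeff_rhs a \<mu> P m \<theta> * exp (- \<nu> m * t))"
      by (intro sum.cong) (auto simp: nonlin_def)
    then show ?thesis
      unfolding split by (simp add: right_diff_distrib sum_subtractf nonlin_def)
  qed
  ultimately show ?thesis by (simp only:)
qed

text \<open>The coefficient of \<open>exp (- \<nu> j * t)\<close> in the right-hand side of the
  equation. As \<open>shift\<close> is injective, the sum has at most one term; writing it as a sum
  treats all cases of the recursion at once: no term, \<open>m = 0\<close>, or
  \<open>m \<ge> 1\<close>.\<close>

definition source :: "(nat \<Rightarrow> real \<Rightarrow> real) \<Rightarrow> nat \<Rightarrow> real \<Rightarrow> real" where
  "source P j \<theta> = (\<Sum>m | m < j \<and> shift m = j. nonlin P m \<theta>)"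

text \<open>A uniform version of the four cases of the recursion: a forced part \<open>Q\<close> of
  degree below the exponent, plus a free harmonic \<open>Y\<close>, which is zero at non-integer
  exponents.\<close>

definition coeff_parts :: "(nat \<Rightarrow> real \<Rightarrow> real) \<Rightarrow> nat \<Rightarrow> (real \<Rightarrow> real) \<Rightarrow> (real \<Rightarrow> real) \<Rightarrow> bool" where
  "coeff_parts P j Q Y \<longleftrightarrow> (\<exists>d\<ge>0. d < \<nu> j \<and> Q \<in> trig_poly d) \<and>
     (\<forall>\<theta>. deriv (deriv Q) \<theta> + (\<nu> j)\<^sup>2 * Q \<theta> = source P j \<theta>) \<and>
     (\<forall>n. \<nu> j = real n \<longrightarrow> Y \<in> spherical_harmonics n) \<and>
     ((\<forall>n. \<nu> j \<noteq> real n) \<longrightarrow> Y = (\<lambda>_. 0)) \<and>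
     P j = (\<lambda>\<theta>. Q \<theta> + Y \<theta>)"

lemma source_cong:
  assumes "\<And>k. 1 \<le> k \<Longrightarrow> k < j \<Longrightarrow> P k = P' k" shows "source P j = source P' j"
  unfolding source_def[abs_def] using assms
  by (intro ext sum.cong refl fun_cong[OF nonlin_cong]) auto

lemma coeff_parts_cong:
  assumes "\<And>k. 1 \<le> k \<Longrightarrow> k \<le> j \<Longrightarrow> P k = P' k" "1 \<le> j"
  shows "coeff_parts P j Q Y \<longleftrightarrow> coeff_parts P' j Q Y"
  using source_cong[of j P P'] assms by (simp add: coeff_parts_def)

lemma partial_expansion_cong:
  assumes "\<And>k. 1 \<le> k \<Longrightarrow> k \<le> l \<Longrightarrow> P k = P' k"
  shows "partial_expansion l P = partial_expansion l P'"
  unfolding partial_expansion_def[abs_def] using assms by (intro ext sum.cong) auto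

lemma coeff_parts_trig_poly:
  assumes "coeff_parts P j Q Y"
  shows "P j \<in> trig_poly (\<nu> j)" "deriv (deriv (P j)) \<theta> + (\<nu> j)\<^sup>2 * P j \<theta> = source P j \<theta>"
proof -
  obtain d where Q: "d < \<nu> j" "Q \<in> trig_poly d" using assms by (auto simp: coeff_parts_def)
  have QT: "Q \<in> trig_poly (\<nu> j)" using trig_poly_mono[OF Q(2)] Q(1) by simp
  have Y: "Y \<in> trig_poly (\<nu> j) \<and> deriv (deriv Y) \<theta> + (\<nu> j)\<^sup>2 * Y \<theta> = 0"
  proof (cases "\<exists>n. \<nu> j = real n")
    case True
    then obtain n where n: "\<nu> j = real n" by blast
    then have "Y \<in> spherical_harmonics n" using assms by (simp add: coeff_parts_def)
    then show ?thesis using n by (simp add: spherical_harmonics_trig_poly spherical_harmonics_deriv2)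
  next
    case False
    then have "Y = (\<lambda>_. 0)" using assms by (simp add: coeff_parts_def)
    then show ?thesis using trig_poly_zero by (simp add: deriv_const[abs_def])
  qed
  have Qe: "deriv (deriv Q) \<theta> + (\<nu> j)\<^sup>2 * Q \<theta> = source P j \<theta>"
    using assms by (simp add: coeff_parts_def)
  have Pj: "P j = (\<lambda>\<theta>. Q \<theta> + Y \<theta>)" using assms by (simp add: coeff_parts_def)
  show "P j \<in> trig_poly (\<nu> j)" unfolding Pj using QT Y by (intro trig_poly_add) auto
  have "deriv (P j) = (\<lambda>\<theta>. deriv Q \<theta> + deriv Y \<theta>)"
    unfolding Pj using QT Y by (intro ext DERIV_imp_deriv DERIV_add trig_poly_deriv(2)) auto
  moreover have "deriv \<dots> \<theta> = deriv (deriv Q) \<theta> + deriv (deriv Y) \<theta>"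
    using QT Y by (intro DERIV_imp_deriv DERIV_add trig_poly_deriv(2)[OF trig_poly_deriv(1)]) auto
  ultimately show "deriv (deriv (P j)) \<theta> + (\<nu> j)\<^sup>2 * P j \<theta> = source P j \<theta>"
    using Y Qe by (simp add: Pj distrib_left)
qed

definition expansion_upto :: "nat \<Rightarrow> (nat \<Rightarrow> real \<Rightarrow> real) \<Rightarrow> bool" where
  "expansion_upto l P \<longleftrightarrow> (\<forall>j. 1 \<le> j \<and> j \<le> l \<longrightarrow> (\<exists>Q Y. coeff_parts P j Q Y)) \<and>
     decays t0 (mid l) (\<lambda>t \<theta>. v t \<theta> - partial_expansion l P t \<theta>)"

text \<open>The given rate \<open>\<gamma>\<close> may be far below the first exponent. The linear
  theory raises it to \<open>mid 0 = \<nu> 1 / 2\<close>, because the forcing has rate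
  \<open>\<tau>0 \<ge> \<nu> 1\<close>.\<close>

lemma expansion_upto_0: "expansion_upto 0 P"
proof -
  obtain \<gamma> where \<gamma>: "\<gamma> > 0" "decays t0 \<gamma> v" by (rule v_decays)
  have pos: "\<nu> 1 > 0" using \<nu>_less_iff[of 0 1] by simp
  have f0: "decays t0 0 (\<lambda>t \<theta>. f (v t \<theta>))"
  proof -
    have "decays t0 0 (\<lambda>t \<theta>. (f (v t \<theta>) - (\<Sum>j\<le>0. a j * v t \<theta> ^ j)) + a 0)"
      using \<gamma>(1) by (intro decays_add decays_const decays_mono[OF f_taylor_decay[OF \<gamma>(2), of 0] _ t0]) simp
    then show ?thesis by simp
  qed
  have "decays t0 (\<tau>0 + 0) (\<lambda>t \<theta>. exp (- \<tau>0 * t) * f (v t \<theta>))"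
    using decays_exp[of "\<lambda>_. 1" 1 t0 \<tau>0] by (intro decays_mult f0) simp
  then have h: "decays t0 (\<nu> 1 / 2) (\<lambda>t \<theta>. exp (- \<tau>0 * t) * f (v t \<theta>))"
    by (rule decays_mono[OF _ _ t0]) (use \<nu>_Suc_le[of 0] pos in simp)
  \<comment> \<open>The frequency \<open>0\<close> is the only natural number below
    \<open>\<nu> 1\<close>, since all positive ones are exponents.\<close>
  have gap: "real k < \<nu> 1 / 4 \<and> real k < \<gamma> \<or> \<nu> 1 \<le> real k" for k
  proof (cases "k = 0")
    case False
    obtain i where i: "\<nu> i = real k" using \<nu>_nat by blast
    then have "i \<noteq> 0" using False by (metis \<nu>_0 of_nat_eq_0_iff)
    then show ?thesis using i \<nu>_le_iff[of 1 i] by simp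
  qed (use pos \<gamma> in simp)
  \<comment> \<open>The number \<open>3 / 8 * \<nu> 1\<close> is a dummy for
    \<open>\<kappa>\<close>, placed strictly between the rates
    \<open>min \<gamma> (\<nu> 1 / 4)\<close> and \<open>\<nu> 1 / 2\<close>. It is not a natural
    number, so \<open>Y\<close> is zero.\<close>
  have "\<exists>Y. (\<forall>n. 3 / 8 * \<nu> 1 = real n \<longrightarrow> Y \<in> spherical_harmonics n) \<and>
     ((\<forall>n. 3 / 8 * \<nu> 1 \<noteq> real n) \<longrightarrow> Y = (\<lambda>_. 0)) \<and>
     decays t0 (\<nu> 1 / 2) (\<lambda>t \<theta>. v t \<theta> - Y \<theta> * exp (- (3 / 8 * \<nu> 1) * t))"
  proof (rule linear_expansion[OF v_solution t0 _ h, of "min \<gamma> (\<nu> 1 / 4)"])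
    show "decays t0 (min \<gamma> (\<nu> 1 / 4)) v" using decays_mono[OF \<gamma>(2) _ t0] by simp
    show "real k < min \<gamma> (\<nu> 1 / 4) \<or> real k = 3 / 8 * \<nu> 1 \<or> \<nu> 1 / 2 < real k" for k
      using gap[of k] pos by auto
  qed (use pos \<gamma> in auto)
  moreover have "3 / 8 * \<nu> 1 \<noteq> real n" for n using gap[of n] pos by auto
  ultimately have "decays t0 (\<nu> 1 / 2) v" by auto
  then show ?thesis by (simp add: expansion_upto_def partial_expansion_def mid_def)
qed

section \<open>The inductive step: one more coefficient\<close>

lemma remainder_solution:
  assumes "\<And>j. 1 \<le> j \<Longrightarrow> j \<le> l \<Longrightarrow> \<exists>Q Y. coeff_parts P j Q Y"
  shows "cylinder_solution t0 (\<lambda>t \<theta>. v t \<theta> - partial_expansion l P t \<theta>)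
     (\<lambda>t \<theta>. exp (- \<tau>0 * t) * f (v t \<theta>) - (\<Sum>j = 1..l. source P j \<theta> * exp (- \<nu> j * t)))"
  using assms
proof (induction l)
  case 0
  then show ?case using v_solution by (simp add: partial_expansion_def)
next
  case (Suc l)
  obtain Q Y where QY: "coeff_parts P (Suc l) Q Y" using Suc.prems[of "Suc l"] by auto
  have "cylinder_solution t0 (\<lambda>t \<theta>. v t \<theta> - partial_expansion l P t \<theta>)
     (\<lambda>t \<theta>. exp (- \<tau>0 * t) * f (v t \<theta>) - (\<Sum>j = 1..l. source P j \<theta> * exp (- \<nu> j * t)))"
    using Suc by simp
  from cylinder_solution_diff[OF this coeff_parts_trig_poly(1)[OF QY], of "\<nu> (Suc l)"]
  show ?case unfolding coeff_parts_trig_poly(2)[OF QY]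
    by (simp add: partial_expansion_def algebra_simps)
qed

text \<open>The forcing terms removed so far are exactly the terms of the expansion of
  \<open>f (v)\<close> whose shifted index has been reached; \<open>m < shift m\<close> keeps them
  among the known coefficients.\<close>

lemma source_sum:
  "(\<Sum>j = 1..Suc l. source P j \<theta> * exp (- \<nu> j * t))
     = exp (- \<tau>0 * t) * (\<Sum>m | m \<le> l \<and> shift m \<le> Suc l. nonlin P m \<theta> * exp (- \<nu> m * t))"
proof -
  let ?S = "{m. m \<le> l \<and> shift m \<le> Suc l}"
  let ?g = "\<lambda>m. nonlin P m \<theta> * exp (- \<nu> (shift m) * t)"
  have "(\<Sum>j = 1..Suc l. source P j \<theta> * exp (- \<nu> j * t)) = (\<Sum>j = 1..Suc l. sum ?g {m \<in> ?S. shift m = j})"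
  proof (rule sum.cong[OF refl])
    fix j assume "j \<in> {1..Suc l}"
    then have "m \<le> l \<and> shift m \<le> Suc l \<and> shift m = j \<longleftrightarrow> m < j \<and> shift m = j" for m
      using shift_gt[of m] by auto
    then have "{m \<in> ?S. shift m = j} = {m. m < j \<and> shift m = j}" by auto
    then show "source P j \<theta> * exp (- \<nu> j * t) = sum ?g {m \<in> ?S. shift m = j}"
      by (simp add: source_def sum_distrib_right)
  qed
  also have "\<dots> = sum ?g ?S"
  proof (rule sum.group)
    have "1 \<le> shift m" for m using shift_gt[of m] by simp
    then show "shift ` ?S \<subseteq> {1..Suc l}" by auto
  qed auto
  also have "\<dots> = exp (- \<tau>0 * t) * (\<Sum>m\<in>?S. nonlin P m \<theta> * exp (- \<nu> m * t))"
    unfolding sum_distrib_left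
    by (intro sum.cong refl) (simp add: \<nu>_shift_eq distrib_right exp_diff exp_minus exp_add field_simps)
  finally show ?thesis .
qed

lemma expansion_upto_Suc:
  assumes E: "expansion_upto l P"
  shows "\<exists>P'. expansion_upto (Suc l) P' \<and> (\<forall>j\<le>l. P' j = P j)"
proof -
  define n where "n = Suc l"
  have parts: "\<And>j. 1 \<le> j \<Longrightarrow> j \<le> l \<Longrightarrow> \<exists>Q Y. coeff_parts P j Q Y"
    and R: "decays t0 (mid l) (\<lambda>t \<theta>. v t \<theta> - partial_expansion l P t \<theta>)"
    using E by (auto simp: expansion_upto_def)
  have PT: "P j \<in> trig_poly (\<nu> j)" if "1 \<le> j" "j \<le> l" for j
    using parts[OF that] coeff_parts_trig_poly(1) by blast
  have NT: "nonlin P m \<in> trig_poly (\<nu> m)" if "m \<le> l" for m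
    using that by (intro nonlin_trig_poly PT) auto
  \<comment> \<open>A nonzero source at \<open>n\<close> is \<open>nonlin P m\<close> with
    \<open>\<nu> m = \<nu> n - \<tau>0\<close>; the maximum with \<open>0\<close> covers the case of
    no such \<open>m\<close>, where the source is zero.\<close>
  define d where "d = max 0 (\<nu> n - \<tau>0)"
  have d: "0 \<le> d" "d < \<nu> n" using \<tau>0 \<nu>_less_iff[of 0 n] by (auto simp: d_def n_def)
  have "source P n \<in> trig_poly d"
    unfolding source_def[abs_def]
  proof (rule trig_poly_sum)
    fix m assume "m \<in> {m. m < n \<and> shift m = n}"
    then show "nonlin P m \<in> trig_poly d"
      using \<nu>_shift_eq[of m] by (intro trig_poly_mono[OF NT]) (auto simp: d_def n_def)
  qed
  then obtain Q where Q: "Q \<in> trig_poly d" "\<And>\<theta>. deriv (deriv Q) \<theta> + (\<nu> n)\<^sup>2 * Q \<theta> = source P n \<theta>"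
    using trig_poly_solve d by blast
  \<comment> \<open>Only the forced part is subtracted here. The free harmonic at this exponent is
    not determined by the equation and comes out of \<open>linear_expansion\<close>.\<close>
  define w where "w = (\<lambda>t \<theta>. v t \<theta> - partial_expansion l P t \<theta> - Q \<theta> * exp (- \<nu> n * t))"
  define h where "h = (\<lambda>t \<theta>. exp (- \<tau>0 * t) * f (v t \<theta>) - (\<Sum>j = 1..Suc l. source P j \<theta> * exp (- \<nu> j * t)))"
  have w: "cylinder_solution t0 w h"
    using cylinder_solution_diff[OF remainder_solution[OF parts] Q(1), where \<mu> = "\<nu> n"]
    unfolding w_def h_def Q(2) by (simp add: n_def algebra_simps)
  \<comment> \<open>Two contributions remain: the error in expanding \<open>f (v)\<close>, improved
    by the factor \<open>exp (- \<tau>0 * t)\<close>, and known terms whose shifted index lies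
    beyond \<open>Suc l\<close>. Both decay at least at rate \<open>mid n\<close>.\<close>
  have heq: "h t \<theta> = exp (- \<tau>0 * t) * (f (v t \<theta>) - (\<Sum>m\<le>l. nonlin P m \<theta> * exp (- \<nu> m * t)))
      + (\<Sum>m | m \<le> l \<and> \<not> shift m \<le> Suc l. nonlin P m \<theta> * exp (- \<nu> (shift m) * t))" for t \<theta>
  proof -
    have "(\<Sum>m\<le>l. nonlin P m \<theta> * exp (- \<nu> m * t))
      = (\<Sum>m | m \<le> l \<and> shift m \<le> Suc l. nonlin P m \<theta> * exp (- \<nu> m * t))
       + (\<Sum>m | m \<le> l \<and> \<not> shift m \<le> Suc l. nonlin P m \<theta> * exp (- \<nu> m * t))"
      by (subst sum.union_disjoint[symmetric]) (auto intro!: sum.cong)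
    moreover have "(\<Sum>m | m \<le> l \<and> \<not> shift m \<le> Suc l. nonlin P m \<theta> * exp (- \<nu> (shift m) * t))
      = exp (- \<tau>0 * t) * (\<Sum>m | m \<le> l \<and> \<not> shift m \<le> Suc l. nonlin P m \<theta> * exp (- \<nu> m * t))"
      unfolding sum_distrib_left
      by (intro sum.cong refl) (simp add: \<nu>_shift_eq distrib_right exp_diff exp_minus exp_add field_simps)
    ultimately show ?thesis unfolding h_def source_sum by (simp add: algebra_simps)
  qed
  have h: "decays t0 (mid n) h"
    unfolding heq[abs_def]
  proof (intro decays_add decays_sum)
    have "decays t0 \<tau>0 (\<lambda>t \<theta>. exp (- \<tau>0 * t))" using decays_exp[of "\<lambda>_. 1" 1 t0 \<tau>0] by simp
    then have "decays t0 (\<tau>0 + mid l) (\<lambda>t \<theta>. exp (- \<tau>0 * t) * (f (v t \<theta>) - (\<Sum>m\<le>l. nonlin P m \<theta> * exp (- \<nu> m * t))))"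
      by (intro decays_mult f_expansion PT R)
    then show "decays t0 (mid n) (\<lambda>t \<theta>. exp (- \<tau>0 * t) * (f (v t \<theta>) - (\<Sum>m\<le>l. nonlin P m \<theta> * exp (- \<nu> m * t))))"
      by (rule decays_mono[OF _ _ t0]) (use mid_bounds(4)[of l] in \<open>simp add: n_def\<close>)
    fix m assume m: "m \<in> {m. m \<le> l \<and> \<not> shift m \<le> Suc l}"
    then have "\<nu> (Suc n) \<le> \<nu> (shift m)" by (simp add: \<nu>_le_iff n_def)
    then have "mid n \<le> \<nu> (shift m)" using mid_bounds(2)[of n] by simp
    then show "decays t0 (mid n) (\<lambda>t \<theta>. nonlin P m \<theta> * exp (- \<nu> (shift m) * t))"
      using m by (intro decays_mono[OF decays_trig_poly[OF NT] _ t0]) auto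
  qed
  \<comment> \<open>This is the a priori rate \<open>\<beta>\<close>; with
    \<open>\<kappa> = \<nu> n\<close> and \<open>b = mid n\<close> the linear theory applies across
    exactly one exponent.\<close>
  have "decays t0 (mid l) w"
    unfolding w_def using mid_bounds(2)[of l]
    by (intro decays_diff R decays_mono[OF decays_trig_poly[OF Q(1)] _ t0]) (simp add: n_def)
  then obtain Y where Y: "\<forall>k. \<nu> n = real k \<longrightarrow> Y \<in> spherical_harmonics k"
    "(\<forall>k. \<nu> n \<noteq> real k) \<longrightarrow> Y = (\<lambda>_. 0)"
    "decays t0 (mid n) (\<lambda>t \<theta>. w t \<theta> - Y \<theta> * exp (- \<nu> n * t))"
    using linear_expansion[OF w t0 _ h mid_bounds(3)[of l], where \<kappa> = "\<nu> n"] gap[of _ l]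
      mid_bounds(2)[of l] mid_bounds(1)[of n] unfolding n_def by blast
  define P' where "P' = P(n := (\<lambda>\<theta>. Q \<theta> + Y \<theta>))"
  have same: "P' j = P j" if "j \<le> l" for j using that by (simp add: P'_def n_def)
  have "coeff_parts P' n Q Y"
    using Y(1,2) Q d source_cong[of n P' P] same
    by (auto simp: coeff_parts_def P'_def n_def)
  moreover have "\<exists>Q Y. coeff_parts P' j Q Y" if "1 \<le> j" "j \<le> l" for j
    using parts[OF that] coeff_parts_cong[of j P' P] same that by auto
  ultimately have "\<exists>Q Y. coeff_parts P' j Q Y" if "1 \<le> j \<and> j \<le> Suc l" for j
    using that by (metis le_SucE n_def)
  moreover have "v t \<theta> - partial_expansion (Suc l) P' t \<theta> = w t \<theta> - Y \<theta> * exp (- \<nu> n * t)" for t \<theta>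
    using partial_expansion_cong[of l P' P] same
    by (simp add: partial_expansion_def w_def P'_def n_def algebra_simps)
  ultimately have "expansion_upto (Suc l) P'" using Y(3) by (simp add: expansion_upto_def n_def)
  then show ?thesis using same by blast
qed

text \<open>Each step keeps the earlier coefficients, so the finite expansions obtained by dependent
  choice agree and their diagonal is a single sequence valid for all orders.\<close>

lemma expansion_exists: "\<exists>P. \<forall>l. expansion_upto l P"
proof -
  have "\<exists>F. \<forall>l. expansion_upto l (F l) \<and> (\<forall>j\<le>l. F (Suc l) j = F l j)"
  proof (rule dependent_nat_choice)
    show "\<exists>P. expansion_upto 0 P" using expansion_upto_0 by blast
    show "\<exists>P'. expansion_upto (Suc l) P' \<and> (\<forall>j\<le>l. P' j = P j)" if "expansion_upto l P" for P l
      using expansion_upto_Suc[OF that] .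
  qed
  then obtain F where F: "\<And>l. expansion_upto l (F l)" "\<And>l j. j \<le> l \<Longrightarrow> F (Suc l) j = F l j" by blast
  have stable: "F l j = F j j" if "j \<le> l" for l j
    using that by (induction l rule: dec_induct) (auto simp: F(2))
  have "expansion_upto l (\<lambda>j. F j j)" for l
  proof -
    have "coeff_parts (\<lambda>j. F j j) j Q Y \<longleftrightarrow> coeff_parts (F l) j Q Y" if "1 \<le> j" "j \<le> l" for j Q Y
      using that by (intro coeff_parts_cong stable[symmetric]) auto
    moreover have "partial_expansion l (\<lambda>j. F j j) = partial_expansion l (F l)"
      by (intro partial_expansion_cong stable[symmetric])
    ultimately show ?thesis using F(1)[of l] by (auto simp: expansion_upto_def)
  qed
  then show ?thesis by blast
qed

section \<open>Matching the coefficients with the recursive definition\<close>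

lemma expansion_upto_parts:
  assumes "expansion_upto l P" "1 \<le> j" "j \<le> l" shows "\<exists>Q Y. coeff_parts P j Q Y"
  using assms by (simp add: expansion_upto_def)

lemma source_shift: "\<nu> l = \<tau>0 + \<nu> m \<Longrightarrow> source P l = nonlin P m"
proof -
  assume "\<nu> l = \<tau>0 + \<nu> m"
  then have m: "shift m = l" by (simp add: shift_iff)
  have "{m'. m' < l \<and> shift m' = l} = {m}"
  proof -
    have "m < l" using m shift_gt[of m] by simp
    moreover have "m' = m" if "shift m' = l" for m'
    proof -
      have "\<nu> m' = \<nu> m" using that m \<nu>_shift_eq[of m] \<nu>_shift_eq[of m'] by simp
      then show ?thesis by (simp only: \<nu>_eq_iff)
    qed
    ultimately show ?thesis using m by blast
  qed
  then show ?thesis by (simp add: source_def[abs_def])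
qed

lemma source_not_shifted: "(\<And>m. \<nu> l \<noteq> \<tau>0 + \<nu> m) \<Longrightarrow> source P l = (\<lambda>_. 0)"
  by (simp add: source_def[abs_def] shift_iff)

lemma coeff_parts_circle_solution:
  assumes "coeff_parts P l Q Y" "l \<ge> 1"
  shows "Q \<in> circle_solutions (\<mu> l) (source P l)"
  using assms trig_poly_smooth_circle by (auto simp: coeff_parts_def circle_solutions_def \<nu>_pos_eq)

lemma coeff_parts_orthogonal:
  assumes "coeff_parts P l Q Y" "l \<ge> 1" "\<mu> l = real n" "Z \<in> spherical_harmonics n"
  shows "L2_circle_inner Q Z = 0"
proof -
  obtain d where d: "0 \<le> d" "d < \<nu> l" "Q \<in> trig_poly d" using assms(1) by (auto simp: coeff_parts_def)
  show ?thesis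
    using d assms by (intro trig_poly_orthogonal[OF d(3)]) (auto simp: \<nu>_pos_eq)
qed

text \<open>Turns the constructed \<open>Q\<close> into the unique element of the solution set that
  the recursion prescribes; the last hypothesis is void at non-integer exponents.\<close>

lemma coeff_parts_unique:
  assumes "coeff_parts P l Q Y" "l \<ge> 1" "R \<in> circle_solutions (\<mu> l) (source P l)"
    and "\<And>n Z. \<mu> l = real n \<Longrightarrow> Z \<in> spherical_harmonics n \<Longrightarrow> L2_circle_inner R Z = 0"
  shows "R = Q"
proof (rule circle_solution_unique[OF assms(3) coeff_parts_circle_solution[OF assms(1,2)]])
  show "\<mu> l > 0" using \<nu>_less_iff[of 0 l] assms(2) by (simp add: \<nu>_pos_eq)
qed (use assms(4) coeff_parts_orthogonal[OF assms(1,2)] in auto)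

text \<open>\<open>Q\<close> is known only through its equation and degree, but the obvious constant
  solution satisfies the same conditions. It is used with \<open>c = a 0\<close> at exponent
  \<open>\<tau>0\<close> and with \<open>c = 0\<close> when there is no source.\<close>

lemma coeff_parts_const:
  assumes "coeff_parts P l Q Y" "l \<ge> 1" "source P l = (\<lambda>_. c)"
  shows "Q = (\<lambda>_. c / (\<mu> l)\<^sup>2)"
proof (rule coeff_parts_unique[OF assms(1,2), symmetric])
  have pos: "\<mu> l > 0" using \<nu>_less_iff[of 0 l] assms(2) by (simp add: \<nu>_pos_eq)
  have T: "(\<lambda>_. c / (\<mu> l)\<^sup>2) \<in> trig_poly 0" by (rule trig_poly_const) simp
  show "(\<lambda>_. c / (\<mu> l)\<^sup>2) \<in> circle_solutions (\<mu> l) (source P l)"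
    using pos trig_poly_smooth_circle[OF T] by (simp add: circle_solutions_def assms(3) deriv_const[abs_def])
  show "L2_circle_inner (\<lambda>_. c / (\<mu> l)\<^sup>2) Z = 0" if "\<mu> l = real n" "Z \<in> spherical_harmonics n" for n Z
    using that pos by (intro trig_poly_orthogonal[OF T]) auto
qed

lemma coeff_sequence_exists:
  assumes P: "\<And>l. l \<ge> 1 \<Longrightarrow> \<exists>Q Y. coeff_parts P l Q Y"
  shows "\<exists>X. (\<forall>i\<ge>1. X i \<in> spherical_harmonics i) \<and> is_coeff_sequence \<tau>0 a \<mu> X P"
proof -
  obtain Q Y where QY: "\<And>l. l \<ge> 1 \<Longrightarrow> coeff_parts P l (Q l) (Y l)" using P by metis
  have "\<exists>l. \<nu> l = real n" for n by (rule \<nu>_nat)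
  \<comment> \<open>Each harmonic \<open>X n\<close> is read off at the index whose exponent is
    \<open>n\<close>; such an index exists for every \<open>n\<close>.\<close>
  then obtain idx where idx: "\<And>n. \<nu> (idx n) = real n" by metis
  have idx1: "idx n \<ge> 1" if "n \<ge> 1" for n
    using idx[of n] that by (cases "idx n") auto
  define X where "X = (\<lambda>n. Y (idx n))"
  have X: "X i \<in> spherical_harmonics i" if "i \<ge> 1" for i
    using QY[OF idx1[OF that]] idx[of i] unfolding X_def coeff_parts_def by blast
  have YX: "Y l = X n" if "\<nu> l = real n" for l n
    using that idx[of n] \<nu>_eq_iff unfolding X_def by metis
  have PQ: "P l = (\<lambda>\<theta>. Q l \<theta> + Y l \<theta>)" if "l \<ge> 1" for l using QY[OF that] by (simp add: coeff_parts_def)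
  have Y0: "Y l = (\<lambda>_. 0)" if "l \<ge> 1" "\<And>n. \<nu> l \<noteq> real n" for l
    using QY[OF that(1)] that(2) by (simp add: coeff_parts_def)
  have "(\<mu> l < \<tau>0 \<longrightarrow> \<mu> l = real l \<and> P l = X l) \<and>
     (\<mu> l = \<tau>0 \<longrightarrow>
        (\<tau>0 \<notin> \<int> \<longrightarrow> P l = (\<lambda>\<theta>. a 0 / \<tau>0\<^sup>2)) \<and>
        (\<forall>n. \<tau>0 = real n \<longrightarrow> P l = (\<lambda>\<theta>. a 0 / \<tau>0\<^sup>2 + X n \<theta>))) \<and>
     (\<mu> l > \<tau>0 \<and> (\<forall>m\<ge>1. \<mu> l \<noteq> \<tau>0 + \<mu> m) \<longrightarrow> (\<exists>n. \<mu> l = real n \<and> P l = X n)) \<and>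
     (\<forall>m. \<mu> l > \<tau>0 \<and> 1 \<le> m \<and> m < l \<and> \<mu> l = \<tau>0 + \<mu> m \<longrightarrow>
        (\<mu> l \<notin> \<int> \<longrightarrow> circle_solutions (\<mu> l) (coeff_rhs a \<mu> P m) = {P l}) \<and>
        (\<forall>n. \<mu> l = real n \<longrightarrow>
           (\<exists>Q. {q \<in> circle_solutions (\<mu> l) (coeff_rhs a \<mu> P m).
                   \<forall>Y\<in>spherical_harmonics n. L2_circle_inner q Y = 0} = {Q} \<and>
                P l = (\<lambda>\<theta>. X n \<theta> + Q \<theta>))))"
    if l: "l \<ge> 1" for l
  proof (intro conjI impI allI)
    note \<nu>l = \<nu>_pos_eq[OF l]
    \<comment> \<open>Covers two cases of the recursion, exponents below \<open>\<tau>0\<close> and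
      unshifted ones above it: without a source the forced part vanishes.\<close>
    have Q0: "P l = Y l" if "\<And>m. \<nu> l \<noteq> \<tau>0 + \<nu> m"
      using coeff_parts_const[OF QY[OF l] l source_not_shifted[OF that]] PQ[OF l] by simp
    show "\<mu> l = real l" if "\<mu> l < \<tau>0" using \<nu>_below_\<tau>0[of l] that \<nu>l by simp
    show "P l = X l" if lt: "\<mu> l < \<tau>0"
    proof -
      have "\<nu> l \<noteq> \<tau>0 + \<nu> m" for m using lt \<nu>l \<nu>_nonneg[of m] by simp
      moreover have "\<nu> l = real l" using \<nu>_below_\<tau>0[of l] lt \<nu>l by simp
      ultimately show ?thesis using Q0 YX[of l l] by simp
    qed
    have Qa: "Q l = (\<lambda>_. a 0 / \<tau>0\<^sup>2)" if "\<mu> l = \<tau>0"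
    proof -
      have "source P l = (\<lambda>_. a 0)" using source_shift[of l 0 P] that \<nu>l by (simp add: nonlin_def)
      then show ?thesis using coeff_parts_const[OF QY[OF l] l] that by simp
    qed
    show "P l = (\<lambda>\<theta>. a 0 / \<tau>0\<^sup>2)" if "\<mu> l = \<tau>0" "\<tau>0 \<notin> \<int>"
    proof -
      have "\<nu> l \<noteq> real n" for n using that \<nu>l Ints_of_nat[of n] by metis
      then show ?thesis using PQ[OF l] Qa[OF that(1)] Y0[OF l] by simp
    qed
    show "P l = (\<lambda>\<theta>. a 0 / \<tau>0\<^sup>2 + X n \<theta>)" if "\<mu> l = \<tau>0" "\<tau>0 = real n" for n
      using PQ[OF l] Qa[OF that(1)] YX[of l n] that \<nu>l by simp
    show "\<exists>n. \<mu> l = real n \<and> P l = X n" if "\<mu> l > \<tau>0 \<and> (\<forall>m\<ge>1. \<mu> l \<noteq> \<tau>0 + \<mu> m)"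
    proof -
      have ns: "\<nu> l \<noteq> \<tau>0 + \<nu> m" for m using that \<nu>l by (cases "m = 0") (auto simp: \<nu>_def)
      obtain n where "\<nu> l = real n" using \<nu>_not_shifted[OF ns] by blast
      then show ?thesis using Q0[OF ns] YX[of l n] \<nu>l by auto
    qed
    fix m assume m: "\<mu> l > \<tau>0 \<and> 1 \<le> m \<and> m < l \<and> \<mu> l = \<tau>0 + \<mu> m"
    then have "\<nu> l = \<tau>0 + \<nu> m" by (simp add: \<nu>_pos_eq)
    then have src: "source P l = coeff_rhs a \<mu> P m" using source_shift m by (simp add: nonlin_def)
    note cs = coeff_parts_circle_solution[OF QY[OF l] l, unfolded src]
    note un = coeff_parts_unique[OF QY[OF l] l, unfolded src]
    show "circle_solutions (\<mu> l) (coeff_rhs a \<mu> P m) = {P l}" if "\<mu> l \<notin> \<int>"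
    proof -
      have n: "\<mu> l \<noteq> real n" for n using that Ints_of_nat[of n] by metis
      then have Pl: "P l = Q l" using PQ[OF l] Y0[OF l] \<nu>l by simp
      have "R = Q l" if "R \<in> circle_solutions (\<mu> l) (coeff_rhs a \<mu> P m)" for R
        using un[OF that] n by blast
      then show ?thesis unfolding Pl by (intro eq_singletonI cs)
    qed
    show "\<exists>Q. {q \<in> circle_solutions (\<mu> l) (coeff_rhs a \<mu> P m).
                   \<forall>Y\<in>spherical_harmonics n. L2_circle_inner q Y = 0} = {Q} \<and>
                P l = (\<lambda>\<theta>. X n \<theta> + Q \<theta>)" if n: "\<mu> l = real n" for n
    proof (intro exI[of _ "Q l"] conjI)
      show "P l = (\<lambda>\<theta>. X n \<theta> + Q l \<theta>)" using PQ[OF l] YX[of l n] n \<nu>l by (simp add: add.commute)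
      show "{q \<in> circle_solutions (\<mu> l) (coeff_rhs a \<mu> P m).
                   \<forall>Y\<in>spherical_harmonics n. L2_circle_inner q Y = 0} = {Q l}"
      proof (rule eq_singletonI)
        show "Q l \<in> {q \<in> circle_solutions (\<mu> l) (coeff_rhs a \<mu> P m).
                   \<forall>Y\<in>spherical_harmonics n. L2_circle_inner q Y = 0}"
          using cs coeff_parts_orthogonal[OF QY[OF l] l n] by simp
        fix q assume "q \<in> {q \<in> circle_solutions (\<mu> l) (coeff_rhs a \<mu> P m).
                   \<forall>Y\<in>spherical_harmonics n. L2_circle_inner q Y = 0}"
        then have q: "q \<in> circle_solutions (\<mu> l) (coeff_rhs a \<mu> P m)"
          "\<forall>Y\<in>spherical_harmonics n. L2_circle_inner q Y = 0" by blast+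
        show "q = Q l" using un[OF q(1)] q(2) n by simp
      qed
    qed
  qed
  then show ?thesis using X unfolding is_coeff_sequence_def by blast
qed

text \<open>The remainder after \<open>l\<close> terms is known only at rate \<open>mid l\<close>,
  short of the claim. The sharp rate comes from the remainder after \<open>l + 1\<close> terms with
  the last term added back. The constant \<open>C + 1\<close> makes it positive.\<close>

lemma expansion_error:
  assumes P: "\<And>l. expansion_upto l P" and l: "l \<ge> 1"
  shows "\<exists>C>0. \<forall>t\<ge>t0. \<forall>\<theta>. \<bar>v t \<theta> - (\<Sum>j = 1..l. P j \<theta> * exp (- \<mu> j * t))\<bar> \<le> C * exp (- \<mu> (Suc l) * t)"
proof -
  have S: "partial_expansion l P t \<theta> = (\<Sum>j = 1..l. P j \<theta> * exp (- \<mu> j * t))" for t \<theta>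
    unfolding partial_expansion_def by (intro sum.cong) (auto simp: \<nu>_pos_eq)
  obtain Q Y where "coeff_parts P (Suc l) Q Y" using expansion_upto_parts[OF P, of "Suc l" "Suc l"] by fastforce
  then have T: "P (Suc l) \<in> trig_poly (\<nu> (Suc l))" by (rule coeff_parts_trig_poly)
  have "decays t0 (mid (Suc l)) (\<lambda>t \<theta>. v t \<theta> - partial_expansion (Suc l) P t \<theta>)"
    using P[of "Suc l"] by (simp add: expansion_upto_def)
  then have "decays t0 (\<nu> (Suc l)) (\<lambda>t \<theta>. v t \<theta> - partial_expansion (Suc l) P t \<theta>)"
    by (rule decays_mono[OF _ _ t0]) (use mid_bounds(1)[of "Suc l"] in simp)
  from decays_add[OF this decays_trig_poly[OF T]]
  have "decays t0 (\<nu> (Suc l)) (\<lambda>t \<theta>. v t \<theta> - partial_expansion l P t \<theta>)"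
    by (simp add: partial_expansion_def)
  then obtain C where C: "C \<ge> 0" "\<And>t \<theta>. t \<ge> t0 \<Longrightarrow> \<bar>v t \<theta> - partial_expansion l P t \<theta>\<bar> \<le> C * exp (- \<nu> (Suc l) * t)"
    by (rule decaysE) blast
  have "\<bar>v t \<theta> - (\<Sum>j = 1..l. P j \<theta> * exp (- \<mu> j * t))\<bar> \<le> (C + 1) * exp (- \<mu> (Suc l) * t)" if "t \<ge> t0" for t \<theta>
  proof -
    have "C * exp (- \<nu> (Suc l) * t) \<le> (C + 1) * exp (- \<nu> (Suc l) * t)" by (intro mult_right_mono) auto
    with C(2)[OF that, of \<theta>] have "\<bar>v t \<theta> - partial_expansion l P t \<theta>\<bar> \<le> (C + 1) * exp (- \<nu> (Suc l) * t)"
      by (rule order_trans)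
    then show ?thesis unfolding S by (simp add: \<nu>_pos_eq)
  qed
  then show ?thesis using C(1) by (intro exI[of _ "C + 1"]) simp
qed

end

theorem theorem4p1:
  fixes f :: "real \<Rightarrow> real" and v :: "real \<Rightarrow> real \<Rightarrow> real"
    and \<epsilon>0 \<tau>0 t0 :: real and \<mu> :: "nat \<Rightarrow> real"
  assumes "\<epsilon>0 > 0"
    and "smooth_on_open {-\<epsilon>0<..<\<epsilon>0} f"
    and "\<tau>0 > 0"
    and "is_index_sequence \<tau>0 \<mu>"
    and "t0 \<ge> 0"
    and "is_solution \<epsilon>0 \<tau>0 f t0 v"
    and "converges_exponentially t0 v"
  shows "\<exists>X :: nat \<Rightarrow> real \<Rightarrow> real.
           (\<forall>i\<ge>1. X i \<in> spherical_harmonics i) \<and>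
           (\<exists>P :: nat \<Rightarrow> real \<Rightarrow> real.
              is_coeff_sequence \<tau>0 (taylor_coeff f) \<mu> X P \<and>
              (\<forall>l\<ge>1. smooth_circle (P l)) \<and>
              (\<forall>l\<ge>1. \<exists>C>0. \<forall>t\<ge>t0. \<forall>\<theta>.
                 \<bar>v t \<theta> - (\<Sum>j = 1..l. P j \<theta> * exp (- \<mu> j * t))\<bar>
                   \<le> C * exp (- \<mu> (Suc l) * t)))"
proof -
  interpret expansion \<tau>0 \<mu> f v \<epsilon>0 t0
    by unfold_locales (use assms in auto)
  obtain P where P: "\<And>l. expansion_upto l P" using expansion_exists by blast
  have parts: "\<exists>Q Y. coeff_parts P l Q Y" if "l \<ge> 1" for l
    using expansion_upto_parts[OF P that order_refl] .
  obtain X where X: "\<forall>i\<ge>1. X i \<in> spherical_harmonics i" "is_coeff_sequence \<tau>0 (taylor_coeff f) \<mu> X P"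
    using coeff_sequence_exists[OF parts] by blast
  have "smooth_circle (P l)" if "l \<ge> 1" for l
    using parts[OF that] coeff_parts_trig_poly(1) trig_poly_smooth_circle by blast
  then show ?thesis using X expansion_error[OF P] by blast
qed

end
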